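(* Let $\Gamma$ be any countable group, let $n\in\mathbb N$, and let $\boldsymbol\alpha,\boldsymbol\beta\in2^\omega$ be such that $\boldsymbol\alpha(i)=\boldsymbol\beta(i)$ for all $i<n-1$, $\boldsymbol\alpha(n)=1$ and $\boldsymbol\beta(n)=0$. Let $\boldsymbol\beta^*\in2^\omega$ be such that $\boldsymbol\beta$ is the concatenation of $\boldsymbol\beta|(n+1)$ and $\boldsymbol\beta^*$. Set $m:=m(K_{\boldsymbol\beta^*}(\Gamma))$ and $r:=r_{n+1}(K_{\boldsymbol\beta^*}(\Gamma))$. Then $$\theta_{m,n+1}^{\mathcal M_{\boldsymbol\alpha}(\Gamma)}=0\quad\text{and}\quad\theta_{m,n+1}^{\mathcal M_{\boldsymbol\beta}(\Gamma)}\ge r.$$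
   Context: Groups. For a countable group $\Gamma$ and $i\ge 1$, let $\Gamma_i$ be a copy of $\Gamma$ and $\Lambda_i$ a copy of $\mathbb{Z}$; let $\tilde\Gamma=\bigoplus_{i\ge1}\Gamma_i$, $\tilde\Gamma_n=\bigoplus_{i\ge n}\Gamma_i$, and let $\pi_n:\Gamma\to\tilde\Gamma$ be the canonical embedding with image $\Gamma_n$. Let $S_\infty$ be the group of finitely supported permutations of $\{1,2,\dots\}$, acting on $\tilde\Gamma$ by permuting indices. Define $$T_0(\Gamma)=\langle\tilde\Gamma,(\Lambda_i)_{i\ge1}\mid[\Gamma_i,\Lambda_j]=0\text{ for }i\ge j\rangle,\qquad T_1(\Gamma)=\langle\tilde\Gamma\rtimes S_\infty,(\Lambda_i)_{i\ge1}\mid[\Gamma_i,\Lambda_j]=0\text{ for }i\ge j\rangle,$$ where $[\Gamma_i,\Lambda_j]=0$ means that $\Gamma_i$ and $\Lambda_j$ commute elementwise. Here $2^n$ is the set of functions $\{0,\dots,n-1\}\to\{0,1\}$, $2^\omega$ is the set of infinite $0$-$1$ sequences indexed by $0,1,2,\dots$, and $\boldsymbol\alpha|k$ is the restriction of $\boldsymbol\alpha$ to $\{0,\dots,k-1\}$; write $\alpha_i=\boldsymbol\alpha(i)$. Set $K_\emptyset(\Gamma)=\Gamma$ and $K_{\boldsymbol\alpha}(\Gamma)=(T_{\alpha_0}\circ T_{\alpha_1}\circ\cdots\circ T_{\alpha_{n-1}})(\Gamma)$ for $\boldsymbol\alpha\in2^n$. For $\boldsymbol\alpha\in2^\omega$,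 $K_{\boldsymbol\alpha}(\Gamma)$ is the inductive limit of the groups $K_{\boldsymbol\alpha|n}(\Gamma)$ along the embeddings $K_{\boldsymbol\alpha|n}(\Gamma)\to K_{\boldsymbol\alpha|(n+1)}(\Gamma)$ obtained by applying $T_{\alpha_0}\circ\cdots\circ T_{\alpha_{n-1}}$ to the inclusion $\Gamma\cong\Gamma_1\subseteq T_{\alpha_n}(\Gamma)$. $L(G)$ is the group von Neumann algebra of $G$ with its canonical trace, $u_g\in L(G)$ is the canonical unitary of $g\in G$, $\mathcal M^{\otimes t}$ is the $t$-fold von Neumann algebra tensor power, and $\mathcal M_{\boldsymbol\alpha}(\Gamma)=L(K_{\boldsymbol\alpha}(\Gamma))$. The number $m(\Gamma)$. For a countable nonamenable group $\Gamma$, fix $m(\Gamma)\in\mathbb N$ and $C(\Gamma)>0$ (known to exist) for which there are $g_1,\dots,g_{m(\Gamma)}\in\Gamma$ such that, for every tracial von Neumann algebra $Q$, every $n\ge1$, all unitaries $v_1,\dots,v_{m(\Gamma)}\in L(\tilde\Gamma_{n+1})\otimes Q$ and all $\zeta\in L(T_0(\Gamma))\otimes Q$, one has $\|\zeta\|_2\le C(\Gamma)\sum_{k=1}^{m(\Gamma)}\|u_{\pi_n(g_k)}\zeta-\zeta v_k\|_2$. Logic. Formulae are formulae of continuous logic in the language of tracial von Neumann algebras. Variables $X,Y,A$ (with subscripts) range over the operator-norm unit ball; variables $U,V$ (with subscripts) range over unitaries; $\vec U,\vec U_1,\vec U_2$ are pairs of unitary variables. $\theta^{\mathcal M}$ is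 the value of $\theta$ in $\mathcal M$; $\|x\|_2=\tau(x^*x)^{1/2}$, $d(x,y)=\|x-y\|_2$, $[x,y]=xy-yx$, and $r\mathbin{\dot-}s=\max(r-s,0)$. For a tuple $\vec a$ in $\mathcal M$, $C(\vec a)=A'\cap\mathcal M$, where $A$ is the subalgebra generated by the coordinates of $\vec a$. Unitaries $u,v$ in a II$_1$ factor $\mathcal M$ are a pair of good unitaries if for all $\zeta\in\mathcal M$, $\inf_{\eta\in C(u,v)}\|\zeta-\eta\|_2^2\le100(\|[\zeta,u]\|_2^2+\|[\zeta,v]\|_2^2)$. Set $\chi(X,U_1,U_2)=100(\|[X,U_1]\|_2^2+\|[X,U_2]\|_2^2)$. For $m\ge1$, $\psi_m(V_a,V_b)$ is $$\sup_{\vec X,\vec Y}\Big(\big(\inf_U\max_{1\le i,j\le m}\|[UX_iU^*,Y_j]\|_2\big)\mathbin{\dot-}2\max_{1\le i\le m}\sqrt{\chi(X_i,V_a,V_b)}\Big),$$ where $\vec X,\vec Y$ are $m$-tuples, and $\tau_m=\inf_{V_a,V_b}\psi_m(V_a,V_b)$. Set $$\varphi_{\mathrm{good}}(U_1,U_2)=\sup_X\inf_Y\max\big(\max_{i=1,2}\|[Y,U_i]\|_2,\ d(X,Y)\mathbin{\dot-}\sqrt{\chi(X,U_1,U_2)}\big).$$ Fix a formula $\varphi_{\le}(Y_1,Y_2,Y_3;\vec U)$ such that in every II$_1$ factor $\mathcal M$, for every pair $\vec u$ of good unitaries and all $y_1,y_2,y_3$, $\varphi_{\le}(\vec y;\vec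 u)^{\mathcal M}=\sup\{\max_{i=1,2,3}\|[x,y_i]\|_2: x\in C(\vec u),\ \|x\|\le1\}$. For each sentence $\theta$ in prenex normal form, fix a formula $\tilde\theta(\vec U_1,\vec U_2)$ such that for every II$_1$ factor $\mathcal M$ and pairs of good unitaries $\vec u_1,\vec u_2\in\mathcal M$ with $C(\vec u_2)\subseteq C(\vec u_1)$, $\tilde\theta(\vec u_1,\vec u_2)^{\mathcal M}=\theta^{C(\vec u_2)'\cap C(\vec u_1)}$ (such formulae exist; sentences are put in equivalent prenex normal form when needed). Given a sentence $\theta$, define $\theta_1=\theta$ and $$\theta_{n+1}=\inf_{\vec U_1}\max\Big(\varphi_{\mathrm{good}}(\vec U_1),\ \sup_A\inf_{\vec U_2}\max\big(\varphi_{\mathrm{good}}(\vec U_2),\ \varphi_{\le}(A,\vec U_1;\vec U_2),\ \widetilde{\theta_n}(\vec U_1,\vec U_2)\big)\Big).$$ Finally $\theta_{m,n}:=(\tau_m)_n$, i.e. the $n$-th sentence obtained starting from $\theta=\tau_m$. The numbers $r_n(\cdot)$. For each countable nonamenable group $\Delta$, $(r_n(\Delta))_{n\ge1}$ is a fixed sequence of positive reals such that for all $n,t\ge1$ and $\boldsymbol\gamma\in2^n$: $\theta_{m,n}^{L(K_{\boldsymbol\gamma}(\Delta))^{\otimes t}}=0$ for all $m\ge1$ if $\boldsymbol\gamma(n-1)=1$, and $\theta_{m(\Delta),n}^{L(K_{\boldsymbol\gamma}(\Delta))^{\otimes t}}\ge r_n(\Delta)$ if $\boldsymbol\gamma(n-1)=0$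 (such a sequence exists). The group $K_{\boldsymbol\beta^*}(\Gamma)$ is countable and nonamenable, so $m(K_{\boldsymbol\beta^*}(\Gamma))$ and $r_{n+1}(K_{\boldsymbol\beta^*}(\Gamma))$ are defined. *)

theory Defs
  imports
    "HOL-Analysis.Analysis"
    "HOL-Algebra.Product_Groups"
    "HOL-Combinatorics.Permutations"
    "HOL-Library.Function_Algebras"
    "HOL-Library.Infinite_Typeclass"
    "HOL-Library.Omega_Words_Fun"
begin

section \<open>Groups\<close>

subsection \<open>The groups \<open>T\<^sub>0(\<Gamma>)\<close> and \<open>T\<^sub>1(\<Gamma>)\<close>\<close>

text \<open>The index set of all direct sums is \<open>{1, 2, \<dots>}\<close>.\<close>

definition tilde_group :: "'a monoid \<Rightarrow> (nat \<Rightarrow> 'a) monoid" where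
  "tilde_group \<Gamma> = sum_group {1..} (\<lambda>_. \<Gamma>)"

definition copy_emb :: "'a monoid \<Rightarrow> nat \<Rightarrow> 'a \<Rightarrow> (nat \<Rightarrow> 'a)" where
  "copy_emb \<Gamma> n g = (\<lambda>i\<in>{1..}. if i = n then g else \<one>\<^bsub>\<Gamma>\<^esub>)"

definition tilde_tail :: "'a monoid \<Rightarrow> nat \<Rightarrow> (nat \<Rightarrow> 'a) set" where
  "tilde_tail \<Gamma> n = {x \<in> carrier (tilde_group \<Gamma>). \<forall>i\<in>{1..<n}. x i = \<one>\<^bsub>\<Gamma>\<^esub>}"

definition fin_perms :: "(nat \<Rightarrow> nat) set" where
  "fin_perms = {\<sigma>. \<sigma> permutes {1..} \<and> finite {i. \<sigma> i \<noteq> i}}"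

definition perm_act :: "(nat \<Rightarrow> nat) \<Rightarrow> (nat \<Rightarrow> 'a) \<Rightarrow> (nat \<Rightarrow> 'a)" where
  "perm_act \<sigma> x = (\<lambda>i\<in>{1..}. x (inv_into UNIV \<sigma> i))"

definition tilde_semidirect :: "'a monoid \<Rightarrow> ((nat \<Rightarrow> 'a) \<times> (nat \<Rightarrow> nat)) monoid" where
  "tilde_semidirect \<Gamma> =
     \<lparr>carrier = carrier (tilde_group \<Gamma>) \<times> fin_perms,
      monoid.mult = (\<lambda>(x, \<sigma>) (y, \<rho>). (x \<otimes>\<^bsub>tilde_group \<Gamma>\<^esub> perm_act \<sigma> y, \<sigma> \<circ> \<rho>)),
      one = (\<one>\<^bsub>tilde_group \<Gamma>\<^esub>, id)\<rparr>"

text \<open>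
  For a group \<open>H\<close> and subsets \<open>D j\<close> of it, \<open>presented H D\<close> is the group
  \<open>\<langle>H, (\<Lambda>\<^sub>j)\<^bsub>j\<ge>1\<^esub> | [D j, \<Lambda>\<^sub>j] = 0\<rangle>\<close>, where each \<open>\<Lambda>\<^sub>j\<close> is a copy of the integers:
  words in the elements of \<open>H\<close> and of the \<open>\<Lambda>\<^sub>j\<close>, modulo the congruence generated by the
  multiplication tables of these groups and by the commutation relations.
  \<open>Lam j k\<close> is the element \<open>k\<close> of \<open>\<Lambda>\<^sub>j\<close>.
\<close>

datatype 'h letter = Grp 'h | Lam nat int

inductive word_eq :: "'h monoid \<Rightarrow> (nat \<Rightarrow> 'h set) \<Rightarrow> 'h letter list \<Rightarrow> 'h letter list \<Rightarrow> bool"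
  for H :: "'h monoid" and D :: "nat \<Rightarrow> 'h set" where
  refl: "word_eq H D w w"
| sym: "word_eq H D v w \<Longrightarrow> word_eq H D w v"
| trans: "word_eq H D u v \<Longrightarrow> word_eq H D v w \<Longrightarrow> word_eq H D u w"
| cong: "word_eq H D v w \<Longrightarrow> word_eq H D (p @ v @ q) (p @ w @ q)"
| grp_one: "word_eq H D [Grp \<one>\<^bsub>H\<^esub>] []"
| grp_mult: "x \<in> carrier H \<Longrightarrow> y \<in> carrier H \<Longrightarrow> word_eq H D [Grp x, Grp y] [Grp (x \<otimes>\<^bsub>H\<^esub> y)]"
| lam_zero: "1 \<le> j \<Longrightarrow> word_eq H D [Lam j 0] []"
| lam_add: "1 \<le> j \<Longrightarrow> word_eq H D [Lam j k, Lam j l] [Lam j (k + l)]"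
| comm: "1 \<le> j \<Longrightarrow> x \<in> D j \<Longrightarrow> word_eq H D [Grp x, Lam j k] [Lam j k, Grp x]"

definition word_class :: "'h monoid \<Rightarrow> (nat \<Rightarrow> 'h set) \<Rightarrow> 'h letter list \<Rightarrow> 'h letter list set" where
  "word_class H D w = {v. word_eq H D w v}"

definition letters :: "'h monoid \<Rightarrow> 'h letter set" where
  "letters H = Grp ` carrier H \<union> {Lam j k | j k. 1 \<le> j}"

definition presented :: "'h monoid \<Rightarrow> (nat \<Rightarrow> 'h set) \<Rightarrow> 'h letter list set monoid" where
  "presented H D =
     \<lparr>carrier = word_class H D ` lists (letters H),
      monoid.mult = (\<lambda>A B. \<Union>a\<in>A. \<Union>b\<in>B. word_class H D (a @ b)),
      one = word_class H D []\<rparr>"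

definition T0_comm :: "'a monoid \<Rightarrow> nat \<Rightarrow> (nat \<Rightarrow> 'a) set" where
  "T0_comm \<Gamma> j = (\<Union>i\<in>{j..}. copy_emb \<Gamma> i ` carrier \<Gamma>)"

definition T0 :: "'a monoid \<Rightarrow> (nat \<Rightarrow> 'a) letter list set monoid" where
  "T0 \<Gamma> = presented (tilde_group \<Gamma>) (T0_comm \<Gamma>)"

definition T0_incl :: "'a monoid \<Rightarrow> (nat \<Rightarrow> 'a) \<Rightarrow> (nat \<Rightarrow> 'a) letter list set" where
  "T0_incl \<Gamma> x = word_class (tilde_group \<Gamma>) (T0_comm \<Gamma>) [Grp x]"

definition T1_comm :: "'a monoid \<Rightarrow> nat \<Rightarrow> ((nat \<Rightarrow> 'a) \<times> (nat \<Rightarrow> nat)) set" where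
  "T1_comm \<Gamma> j = (\<lambda>x. (x, id)) ` T0_comm \<Gamma> j"

definition T1 :: "'a monoid \<Rightarrow> ((nat \<Rightarrow> 'a) \<times> (nat \<Rightarrow> nat)) letter list set monoid" where
  "T1 \<Gamma> = presented (tilde_semidirect \<Gamma>) (T1_comm \<Gamma>)"

definition T1_incl ::
  "'a monoid \<Rightarrow> (nat \<Rightarrow> 'a) \<Rightarrow> ((nat \<Rightarrow> 'a) \<times> (nat \<Rightarrow> nat)) letter list set" where
  "T1_incl \<Gamma> x = word_class (tilde_semidirect \<Gamma>) (T1_comm \<Gamma>) [Grp (x, id)]"

text \<open>The action of \<open>T\<^sub>0\<close> and \<open>T\<^sub>1\<close> on a homomorphism \<open>f\<close> into \<open>\<Delta>\<close>.\<close>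

definition tilde_map :: "('a \<Rightarrow> 'b) \<Rightarrow> (nat \<Rightarrow> 'a) \<Rightarrow> (nat \<Rightarrow> 'b)" where
  "tilde_map f x = (\<lambda>i\<in>{1..}. f (x i))"

definition T0_map ::
  "'b monoid \<Rightarrow> ('a \<Rightarrow> 'b) \<Rightarrow> (nat \<Rightarrow> 'a) letter list set \<Rightarrow> (nat \<Rightarrow> 'b) letter list set" where
  "T0_map \<Delta> f W =
     (\<Union>w\<in>W. word_class (tilde_group \<Delta>) (T0_comm \<Delta>) (map (map_letter (tilde_map f)) w))"

definition T1_map ::
  "'b monoid \<Rightarrow> ('a \<Rightarrow> 'b) \<Rightarrow> ((nat \<Rightarrow> 'a) \<times> (nat \<Rightarrow> nat)) letter list set
    \<Rightarrow> ((nat \<Rightarrow> 'b) \<times> (nat \<Rightarrow> nat)) letter list set" where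
  "T1_map \<Delta> f W =
     (\<Union>w\<in>W. word_class (tilde_semidirect \<Delta>) (T1_comm \<Delta>)
               (map (map_letter (map_prod (tilde_map f) id)) w))"

subsection \<open>Iterating: \<open>K\<^sub>\<alpha>(\<Gamma>)\<close>\<close>

text \<open>
  The carrier types of \<open>T0 \<Gamma>\<close> and \<open>T1 \<Gamma>\<close> differ from that of \<open>\<Gamma>\<close>. To iterate these
  constructions, every countable group is replaced by an isomorphic copy whose carrier is a set of
  natural numbers. The values 1 and 0 of a binary sequence are \<open>True\<close> and \<open>False\<close>.
\<close>

definition nat_copy :: "'a monoid \<Rightarrow> nat monoid" where
  "nat_copy G =
     \<lparr>carrier = to_nat_on (carrier G) ` carrier G,
      monoid.mult = (\<lambda>x y. to_nat_on (carrier G)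
         (from_nat_into (carrier G) x \<otimes>\<^bsub>G\<^esub> from_nat_into (carrier G) y)),
      one = to_nat_on (carrier G) \<one>\<^bsub>G\<^esub>\<rparr>"

definition T_nat :: "bool \<Rightarrow> nat monoid \<Rightarrow> nat monoid" where
  "T_nat b \<Gamma> = (if b then nat_copy (T1 \<Gamma>) else nat_copy (T0 \<Gamma>))"

definition T_map :: "bool \<Rightarrow> nat monoid \<Rightarrow> nat monoid \<Rightarrow> (nat \<Rightarrow> nat) \<Rightarrow> nat \<Rightarrow> nat" where
  "T_map b \<Gamma> \<Delta> f x =
     (if b then to_nat_on (carrier (T1 \<Delta>)) (T1_map \<Delta> f (from_nat_into (carrier (T1 \<Gamma>)) x))
      else to_nat_on (carrier (T0 \<Delta>)) (T0_map \<Delta> f (from_nat_into (carrier (T0 \<Gamma>)) x)))"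

text \<open>The inclusion of \<open>\<Gamma> \<cong> \<Gamma>\<^sub>1\<close> in \<open>T_nat b \<Gamma>\<close>.\<close>

definition T_emb :: "bool \<Rightarrow> nat monoid \<Rightarrow> nat \<Rightarrow> nat" where
  "T_emb b \<Gamma> g =
     (if b then to_nat_on (carrier (T1 \<Gamma>)) (T1_incl \<Gamma> (copy_emb \<Gamma> 1 g))
      else to_nat_on (carrier (T0 \<Gamma>)) (T0_incl \<Gamma> (copy_emb \<Gamma> 1 g)))"

fun T_iter :: "bool list \<Rightarrow> nat monoid \<Rightarrow> nat monoid" where
  "T_iter [] \<Gamma> = \<Gamma>"
| "T_iter (b # bs) \<Gamma> = T_nat b (T_iter bs \<Gamma>)"

fun T_iter_map :: "bool list \<Rightarrow> nat monoid \<Rightarrow> nat monoid \<Rightarrow> (nat \<Rightarrow> nat) \<Rightarrow> nat \<Rightarrow> nat" where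
  "T_iter_map [] \<Gamma> \<Delta> f = f"
| "T_iter_map (b # bs) \<Gamma> \<Delta> f = T_map b (T_iter bs \<Gamma>) (T_iter bs \<Delta>) (T_iter_map bs \<Gamma> \<Delta> f)"

definition K_fin :: "bool list \<Rightarrow> 'a monoid \<Rightarrow> nat monoid" where
  "K_fin bs \<Gamma> = T_iter bs (nat_copy \<Gamma>)"

definition K_step :: "bool word \<Rightarrow> 'a monoid \<Rightarrow> nat \<Rightarrow> nat \<Rightarrow> nat" where
  "K_step \<alpha> \<Gamma> n =
     T_iter_map (prefix n \<alpha>) (nat_copy \<Gamma>) (T_nat (\<alpha> n) (nat_copy \<Gamma>)) (T_emb (\<alpha> n) (nat_copy \<Gamma>))"

text \<open>Inductive limit of a sequence of groups \<open>G n\<close> along homomorphisms \<open>f n\<close> from \<open>G n\<close> to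
  \<open>G (n + 1)\<close>, as a quotient of the disjoint union.\<close>

fun push :: "(nat \<Rightarrow> 'a \<Rightarrow> 'a) \<Rightarrow> nat \<Rightarrow> nat \<Rightarrow> 'a \<Rightarrow> 'a" where
  "push f n 0 x = x"
| "push f n (Suc d) x = f (n + d) (push f n d x)"

definition lim_class ::
  "(nat \<Rightarrow> 'a monoid) \<Rightarrow> (nat \<Rightarrow> 'a \<Rightarrow> 'a) \<Rightarrow> nat \<Rightarrow> 'a \<Rightarrow> (nat \<times> 'a) set" where
  "lim_class G f n x =
     {(k, y). y \<in> carrier (G k) \<and> (\<exists>N\<ge>max n k. push f n (N - n) x = push f k (N - k) y)}"

definition lim_group ::
  "(nat \<Rightarrow> 'a monoid) \<Rightarrow> (nat \<Rightarrow> 'a \<Rightarrow> 'a) \<Rightarrow> (nat \<times> 'a) set monoid" where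
  "lim_group G f =
     \<lparr>carrier = {lim_class G f n x | n x. x \<in> carrier (G n)},
      monoid.mult = (\<lambda>A B. \<Union>{lim_class G f n (x \<otimes>\<^bsub>G n\<^esub> y) | n x y. (n, x) \<in> A \<and> (n, y) \<in> B}),
      one = lim_class G f 0 \<one>\<^bsub>G 0\<^esub>\<rparr>"

definition K_lim :: "bool word \<Rightarrow> 'a monoid \<Rightarrow> nat monoid" where
  "K_lim \<alpha> \<Gamma> = nat_copy (lim_group (\<lambda>n. K_fin (prefix n \<alpha>) \<Gamma>) (K_step \<alpha> \<Gamma>))"

definition amenable :: "'a monoid \<Rightarrow> bool" where
  "amenable G \<longleftrightarrow>
     (\<exists>\<mu> :: 'a set \<Rightarrow> real.
        (\<forall>A\<subseteq>carrier G. 0 \<le> \<mu> A) \<and> \<mu> (carrier G) = 1 \<and>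
        (\<forall>A\<subseteq>carrier G. \<forall>B\<subseteq>carrier G. A \<inter> B = {} \<longrightarrow> \<mu> (A \<union> B) = \<mu> A + \<mu> B) \<and>
        (\<forall>g\<in>carrier G. \<forall>A\<subseteq>carrier G. \<mu> (g <#\<^bsub>G\<^esub> A) = \<mu> A))"


section \<open>Tracial von Neumann algebras\<close>

subsection \<open>Operators on \<open>\<ell>\<^sup>2(X)\<close>\<close>

text \<open>
  Every Hilbert space is isomorphic to \<open>\<ell>\<^sup>2(X)\<close> for some set \<open>X\<close>. A bounded operator on
  \<open>\<ell>\<^sup>2(X)\<close> is identified with its matrix in the standard orthonormal basis, extended by 0
  outside \<open>X \<times> X\<close>. Sums and differences of operators are pointwise; the product is \<open>\<star>\<close>, not the
  pointwise \<open>*\<close>. The sum in the matrix product converges absolutely for bounded operators.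
\<close>

type_synonym 'i op = "'i \<Rightarrow> 'i \<Rightarrow> complex"

definition norm_le :: "'i set \<Rightarrow> 'i op \<Rightarrow> real \<Rightarrow> bool" where
  "norm_le X a B \<longleftrightarrow>
     (\<forall>F x y. finite F \<and> F \<subseteq> X \<longrightarrow>
        cmod (\<Sum>i\<in>F. \<Sum>j\<in>F. cnj (x i) * a i j * y j)
          \<le> B * L2_set (\<lambda>i. cmod (x i)) F * L2_set (\<lambda>j. cmod (y j)) F)"

definition bounded_ops :: "'i set \<Rightarrow> 'i op set" where
  "bounded_ops X = {a. (\<forall>i j. i \<notin> X \<or> j \<notin> X \<longrightarrow> a i j = 0) \<and> (\<exists>B. norm_le X a B)}"

definition op_mult :: "'i op \<Rightarrow> 'i op \<Rightarrow> 'i op" (infixl "\<star>" 70) where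
  "a \<star> b = (\<lambda>i j. \<Sum>\<^sub>\<infinity>k. a i k * b k j)"

definition op_adj :: "'i op \<Rightarrow> 'i op" where
  "op_adj a = (\<lambda>i j. cnj (a j i))"

definition op_scale :: "complex \<Rightarrow> 'i op \<Rightarrow> 'i op" where
  "op_scale c a = (\<lambda>i j. c * a i j)"

definition op_one :: "'i set \<Rightarrow> 'i op" where
  "op_one X = (\<lambda>i j. if i = j \<and> i \<in> X then 1 else 0)"

definition commutant :: "'i set \<Rightarrow> 'i op set \<Rightarrow> 'i op set" where
  "commutant X S = {a \<in> bounded_ops X. \<forall>s\<in>S. a \<star> s = s \<star> a}"

text \<open>By the bicommutant theorem, this is the von Neumann algebra generated by \<open>S\<close>.\<close>

definition vN_gen :: "'i set \<Rightarrow> 'i op set \<Rightarrow> 'i op set" where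
  "vN_gen X S = commutant X (commutant X (S \<union> op_adj ` S))"

definition von_neumann_algebra :: "'i set \<Rightarrow> 'i op set \<Rightarrow> bool" where
  "von_neumann_algebra X M \<longleftrightarrow>
     M \<subseteq> bounded_ops X \<and> op_adj ` M \<subseteq> M \<and> commutant X (commutant X M) = M"

text \<open>The ultraweakly continuous functionals \<open>a \<mapsto> \<Sum>\<^sub>n \<langle>a \<xi>\<^sub>n, \<eta>\<^sub>n\<rangle>\<close>.\<close>

definition ultraweakly_continuous :: "'i op set \<Rightarrow> ('i op \<Rightarrow> complex) \<Rightarrow> bool" where
  "ultraweakly_continuous M \<tau> \<longleftrightarrow>
     (\<exists>\<xi> \<eta> :: nat \<Rightarrow> 'i \<Rightarrow> complex.
        (\<lambda>(n, i). (cmod (\<xi> n i))\<^sup>2) summable_on UNIV \<and>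
        (\<lambda>(n, i). (cmod (\<eta> n i))\<^sup>2) summable_on UNIV \<and>
        (\<forall>a\<in>M. \<tau> a = (\<Sum>\<^sub>\<infinity>n. \<Sum>\<^sub>\<infinity>i. cnj (\<eta> n i) * (\<Sum>\<^sub>\<infinity>j. a i j * \<xi> n j))))"

record 'i tvna =
  base :: "'i set"
  ops :: "'i op set"
  trc :: "'i op \<Rightarrow> complex"

text \<open>A von Neumann algebra with a faithful normal tracial state. Only the values of \<open>trc M\<close> on
  \<open>ops M\<close> matter.\<close>

definition tracial_vna :: "'i tvna \<Rightarrow> bool" where
  "tracial_vna M \<longleftrightarrow>
     von_neumann_algebra (base M) (ops M) \<and>
     (\<forall>a\<in>ops M. \<forall>b\<in>ops M. trc M (a + b) = trc M a + trc M b) \<and>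
     (\<forall>c. \<forall>a\<in>ops M. trc M (op_scale c a) = c * trc M a) \<and>
     trc M (op_one (base M)) = 1 \<and>
     (\<forall>a\<in>ops M. trc M (op_adj a \<star> a) \<in> \<real>\<^sub>\<ge>\<^sub>0) \<and>
     (\<forall>a\<in>ops M. trc M (op_adj a \<star> a) = 0 \<longrightarrow> a = 0) \<and>
     (\<forall>a\<in>ops M. \<forall>b\<in>ops M. trc M (a \<star> b) = trc M (b \<star> a)) \<and>
     ultraweakly_continuous (ops M) (trc M)"

definition II1_factor :: "'i tvna \<Rightarrow> bool" where
  "II1_factor M \<longleftrightarrow>
     tracial_vna M \<and>
     (\<forall>z\<in>ops M \<inter> commutant (base M) (ops M). \<exists>c. z = op_scale c (op_one (base M))) \<and>
     \<not> (\<exists>F. finite F \<and> (\<forall>a\<in>ops M. \<exists>c. a = (\<Sum>f\<in>F. op_scale (c f) f)))"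

definition norm2 :: "'i tvna \<Rightarrow> 'i op \<Rightarrow> real" where
  "norm2 M a = sqrt (Re (trc M (op_adj a \<star> a)))"

definition unit_ball :: "'i tvna \<Rightarrow> 'i op set" where
  "unit_ball M = {a \<in> ops M. norm_le (base M) a 1}"

definition unitary_op :: "'i set \<Rightarrow> 'i op \<Rightarrow> bool" where
  "unitary_op X u \<longleftrightarrow> op_adj u \<star> u = op_one X \<and> u \<star> op_adj u = op_one X"

definition unitaries :: "'i tvna \<Rightarrow> 'i op set" where
  "unitaries M = {u \<in> ops M. unitary_op (base M) u}"

definition op_comm :: "'i op \<Rightarrow> 'i op \<Rightarrow> 'i op" where
  "op_comm a b = a \<star> b - b \<star> a"

definition rel_comm :: "'i tvna \<Rightarrow> 'i op \<times> 'i op \<Rightarrow> 'i op set" where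
  "rel_comm M = (\<lambda>(a, b). commutant (base M) (vN_gen (base M) {a, b}) \<inter> ops M)"

definition good_unitaries :: "'i tvna \<Rightarrow> 'i op \<times> 'i op \<Rightarrow> bool" where
  "good_unitaries M = (\<lambda>(u, v).
     u \<in> unitaries M \<and> v \<in> unitaries M \<and>
     (\<forall>\<zeta>\<in>ops M. (INF \<eta>\<in>rel_comm M (u, v). (norm2 M (\<zeta> - \<eta>))\<^sup>2)
        \<le> 100 * ((norm2 M (op_comm \<zeta> u))\<^sup>2 + (norm2 M (op_comm \<zeta> v))\<^sup>2)))"

subsection \<open>Tensor products\<close>

definition kron :: "'i op \<Rightarrow> 'j op \<Rightarrow> ('i \<times> 'j) op" where
  "kron a b = (\<lambda>(i, k) (j, l). a i j * b k l)"

definition tensor_ops ::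
  "'i set \<Rightarrow> 'i op set \<Rightarrow> 'j set \<Rightarrow> 'j op set \<Rightarrow> ('i \<times> 'j) op set" where
  "tensor_ops X M Y N = vN_gen (X \<times> Y) {kron a b | a b. a \<in> M \<and> b \<in> N}"

text \<open>The trace of a tensor product is determined on the algebra by its values on elementary
  tensors.\<close>

definition tensor :: "'i tvna \<Rightarrow> 'j tvna \<Rightarrow> ('i \<times> 'j) tvna" where
  "tensor M N =
    (let X = base M \<times> base N; A = tensor_ops (base M) (ops M) (base N) (ops N)
     in \<lparr>base = X, ops = A,
         trc = (SOME \<sigma>. tracial_vna \<lparr>base = X, ops = A, trc = \<sigma>\<rparr> \<and>
                  (\<forall>a\<in>ops M. \<forall>b\<in>ops N. \<sigma> (kron a b) = trc M a * trc N b))\<rparr>)"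

definition kron_list :: "'i op list \<Rightarrow> 'i list op" where
  "kron_list as = (\<lambda>xs ys.
     if length xs = length as \<and> length ys = length as
     then \<Prod>k<length as. (as ! k) (xs ! k) (ys ! k) else 0)"

definition tensor_power :: "'i tvna \<Rightarrow> nat \<Rightarrow> 'i list tvna" where
  "tensor_power M t =
    (let X = {xs. length xs = t \<and> set xs \<subseteq> base M};
         E = {as. length as = t \<and> set as \<subseteq> ops M};
         A = vN_gen X (kron_list ` E)
     in \<lparr>base = X, ops = A,
         trc = (SOME \<sigma>. tracial_vna \<lparr>base = X, ops = A, trc = \<sigma>\<rparr> \<and>
                  (\<forall>as\<in>E. \<sigma> (kron_list as) = (\<Prod>a\<leftarrow>as. trc M a)))\<rparr>)"

subsection \<open>Group von Neumann algebras\<close>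

text \<open>The canonical unitary \<open>u\<^sub>g\<close>: left translation \<open>\<delta>\<^sub>y \<mapsto> \<delta>\<^bsub>gy\<^esub>\<close> on \<open>\<ell>\<^sup>2(G)\<close>.\<close>

definition translation :: "'a monoid \<Rightarrow> 'a \<Rightarrow> 'a op" where
  "translation G g =
     (\<lambda>x y. if x \<in> carrier G \<and> y \<in> carrier G \<and> x = g \<otimes>\<^bsub>G\<^esub> y then 1 else 0)"

text \<open>The algebra of a subgroup \<open>S\<close> of \<open>G\<close>, inside that of \<open>G\<close>.\<close>

definition subgroup_ops :: "'a monoid \<Rightarrow> 'a set \<Rightarrow> 'a op set" where
  "subgroup_ops G S = vN_gen (carrier G) (translation G ` S)"

definition group_vna :: "'a monoid \<Rightarrow> 'a tvna" where
  "group_vna G =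
     \<lparr>base = carrier G, ops = subgroup_ops G (carrier G), trc = (\<lambda>a. a \<one>\<^bsub>G\<^esub> \<one>\<^bsub>G\<^esub>)\<rparr>"

text \<open>
  The type argument \<open>'h\<close>, here and below, bounds the size of the algebras under consideration: they
  act on \<open>\<ell>\<^sup>2(X)\<close> for an arbitrary set \<open>X\<close> of elements of \<open>'h\<close>.
\<close>

definition nonamenability_constants :: "'h itself \<Rightarrow> nat monoid \<Rightarrow> nat \<Rightarrow> real \<Rightarrow> bool" where
  "nonamenability_constants _ \<Gamma> m C \<longleftrightarrow>
     C > 0 \<and>
     (\<exists>g. (\<forall>k\<in>{1..m}. g k \<in> carrier \<Gamma>) \<and>
        (\<forall>(Q :: 'h tvna) n v \<zeta>.
           tracial_vna Q \<and> n \<ge> 1 \<and>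
           (\<forall>k\<in>{1..m}.
              v k \<in> tensor_ops (carrier (T0 \<Gamma>))
                       (subgroup_ops (T0 \<Gamma>) (T0_incl \<Gamma> ` tilde_tail \<Gamma> (n + 1))) (base Q) (ops Q) \<and>
              unitary_op (carrier (T0 \<Gamma>) \<times> base Q) (v k)) \<and>
           \<zeta> \<in> ops (tensor (group_vna (T0 \<Gamma>)) Q) \<longrightarrow>
           (let M = tensor (group_vna (T0 \<Gamma>)) Q;
                u = (\<lambda>k. kron (translation (T0 \<Gamma>) (T0_incl \<Gamma> (copy_emb \<Gamma> n (g k))))
                              (op_one (base Q)))
            in norm2 M \<zeta> \<le> C * (\<Sum>k=1..m. norm2 M (u k \<star> \<zeta> - \<zeta> \<star> v k)))))"


section \<open>Continuous logic\<close>

text \<open>The variables \<open>X\<^sub>i\<close>, \<open>Y\<^sub>i\<close>, \<open>A\<close>, \<open>V\<^sub>i\<close>, and \<open>U\<close> with a pair of indices: \<open>VU i 1\<close> and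
  \<open>VU i 2\<close> are the coordinates of the pair \<open>U\<^sub>i\<close>; \<open>VU 0 0\<close> is a single variable \<open>U\<close>.\<close>

datatype var = VX nat | VY nat | VA | VU nat nat | VV nat

datatype trm =
    Var var
  | Zero
  | One
  | Add trm trm
  | Mul trm trm
  | Adj trm
  | Scale complex trm

text \<open>\<open>Quant_Ball\<close> is the operator-norm unit ball. A connective is a continuous function
  of the values of finitely many formulae; it is encoded as a function on sequences, the values being
  padded by 0. Continuity refers to the product topology.\<close>

datatype qrange = Quant_Ball | Quant_Unitary

datatype fm =
    Re_Trace trm
  | Im_Trace trm
  | Dist trm trm
  | Conn "(nat \<Rightarrow> real) \<Rightarrow> real" "fm list"
  | QSup qrange var fm
  | QInf qrange var fm

fun wf_fm :: "fm \<Rightarrow> bool" where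
  "wf_fm (Conn f \<phi>s) \<longleftrightarrow> continuous_on UNIV f \<and> (\<forall>\<phi>\<in>set \<phi>s. wf_fm \<phi>)"
| "wf_fm (QSup q x \<phi>) \<longleftrightarrow> wf_fm \<phi>"
| "wf_fm (QInf q x \<phi>) \<longleftrightarrow> wf_fm \<phi>"
| "wf_fm _ \<longleftrightarrow> True"

fun fv_trm :: "trm \<Rightarrow> var set" where
  "fv_trm (Var x) = {x}"
| "fv_trm Zero = {}"
| "fv_trm One = {}"
| "fv_trm (Add s t) = fv_trm s \<union> fv_trm t"
| "fv_trm (Mul s t) = fv_trm s \<union> fv_trm t"
| "fv_trm (Adj t) = fv_trm t"
| "fv_trm (Scale c t) = fv_trm t"

fun fv :: "fm \<Rightarrow> var set" where
  "fv (Re_Trace t) = fv_trm t"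
| "fv (Im_Trace t) = fv_trm t"
| "fv (Dist s t) = fv_trm s \<union> fv_trm t"
| "fv (Conn f \<phi>s) = (\<Union>\<phi>\<in>set \<phi>s. fv \<phi>)"
| "fv (QSup q x \<phi>) = fv \<phi> - {x}"
| "fv (QInf q x \<phi>) = fv \<phi> - {x}"

definition is_sentence :: "fm \<Rightarrow> bool" where
  "is_sentence \<theta> \<longleftrightarrow> wf_fm \<theta> \<and> fv \<theta> = {}"

fun quant_free :: "fm \<Rightarrow> bool" where
  "quant_free (Conn f \<phi>s) \<longleftrightarrow> (\<forall>\<phi>\<in>set \<phi>s. quant_free \<phi>)"
| "quant_free (QSup q x \<phi>) \<longleftrightarrow> False"
| "quant_free (QInf q x \<phi>) \<longleftrightarrow> False"
| "quant_free _ \<longleftrightarrow> True"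

fun prenex :: "fm \<Rightarrow> bool" where
  "prenex (QSup q x \<phi>) \<longleftrightarrow> prenex \<phi>"
| "prenex (QInf q x \<phi>) \<longleftrightarrow> prenex \<phi>"
| "prenex \<phi> \<longleftrightarrow> quant_free \<phi>"

fun eval_trm :: "'i tvna \<Rightarrow> (var \<Rightarrow> 'i op) \<Rightarrow> trm \<Rightarrow> 'i op" where
  "eval_trm M e (Var x) = e x"
| "eval_trm M e Zero = 0"
| "eval_trm M e One = op_one (base M)"
| "eval_trm M e (Add s t) = eval_trm M e s + eval_trm M e t"
| "eval_trm M e (Mul s t) = eval_trm M e s \<star> eval_trm M e t"
| "eval_trm M e (Adj t) = op_adj (eval_trm M e t)"
| "eval_trm M e (Scale c t) = op_scale c (eval_trm M e t)"

fun quant_dom :: "'i tvna \<Rightarrow> qrange \<Rightarrow> 'i op set" where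
  "quant_dom M Quant_Ball = unit_ball M"
| "quant_dom M Quant_Unitary = unitaries M"

fun eval_fm :: "'i tvna \<Rightarrow> (var \<Rightarrow> 'i op) \<Rightarrow> fm \<Rightarrow> real" where
  "eval_fm M e (Re_Trace t) = Re (trc M (eval_trm M e t))"
| "eval_fm M e (Im_Trace t) = Im (trc M (eval_trm M e t))"
| "eval_fm M e (Dist s t) = norm2 M (eval_trm M e s - eval_trm M e t)"
| "eval_fm M e (Conn f \<phi>s) =
     f (\<lambda>i. if i < length \<phi>s then map (eval_fm M e) \<phi>s ! i else 0)"
| "eval_fm M e (QSup q x \<phi>) = (SUP a\<in>quant_dom M q. eval_fm M (e(x := a)) \<phi>)"
| "eval_fm M e (QInf q x \<phi>) = (INF a\<in>quant_dom M q. eval_fm M (e(x := a)) \<phi>)"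

text \<open>The value of a sentence.\<close>

definition value_in :: "'i tvna \<Rightarrow> fm \<Rightarrow> real" where
  "value_in M \<theta> = eval_fm M (\<lambda>_. 0) \<theta>"

subsection \<open>The formulae of the statement\<close>

definition trm_comm :: "trm \<Rightarrow> trm \<Rightarrow> trm" where
  "trm_comm s t = Add (Mul s t) (Scale (-1) (Mul t s))"

definition fm_norm2 :: "trm \<Rightarrow> fm" where
  "fm_norm2 t = Dist t Zero"

definition fm_max :: "fm list \<Rightarrow> fm" where
  "fm_max \<phi>s = Conn (\<lambda>v. Max (v ` {..<length \<phi>s})) \<phi>s"

definition fm_monus :: "fm \<Rightarrow> fm \<Rightarrow> fm" where
  "fm_monus \<phi> \<psi> = Conn (\<lambda>v. max (v 0 - v 1) 0) [\<phi>, \<psi>]"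

definition fm_scale :: "real \<Rightarrow> fm \<Rightarrow> fm" where
  "fm_scale c \<phi> = Conn (\<lambda>v. c * v 0) [\<phi>]"

definition fm_sqrt :: "fm \<Rightarrow> fm" where
  "fm_sqrt \<phi> = Conn (\<lambda>v. sqrt (v 0)) [\<phi>]"

definition QSups :: "qrange \<Rightarrow> var list \<Rightarrow> fm \<Rightarrow> fm" where
  "QSups q xs \<phi> = foldr (QSup q) xs \<phi>"

definition QInfs :: "qrange \<Rightarrow> var list \<Rightarrow> fm \<Rightarrow> fm" where
  "QInfs q xs \<phi> = foldr (QInf q) xs \<phi>"

definition chi :: "var \<Rightarrow> var \<Rightarrow> var \<Rightarrow> fm" where
  "chi x u1 u2 =
     Conn (\<lambda>v. 100 * ((v 0)\<^sup>2 + (v 1)\<^sup>2))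
       [fm_norm2 (trm_comm (Var x) (Var u1)), fm_norm2 (trm_comm (Var x) (Var u2))]"

definition psi :: "nat \<Rightarrow> var \<Rightarrow> var \<Rightarrow> fm" where
  "psi m va vb =
     QSups Quant_Ball (map VX [1..<Suc m] @ map VY [1..<Suc m])
       (fm_monus
         (QInf Quant_Unitary (VU 0 0)
            (fm_max [fm_norm2 (trm_comm
                       (Mul (Mul (Var (VU 0 0)) (Var (VX i))) (Adj (Var (VU 0 0)))) (Var (VY j))).
                     i \<leftarrow> [1..<Suc m], j \<leftarrow> [1..<Suc m]]))
         (fm_scale 2 (fm_max (map (\<lambda>i. fm_sqrt (chi (VX i) va vb)) [1..<Suc m]))))"

definition tau :: "nat \<Rightarrow> fm" where
  "tau m = QInfs Quant_Unitary [VV 1, VV 2] (psi m (VV 1) (VV 2))"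

definition phi_good :: "var \<Rightarrow> var \<Rightarrow> fm" where
  "phi_good u1 u2 =
     QSup Quant_Ball (VX 0) (QInf Quant_Ball (VY 0)
       (fm_max
         [fm_max [fm_norm2 (trm_comm (Var (VY 0)) (Var u1)), fm_norm2 (trm_comm (Var (VY 0)) (Var u2))],
          fm_monus (Dist (Var (VX 0)) (Var (VY 0))) (fm_sqrt (chi (VX 0) u1 u2))]))"

text \<open>
  Specification of \<open>\<phi>\<^sub>\<le>(Y\<^sub>1, Y\<^sub>2, Y\<^sub>3; U)\<close>. Its free variables are named as they are used below: \<open>VA\<close>,
  \<open>VU 1 1\<close>, \<open>VU 1 2\<close> stand for \<open>Y\<^sub>1\<close>, \<open>Y\<^sub>2\<close>, \<open>Y\<^sub>3\<close> (so they range over the unit ball here), and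
  \<open>VU 2 1\<close>, \<open>VU 2 2\<close> for the pair \<open>U\<close>.
\<close>

definition phi_le_spec :: "'h itself \<Rightarrow> fm \<Rightarrow> bool" where
  "phi_le_spec _ \<phi> \<longleftrightarrow>
     wf_fm \<phi> \<and> fv \<phi> \<subseteq> {VA, VU 1 1, VU 1 2, VU 2 1, VU 2 2} \<and>
     (\<forall>(M :: 'h tvna) u v e.
        II1_factor M \<and> good_unitaries M (u, v) \<and>
        {e VA, e (VU 1 1), e (VU 1 2)} \<subseteq> unit_ball M \<and> e (VU 2 1) = u \<and> e (VU 2 2) = v \<longrightarrow>
        eval_fm M e \<phi> =
          (SUP x\<in>rel_comm M (u, v) \<inter> unit_ball M.
             Max ((\<lambda>y. norm2 M (op_comm x y)) ` {e VA, e (VU 1 1), e (VU 1 2)})))"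

text \<open>
  Specification of \<open>\<theta> \<mapsto> \<theta>\<^sup>~\<close>. The free variables of \<open>\<theta>\<^sup>~\<close> are the coordinates of \<open>U\<^sub>1\<close>, \<open>U\<^sub>2\<close>.
\<close>

definition relativization_spec :: "'h itself \<Rightarrow> (fm \<Rightarrow> fm) \<Rightarrow> bool" where
  "relativization_spec _ rel \<longleftrightarrow>
     (\<forall>\<theta>. is_sentence \<theta> \<and> prenex \<theta> \<longrightarrow>
        wf_fm (rel \<theta>) \<and> fv (rel \<theta>) \<subseteq> {VU 1 1, VU 1 2, VU 2 1, VU 2 2} \<and>
        (\<forall>(M :: 'h tvna) u1 u2 e.
           II1_factor M \<and> good_unitaries M u1 \<and> good_unitaries M u2 \<and>
           rel_comm M u2 \<subseteq> rel_comm M u1 \<and>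
           u1 = (e (VU 1 1), e (VU 1 2)) \<and> u2 = (e (VU 2 1), e (VU 2 2)) \<longrightarrow>
           eval_fm M e (rel \<theta>) =
             value_in (M\<lparr>ops := commutant (base M) (rel_comm M u2) \<inter> rel_comm M u1\<rparr>) \<theta>))"

text \<open>
  A choice of equivalent prenex normal forms. With arbitrary continuous connectives a sentence need
  not have an exactly equivalent prenex form, whence the existence premise; without it the
  specification could be unsatisfiable.
\<close>

definition equivalent_fm :: "'h itself \<Rightarrow> fm \<Rightarrow> fm \<Rightarrow> bool" where
  "equivalent_fm _ \<theta> \<theta>' \<longleftrightarrow> (\<forall>M :: 'h tvna. tracial_vna M \<longrightarrow> value_in M \<theta> = value_in M \<theta>')"

definition prenex_form_spec :: "'h itself \<Rightarrow> (fm \<Rightarrow> fm) \<Rightarrow> bool" where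
  "prenex_form_spec ty pnf \<longleftrightarrow>
     (\<forall>\<theta>. is_sentence \<theta> \<and> (\<exists>\<theta>'. is_sentence \<theta>' \<and> prenex \<theta>' \<and> equivalent_fm ty \<theta> \<theta>') \<longrightarrow>
        is_sentence (pnf \<theta>) \<and> prenex (pnf \<theta>) \<and> equivalent_fm ty \<theta> (pnf \<theta>))"

definition theta_next :: "fm \<Rightarrow> (fm \<Rightarrow> fm) \<Rightarrow> (fm \<Rightarrow> fm) \<Rightarrow> fm \<Rightarrow> fm" where
  "theta_next \<phi>le rel pnf \<theta> =
     QInfs Quant_Unitary [VU 1 1, VU 1 2]
       (fm_max
         [phi_good (VU 1 1) (VU 1 2),
          QSup Quant_Ball VA
            (QInfs Quant_Unitary [VU 2 1, VU 2 2]
               (fm_max [phi_good (VU 2 1) (VU 2 2), \<phi>le, rel (pnf \<theta>)]))])"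

text \<open>\<open>theta \<dots> m n\<close> is \<open>\<theta>\<^bsub>m,n\<^esub> = (\<tau>\<^sub>m)\<^sub>n\<close>, for \<open>n \<ge> 1\<close>.\<close>

definition theta :: "fm \<Rightarrow> (fm \<Rightarrow> fm) \<Rightarrow> (fm \<Rightarrow> fm) \<Rightarrow> nat \<Rightarrow> nat \<Rightarrow> fm" where
  "theta \<phi>le rel pnf m n = (theta_next \<phi>le rel pnf ^^ (n - 1)) (tau m)"

text \<open>Specification of the numbers \<open>r\<^sub>n(\<Delta>)\<close>, relative to the choice of the constants \<open>m(\<Delta>)\<close>.
  Every countable group is isomorphic to one with carrier in the natural numbers.\<close>

definition lower_bounds_spec ::
  "fm \<Rightarrow> (fm \<Rightarrow> fm) \<Rightarrow> (fm \<Rightarrow> fm) \<Rightarrow> (nat monoid \<Rightarrow> nat) \<Rightarrow> (nat monoid \<Rightarrow> nat \<Rightarrow> real) \<Rightarrow> bool"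
  where
  "lower_bounds_spec \<phi>le rel pnf m r \<longleftrightarrow>
     (\<forall>\<Delta> :: nat monoid. group \<Delta> \<and> \<not> amenable \<Delta> \<longrightarrow>
        (\<forall>n\<ge>1. r \<Delta> n > 0) \<and>
        (\<forall>n\<ge>1. \<forall>t\<ge>1. \<forall>\<gamma> :: bool list. length \<gamma> = n \<longrightarrow>
           (let M = tensor_power (group_vna (K_fin \<gamma> \<Delta>)) t
            in (\<gamma> ! (n - 1) \<longrightarrow> (\<forall>k\<ge>1. value_in M (theta \<phi>le rel pnf k n) = 0)) \<and>
               (\<not> \<gamma> ! (n - 1) \<longrightarrow> value_in M (theta \<phi>le rel pnf (m \<Delta>) n) \<ge> r \<Delta> n))))"

end

theory Submission
  imports Defs
begin

text \<open>
  \<open>T\<^sub>0\<close> and \<open>T\<^sub>1\<close> commute with inductive limits of groups, so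
  \<open>K\<^sub>\<alpha>(\<Gamma>)\<close> is isomorphic to \<open>K\<^bsub>\<alpha>|(n+1)\<^esub>(\<Delta>)\<close>, where \<open>\<Delta> = K\<^bsub>\<alpha>*\<^esub>(\<Gamma>)\<close> and
  \<open>\<alpha>*\<close> is the rest of the sequence. The group \<open>\<Delta>\<close> is nonamenable for
  every \<open>\<Gamma>\<close>, since it is itself of the form \<open>T\<^sub>0\<close> or \<open>T\<^sub>1\<close> of a group and hence has
  a free quotient. The specification of \<open>r\<^sub>n(\<Delta>)\<close> for the tensor power \<open>t = 1\<close>
  then gives both claims, because the values of sentences are invariant under group isomorphisms and
  under the identification of \<open>\<M>\<^bsup>\<otimes>1\<^esup>\<close> with \<open>\<M>\<close>.
\<close>

section \<open>Presented groups\<close>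

text \<open>The connecting maps of the system act on the innermost argument, whereas removing the
  first letter of the sequence concerns the outermost functor; hence the need for compatibility with
  limits. Limits are characterized abstractly, by lifting of elements and of equalities to stages,
  so that the functors, index shifts and copies on the natural numbers can all be followed. The two
  sequences have different remainders and hence different groups \<Delta>, while the index m always
  belongs to that of \<beta>. On the side of \<alpha> the specification gives the value 0 for every
  index that is at least 1, so m \<ge> 1 becomes a proof obligation; it is extracted from the
  inequality that specifies m. On the operator side there are two obstacles. The trace of a tensor
  power is chosen among functionals with prescribed values, so one such functional has to be
  exhibited before anything can be said about the choice. And operators are matrices, so
  associativity of their product is an exchange of infinite sums.\<close>

lemma word_class_eq_iff: "word_class H D v = word_class H D w \<longleftrightarrow> word_eq H D v w"
  unfolding word_class_def by (metis word_eq.refl word_eq.sym word_eq.trans mem_Collect_eq Collect_cong)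

lemma word_eq_append:
  assumes "word_eq H D v v'" "word_eq H D w w'"
  shows "word_eq H D (v @ w) (v' @ w')"
  using word_eq.cong[OF assms(1), where p = "[]" and q = w]
    word_eq.cong[OF assms(2), where p = v' and q = "[]"]
  by (auto intro: word_eq.trans)

lemma self_in_word_class [simp]: "w \<in> word_class H D w"
  by (simp add: word_class_def word_eq.refl)

lemma in_word_class_iff: "v \<in> word_class H D w \<longleftrightarrow> word_eq H D w v"
  by (simp add: word_class_def)

lemma carrier_presented [simp]:
  "carrier (presented H D) = word_class H D ` lists (letters H)"
  by (simp add: presented_def)

lemma one_presented [simp]: "\<one>\<^bsub>presented H D\<^esub> = word_class H D []"
  by (simp add: presented_def)

text \<open>Products and functorial maps on classes are defined as unions over all representatives.
  A family that is constant on a class has its common value as union; all these definitions are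
  evaluated in this way.\<close>

lemma UN_word_class:
  assumes "\<And>v. word_eq H D w v \<Longrightarrow> F v = F w"
  shows "(\<Union>v\<in>word_class H D w. F v) = F w"
proof -
  have "(\<Union>v\<in>word_class H D w. F v) = (\<Union>v\<in>word_class H D w. F w)"
    using assms by (intro SUP_cong) (auto simp: in_word_class_iff)
  moreover have "word_class H D w \<noteq> {}"
    using self_in_word_class[of w H D] by blast
  ultimately show ?thesis
    by simp
qed

lemma mult_presented [simp]:
  "word_class H D v \<otimes>\<^bsub>presented H D\<^esub> word_class H D w = word_class H D (v @ w)"
proof -
  have "(\<Union>b\<in>word_class H D w. word_class H D (a @ b)) = word_class H D (a @ w)" for a
    by (rule UN_word_class) (simp add: word_class_eq_iff word_eq_append word_eq.refl word_eq.sym)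
  moreover have "(\<Union>a\<in>word_class H D v. word_class H D (a @ w)) = word_class H D (v @ w)"
    by (rule UN_word_class) (simp add: word_class_eq_iff word_eq_append word_eq.refl word_eq.sym)
  ultimately show ?thesis
    by (simp add: presented_def)
qed

lemma Grp_in_letters [simp]: "Grp x \<in> letters H \<longleftrightarrow> x \<in> carrier H"
  by (auto simp: letters_def)

lemma Lam_in_letters [simp]: "Lam j k \<in> letters H \<longleftrightarrow> 1 \<le> j"
  by (auto simp: letters_def)

text \<open>\<open>word_eq\<close> relates arbitrary words, including words with letters outside the
  group. The basic relations are between admissible words and contexts agree on both sides, so
  admissibility is an invariant. It makes the intermediate words of a chain of equalities available
  as words over \<open>H\<close>.\<close>

lemma word_eq_lists_iff:
  assumes "word_eq H D v w" "group H" "\<And>j. D j \<subseteq> carrier H"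
  shows "v \<in> lists (letters H) \<longleftrightarrow> w \<in> lists (letters H)"
  using assms(1)
proof (induction rule: word_eq.induct)
  case (comm j x k)
  then show ?case
    using assms(3)[of j] by auto
qed (use assms(2) in \<open>auto simp: group.is_monoid monoid.m_closed\<close>)

primrec inv_letter :: "'h monoid \<Rightarrow> 'h letter \<Rightarrow> 'h letter" where
  "inv_letter H (Grp x) = Grp (inv\<^bsub>H\<^esub> x)"
| "inv_letter H (Lam j k) = Lam j (- k)"

lemma inv_letter_word_eq:
  assumes "group H" "a \<in> letters H"
  shows "word_eq H D [inv_letter H a, a] []"
proof (cases a)
  case (Grp x)
  then have "word_eq H D [Grp (inv\<^bsub>H\<^esub> x), Grp x] [Grp (inv\<^bsub>H\<^esub> x \<otimes>\<^bsub>H\<^esub> x)]"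
    using assms by (intro word_eq.grp_mult) auto
  then show ?thesis
    using Grp assms word_eq.grp_one[of H D] by (auto simp: group.l_inv intro: word_eq.trans)
next
  case (Lam j k)
  then show ?thesis
    using assms word_eq.lam_add[of j H D "- k" k] word_eq.lam_zero[of j H D]
    by (auto intro: word_eq.trans)
qed

lemma group_presented:
  assumes "group H"
  shows "group (presented H D)"
proof (rule groupI)
  fix A assume "A \<in> carrier (presented H D)"
  then obtain w where w: "w \<in> lists (letters H)" "A = word_class H D w"
    by auto
  \<comment> \<open>The left inverse grows at its right end: if \<open>v\<close> inverts
    \<open>w\<close>, then \<open>v\<close> followed by the inverse letter of \<open>a\<close>
    inverts \<open>a # w\<close>.\<close>
  have "\<exists>v\<in>lists (letters H). word_eq H D (v @ w) []"
    using w(1)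
  proof (induction w)
    case Nil
    then show ?case
      by (auto intro: bexI[of _ "[]"] word_eq.refl)
  next
    case (Cons a w)
    then obtain v where v: "v \<in> lists (letters H)" "word_eq H D (v @ w) []"
      by auto
    have "word_eq H D (v @ [inv_letter H a, a] @ w) (v @ [] @ w)"
      using Cons assms by (intro word_eq.cong inv_letter_word_eq) auto
    then have "word_eq H D ((v @ [inv_letter H a]) @ a # w) []"
      using v(2) by (auto intro: word_eq.trans)
    moreover have "v @ [inv_letter H a] \<in> lists (letters H)"
      using v Cons assms by (cases a) auto
    ultimately show ?case
      by blast
  qed
  then show "\<exists>B\<in>carrier (presented H D). B \<otimes>\<^bsub>presented H D\<^esub> A = \<one>\<^bsub>presented H D\<^esub>"
    using w(2) by (auto simp: word_class_eq_iff)
qed (auto intro!: imageI)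

lemma countable_presented:
  assumes "countable (carrier H)"
  shows "countable (carrier (presented H D))"
proof -
  have "letters H \<subseteq> Grp ` carrier H \<union> case_prod Lam ` UNIV"
    by (auto simp: letters_def)
  then have "countable (letters H)"
    using assms by (meson countable_Un countable_image countable_subset uncountable_def countableI_type)
  then show ?thesis
    by (simp add: countable_lists)
qed

lemma word_eq_map:
  assumes "word_eq H D v w" "\<phi> \<in> hom H K" "\<phi> \<one>\<^bsub>H\<^esub> = \<one>\<^bsub>K\<^esub>" "\<And>j. \<phi> ` D j \<subseteq> E j"
  shows "word_eq K E (map (map_letter \<phi>) v) (map (map_letter \<phi>) w)"
  using assms(1)
proof (induction rule: word_eq.induct)
  case (sym v w)
  then show ?case
    by (blast intro: word_eq.sym)
next
  case (trans u v w)
  then show ?case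
    by (blast intro: word_eq.trans)
next
  case (cong v w p q)
  then show ?case
    by (simp add: word_eq.cong)
next
  case (grp_mult x y)
  have "\<phi> x \<in> carrier K" "\<phi> y \<in> carrier K"
    using assms(2) grp_mult by (auto simp: hom_def)
  then have "word_eq K E [Grp (\<phi> x), Grp (\<phi> y)] [Grp (\<phi> x \<otimes>\<^bsub>K\<^esub> \<phi> y)]"
    by (rule word_eq.grp_mult)
  then show ?case
    using assms(2) grp_mult by (simp add: hom_mult)
next
  case (comm j x k)
  then have "\<phi> x \<in> E j"
    using assms(4)[of j] by auto
  then show ?case
    using comm by (simp add: word_eq.comm)
qed (use assms(3) in \<open>auto intro: word_eq.intros\<close>)

text \<open>The common form of \<open>T0_map\<close> and \<open>T1_map\<close>, which differ only in
  the base group, the relators and the map on letters.\<close>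

definition presented_map ::
  "'k monoid \<Rightarrow> (nat \<Rightarrow> 'k set) \<Rightarrow> ('h \<Rightarrow> 'k) \<Rightarrow> 'h letter list set \<Rightarrow> 'k letter list set" where
  "presented_map K E \<phi> W = (\<Union>w\<in>W. word_class K E (map (map_letter \<phi>) w))"

lemma presented_map_word_class:
  assumes "\<phi> \<in> hom H K" "\<phi> \<one>\<^bsub>H\<^esub> = \<one>\<^bsub>K\<^esub>" "\<And>j. \<phi> ` D j \<subseteq> E j"
  shows "presented_map K E \<phi> (word_class H D w) = word_class K E (map (map_letter \<phi>) w)"
  unfolding presented_map_def
proof (rule UN_word_class)
  fix v assume "word_eq H D w v"
  from word_eq_map[OF this assms] show
    "word_class K E (map (map_letter \<phi>) v) = word_class K E (map (map_letter \<phi>) w)"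
    by (simp add: word_class_eq_iff word_eq.sym)
qed

lemma map_letter_eq_Grp_iff [simp]: "map_letter f a = Grp y \<longleftrightarrow> (\<exists>x. a = Grp x \<and> f x = y)"
  by (cases a) auto

lemma map_letter_eq_Lam_iff [simp]: "map_letter f a = Lam j k \<longleftrightarrow> a = Lam j k"
  by (cases a) auto

lemma map_letter_in_letters:
  assumes "\<phi> \<in> hom H K" "a \<in> letters H"
  shows "map_letter \<phi> a \<in> letters K"
  using assms by (cases a) (auto simp: hom_def)

lemma map_letters_in_lists:
  assumes "\<phi> \<in> hom H K" "w \<in> lists (letters H)"
  shows "map (map_letter \<phi>) w \<in> lists (letters K)"
  using assms by (auto simp: map_letter_in_letters in_lists_conv_set)

section \<open>Direct limits\<close>

lemma push_add: "push f n (a + b) x = push f (n + a) b (push f n a x)"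
  by (induction b) (simp_all add: add.assoc)

text \<open>The last two conditions replace the universal property: everything in the limit comes
  from a stage, and what becomes equal in the limit is already equal at a later stage. In this form
  being a limit can be checked directly for the groups constructed from a given system.\<close>

locale direct_limit =
  fixes G :: "nat \<Rightarrow> 'a monoid" and f :: "nat \<Rightarrow> 'a \<Rightarrow> 'a"
    and L :: "'b monoid" and \<iota> :: "nat \<Rightarrow> 'a \<Rightarrow> 'b"
  assumes group_system: "group (G n)"
    and group_limit: "group L"
    and hom_system: "f n \<in> hom (G n) (G (Suc n))"
    and hom_limit: "\<iota> n \<in> hom (G n) L"
    and limit_compat: "x \<in> carrier (G n) \<Longrightarrow> \<iota> (Suc n) (f n x) = \<iota> n x"
    and limit_surj: "z \<in> carrier L \<Longrightarrow> \<exists>n. z \<in> \<iota> n ` carrier (G n)"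
    and limit_inj: "\<lbrakk>x \<in> carrier (G n); y \<in> carrier (G n); \<iota> n x = \<iota> n y\<rbrakk>
      \<Longrightarrow> \<exists>d. push f n d x = push f n d y"
begin

text \<open>\<open>push\<close> counts steps; indexing by the target stage allows elements of
  different stages to be compared at a common \<open>N\<close>. For \<open>N < n\<close> this is the
  identity, a harmless value because comparisons are made for all large \<open>N\<close>.\<close>

definition transition :: "nat \<Rightarrow> nat \<Rightarrow> 'a \<Rightarrow> 'a" where
  "transition n N = push f n (N - n)"

lemma push_hom: "push f n d \<in> hom (G n) (G (n + d))"
proof (induction d)
  case (Suc d)
  then show ?case
    using hom_compose[OF Suc hom_system[of "n + d"]] by (simp add: comp_def)
qed (simp add: hom_def)

lemma transition_hom: "n \<le> N \<Longrightarrow> transition n N \<in> hom (G n) (G N)"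
  using push_hom[of n "N - n"] by (simp add: transition_def)

lemma transition_transition: "n \<le> k \<Longrightarrow> k \<le> N \<Longrightarrow> transition k N (transition n k x) = transition n N x"
  using push_add[of f n "k - n" "N - k" x] by (simp add: transition_def)

lemma transition_Suc: "n \<le> N \<Longrightarrow> transition n (Suc N) x = f N (transition n N x)"
  by (simp add: transition_def Suc_diff_le)

lemma transition_closed: "n \<le> N \<Longrightarrow> x \<in> carrier (G n) \<Longrightarrow> transition n N x \<in> carrier (G N)"
  using transition_hom by (auto simp: hom_def)

lemma transition_one: "n \<le> N \<Longrightarrow> transition n N \<one>\<^bsub>G n\<^esub> = \<one>\<^bsub>G N\<^esub>"
  by (intro hom_one[OF transition_hom]) (auto simp: group_system)

lemma limit_closed: "x \<in> carrier (G n) \<Longrightarrow> \<iota> n x \<in> carrier L"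
  using hom_limit by (auto simp: hom_def)

lemma limit_transition:
  assumes "n \<le> N" "x \<in> carrier (G n)"
  shows "\<iota> N (transition n N x) = \<iota> n x"
  using assms(1)
proof (induction N rule: dec_induct)
  case (step N)
  then show ?case
    using assms(2) by (simp add: transition_Suc limit_compat transition_closed)
qed (simp add: transition_def)

text \<open>An element that lifts to one stage lifts to all later ones. In the form "for all large
  N", lifts of finitely many elements can be combined at a common stage without tracking
  maxima.\<close>

lemma limit_surj_eventually:
  assumes "y \<in> carrier L"
  shows "\<forall>\<^sub>F N in sequentially. y \<in> \<iota> N ` carrier (G N)"
proof -
  obtain n x where x: "x \<in> carrier (G n)" "y = \<iota> n x"
    using limit_surj[OF assms] by blast
  have "y \<in> \<iota> N ` carrier (G N)" if "n \<le> N" for N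
    using limit_transition[OF that x(1)] transition_closed[OF that x(1)] x(2) by (metis imageI)
  then show ?thesis
    by (auto simp: eventually_sequentially)
qed

lemma limit_inj_eventually:
  assumes "x \<in> carrier (G n)" "y \<in> carrier (G k)" "\<iota> n x = \<iota> k y"
  shows "\<forall>\<^sub>F N in sequentially. transition n N x = transition k N y"
proof -
  define M where "M = max n k"
  have M: "n \<le> M" "k \<le> M"
    by (auto simp: M_def)
  then have "\<iota> M (transition n M x) = \<iota> M (transition k M y)"
    using assms by (simp add: limit_transition)
  then obtain d where d: "push f M d (transition n M x) = push f M d (transition k M y)"
    using limit_inj M assms(1,2) by (meson transition_closed)
  have "transition n N x = transition k N y" if "M + d \<le> N" for N
  proof -
    have eq: "transition M (M + d) (transition n M x) = transition M (M + d) (transition k M y)"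
      using d by (simp add: transition_def)
    have "transition n N x = transition (M + d) N (transition M (M + d) (transition n M x))"
      using M that by (simp add: transition_transition)
    also have "\<dots> = transition k N y"
      using M that by (simp add: eq transition_transition)
    finally show ?thesis .
  qed
  then show ?thesis
    by (auto simp: eventually_sequentially)
qed

lemma letters_surj_eventually:
  assumes "a \<in> letters L"
  shows "\<forall>\<^sub>F N in sequentially. a \<in> map_letter (\<iota> N) ` letters (G N)"
proof (cases a)
  case (Grp y)
  have "Grp y \<in> map_letter (\<iota> N) ` letters (G N)" if "y \<in> \<iota> N ` carrier (G N)" for N
    using that by (auto intro!: image_eqI[where x = "Grp _"])
  then show ?thesis
    using assms Grp limit_surj_eventually[of y] by (auto elim: eventually_mono)
next
  case (Lam j k)
  then show ?thesis
    using assms by (auto intro!: always_eventually image_eqI[where x = "Lam j k"])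
qed

lemma words_surj_eventually:
  assumes "w \<in> lists (letters L)"
  shows "\<forall>\<^sub>F N in sequentially. w \<in> map (map_letter (\<iota> N)) ` lists (letters (G N))"
proof -
  have "\<forall>\<^sub>F N in sequentially. \<forall>a\<in>set w. a \<in> map_letter (\<iota> N) ` letters (G N)"
    using assms by (intro eventually_ball_finite) (auto simp: letters_surj_eventually)
  then show ?thesis
  proof (rule eventually_mono)
    fix N assume "\<forall>a\<in>set w. a \<in> map_letter (\<iota> N) ` letters (G N)"
    then have "w \<in> lists (map_letter (\<iota> N) ` letters (G N))"
      by auto
    then show "w \<in> map (map_letter (\<iota> N)) ` lists (letters (G N))"
      by (simp add: lists_image)
  qed
qed

lemma words_inj_eventually:
  assumes "v \<in> lists (letters (G n))" "w \<in> lists (letters (G k))"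
    "map (map_letter (\<iota> n)) v = map (map_letter (\<iota> k)) w"
  shows "\<forall>\<^sub>F N in sequentially. map (map_letter (transition n N)) v = map (map_letter (transition k N)) w"
  using assms
proof (induction v arbitrary: w)
  case (Cons a v)
  then obtain b w' where w: "w = b # w'" "map_letter (\<iota> n) a = map_letter (\<iota> k) b"
      "map (map_letter (\<iota> n)) v = map (map_letter (\<iota> k)) w'"
    by (auto simp: map_eq_Cons_conv Cons_eq_map_conv)
  have "\<forall>\<^sub>F N in sequentially. map_letter (transition n N) a = map_letter (transition k N) b"
  proof (cases a)
    case (Grp x)
    with w obtain y where "b = Grp y"
      by (cases b) auto
    then show ?thesis
      using Grp w Cons limit_inj_eventually[of x n y k] by auto
  next
    case (Lam i l)
    with w show ?thesis
      by (cases b) auto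
  qed
  moreover have "\<forall>\<^sub>F N in sequentially. map (map_letter (transition n N)) v = map (map_letter (transition k N)) w'"
    using Cons.prems w by (intro Cons.IH) auto
  ultimately show ?case
    unfolding w(1) by eventually_elim simp
qed simp

text \<open>A derivation of an equality of words over the limit involves only finitely many letters, hence
  it can be lifted to some stage of the system.\<close>

lemma word_eq_lift:
  assumes "word_eq L E v w" "v \<in> lists (letters L)"
    and D: "\<And>n j. D n j \<subseteq> carrier (G n)" "\<And>n j. f n ` D n j \<subseteq> D (Suc n) j"
    and E: "\<And>j. E j = (\<Union>n. \<iota> n ` D n j)"
    and "v' \<in> lists (letters (G n))" "map (map_letter (\<iota> n)) v' = v"
    and "w' \<in> lists (letters (G k))" "map (map_letter (\<iota> k)) w' = w"
  shows "\<forall>\<^sub>F N in sequentially.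
    word_eq (G N) (D N) (map (map_letter (transition n N)) v') (map (map_letter (transition k N)) w')"
proof -
  have E_subset: "E j \<subseteq> carrier L" for j
    using D(1) limit_closed unfolding E by blast
  have lists_iff: "v \<in> lists (letters L) \<longleftrightarrow> w \<in> lists (letters L)" if "word_eq L E v w" for v w
    using that group_limit E_subset by (rule word_eq_lists_iff)
  have D_tr: "transition i N x \<in> D N j" if "i \<le> N" "x \<in> D i j" for i N x j
    using that(1)
  proof (induction N rule: dec_induct)
    case (step N)
    then show ?case
      using D(2)[of N j] by (auto simp: transition_Suc)
  qed (simp add: transition_def that(2))
  show ?thesis
    using assms(1,2) assms(6-)
  \<comment> \<open>The lifts and their stages have to stay arbitrary: transitivity brings in a
    middle word with a lift at a stage of its own.\<close>
  proof (induction arbitrary: v' w' n k rule: word_eq.induct)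
    case (refl w)
    then have "\<forall>\<^sub>F N in sequentially. map (map_letter (transition n N)) v' = map (map_letter (transition k N)) w'"
      by (intro words_inj_eventually) auto
    then show ?case
      by eventually_elim (simp add: word_eq.refl)
  next
    case (sym v w)
    have "v \<in> lists (letters L)"
      using sym.hyps sym.prems(1) lists_iff by blast
    then have "\<forall>\<^sub>F N in sequentially.
        word_eq (G N) (D N) (map (map_letter (transition k N)) w') (map (map_letter (transition n N)) v')"
      using sym.prems by (intro sym.IH) auto
    then show ?case
      by eventually_elim (rule word_eq.sym)
  next
    case (trans u v w)
    \<comment> \<open>The middle word is given only over the limit. Admissibility passes to it from
      \<open>u\<close>, and so it has a lift at some stage \<open>l\<close>, through which both
      halves of the chain are compared.\<close>
    have v: "v \<in> lists (letters L)"
      using trans.hyps trans.prems(1) lists_iff by blast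
    then obtain l x where x: "x \<in> lists (letters (G l))" "map (map_letter (\<iota> l)) x = v"
      using eventually_happens'[OF _ words_surj_eventually[OF v]] by auto
    have "\<forall>\<^sub>F N in sequentially.
        word_eq (G N) (D N) (map (map_letter (transition n N)) v') (map (map_letter (transition l N)) x)"
      using trans.prems x by (intro trans.IH(1)) auto
    moreover have "\<forall>\<^sub>F N in sequentially.
        word_eq (G N) (D N) (map (map_letter (transition l N)) x) (map (map_letter (transition k N)) w')"
      using trans.prems x v by (intro trans.IH(2)) auto
    ultimately show ?case
      by eventually_elim (rule word_eq.trans)
  next
    case (cong v w p q)
    obtain p1 v1 q1 where 1: "v' = p1 @ v1 @ q1" "map (map_letter (\<iota> n)) p1 = p"
        "map (map_letter (\<iota> n)) v1 = v" "map (map_letter (\<iota> n)) q1 = q"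
      using cong.prems(3) by (auto simp: map_eq_append_conv append_eq_map_conv)
    obtain p2 w2 q2 where 2: "w' = p2 @ w2 @ q2" "map (map_letter (\<iota> k)) p2 = p"
        "map (map_letter (\<iota> k)) w2 = w" "map (map_letter (\<iota> k)) q2 = q"
      using cong.prems(5) by (auto simp: map_eq_append_conv append_eq_map_conv)
    have "\<forall>\<^sub>F N in sequentially. map (map_letter (transition n N)) p1 = map (map_letter (transition k N)) p2"
      using 1 2 cong.prems by (intro words_inj_eventually) auto
    moreover have "\<forall>\<^sub>F N in sequentially. map (map_letter (transition n N)) q1 = map (map_letter (transition k N)) q2"
      using 1 2 cong.prems by (intro words_inj_eventually) auto
    moreover have "\<forall>\<^sub>F N in sequentially.
        word_eq (G N) (D N) (map (map_letter (transition n N)) v1) (map (map_letter (transition k N)) w2)"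
      using 1 2 cong.prems by (intro cong.IH) auto
    ultimately show ?case
      unfolding 1(1) 2(1) by eventually_elim (simp add: word_eq.cong)
  next
    case grp_one
    then obtain x where x: "v' = [Grp x]" "x \<in> carrier (G n)" "\<iota> n x = \<one>\<^bsub>L\<^esub>"
      by (auto simp: map_eq_Cons_conv)
    have "\<iota> n x = \<iota> n \<one>\<^bsub>G n\<^esub>"
      using x hom_one[OF hom_limit] by (simp add: group_system group_limit)
    then have "\<forall>\<^sub>F N in sequentially. transition n N x = transition n N \<one>\<^bsub>G n\<^esub>"
      using x by (intro limit_inj_eventually) (auto simp: group_system group.is_monoid)
    with eventually_ge_at_top[of n] show ?case
      by eventually_elim (use grp_one x in \<open>simp add: transition_one word_eq.grp_one\<close>)
  next
    case (grp_mult x y)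
    then obtain x' y' where v': "v' = [Grp x', Grp y']" "x' \<in> carrier (G n)" "y' \<in> carrier (G n)"
        "x = \<iota> n x'" "y = \<iota> n y'"
      by (auto simp: map_eq_Cons_conv)
    obtain z where w': "w' = [Grp z]" "z \<in> carrier (G k)" "\<iota> k z = x \<otimes>\<^bsub>L\<^esub> y"
      using grp_mult by (auto simp: map_eq_Cons_conv)
    then have "\<iota> k z = \<iota> n (x' \<otimes>\<^bsub>G n\<^esub> y')"
      using v' by (simp add: hom_mult[OF hom_limit])
    then have "\<forall>\<^sub>F N in sequentially. transition k N z = transition n N (x' \<otimes>\<^bsub>G n\<^esub> y')"
      using v' w' by (intro limit_inj_eventually) (auto simp: group_system group.is_monoid monoid.m_closed)
    with eventually_ge_at_top[of n] show ?case
      by eventually_elim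
        (use v' w' in \<open>simp add: hom_mult[OF transition_hom] transition_closed word_eq.grp_mult\<close>)
  next
    case (lam_zero j)
    then show ?case
      by (auto simp: map_eq_Cons_conv word_eq.lam_zero)
  next
    case (lam_add j k l)
    then show ?case
      by (auto simp: map_eq_Cons_conv word_eq.lam_add)
  next
    case (comm j x l)
    then obtain x1 where v': "v' = [Grp x1, Lam j l]" "x1 \<in> carrier (G n)" "x = \<iota> n x1"
      by (auto simp: map_eq_Cons_conv)
    obtain x2 where w': "w' = [Lam j l, Grp x2]" "x2 \<in> carrier (G k)" "\<iota> k x2 = x"
      using comm by (auto simp: map_eq_Cons_conv)
    \<comment> \<open>The lifts \<open>x1\<close> and \<open>x2\<close> need not be relators at
      their own stages. Since the relators of the limit are unions of images, there is a third lift
      \<open>x0\<close> that is one, and all three lifts agree from some stage on.\<close>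
    obtain i x0 where x0: "x0 \<in> D i j" "x = \<iota> i x0"
      using comm.hyps unfolding E by blast
    have "\<forall>\<^sub>F N in sequentially. transition n N x1 = transition i N x0"
      using v' x0 D(1) by (intro limit_inj_eventually) auto
    moreover have "\<forall>\<^sub>F N in sequentially. transition k N x2 = transition i N x0"
      using w' x0 D(1) by (intro limit_inj_eventually) auto
    moreover note eventually_ge_at_top[of i]
    ultimately show ?case
    proof eventually_elim
      case (elim N)
      then have "transition i N x0 \<in> D N j"
        using x0(1) by (intro D_tr)
      then show ?case
        using elim v' w' comm.hyps(1) by (simp add: word_eq.comm)
    qed
  qed
qed

end

section \<open>Compatibility of presentations with direct limits; change of system and limit\<close>

lemma presented_map_hom:
  assumes "\<phi> \<in> hom H K" "\<phi> \<one>\<^bsub>H\<^esub> = \<one>\<^bsub>K\<^esub>" "\<And>j. \<phi> ` D j \<subseteq> E j"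
  shows "presented_map K E \<phi> \<in> hom (presented H D) (presented K E)"
  using map_letter_in_letters[OF assms(1)]
  by (auto simp: hom_def presented_map_word_class[OF assms] intro!: imageI)

context direct_limit
begin

lemma system_one: "f n \<one>\<^bsub>G n\<^esub> = \<one>\<^bsub>G (Suc n)\<^esub>"
  by (rule hom_one[OF hom_system]) (auto simp: group_system)

lemma limit_one: "\<iota> n \<one>\<^bsub>G n\<^esub> = \<one>\<^bsub>L\<^esub>"
  by (rule hom_one[OF hom_limit]) (auto simp: group_system group_limit)

text \<open>A word has finitely many letters, so it lifts to a stage; a derivation uses finitely
  many relations, so an equality lifts as well. In the condition on \<open>E\<close>, one inclusion
  makes the maps to the limit well defined, the other lets commutation relations be lifted.\<close>

lemma direct_limit_presented:
  assumes D: "\<And>n j. D n j \<subseteq> carrier (G n)" "\<And>n j. f n ` D n j \<subseteq> D (Suc n) j"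
    and E: "\<And>j. E j = (\<Union>n. \<iota> n ` D n j)"
  shows "direct_limit (\<lambda>n. presented (G n) (D n))
    (\<lambda>n. presented_map (G (Suc n)) (D (Suc n)) (f n)) (presented L E) (\<lambda>n. presented_map L E (\<iota> n))"
proof -
  define F where "F n = presented_map (G (Suc n)) (D (Suc n)) (f n)" for n
  define I where "I n = presented_map L E (\<iota> n)" for n
  have ED: "\<iota> n ` D n j \<subseteq> E j" for n j
    unfolding E by blast
  have F: "F n (word_class (G n) (D n) w) =
      word_class (G (Suc n)) (D (Suc n)) (map (map_letter (f n)) w)" for n w
    unfolding F_def by (intro presented_map_word_class hom_system system_one D)
  have I: "I n (word_class (G n) (D n) w) = word_class L E (map (map_letter (\<iota> n)) w)" for n w
    unfolding I_def by (intro presented_map_word_class hom_limit limit_one ED)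
  have push_F: "push F n d (word_class (G n) (D n) w) =
      word_class (G (n + d)) (D (n + d)) (map (map_letter (push f n d)) w)" for n d w
    by (induction d) (simp_all add: F letter.map_comp comp_def letter.map_ident)
  have "direct_limit (\<lambda>n. presented (G n) (D n)) F (presented L E) I"
  proof (rule direct_limit.intro)
    show "group (presented (G n) (D n))" for n
      by (intro group_presented group_system)
    show "group (presented L E)"
      by (intro group_presented group_limit)
    show "F n \<in> hom (presented (G n) (D n)) (presented (G (Suc n)) (D (Suc n)))" for n
      unfolding F_def by (intro presented_map_hom hom_system system_one D)
    show "I n \<in> hom (presented (G n) (D n)) (presented L E)" for n
      unfolding I_def by (intro presented_map_hom hom_limit limit_one ED)
  next
    fix x n assume "x \<in> carrier (presented (G n) (D n))"
    then obtain w where w: "w \<in> lists (letters (G n))" "x = word_class (G n) (D n) w"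
      by auto
    have "map_letter (\<iota> (Suc n)) (map_letter (f n) a) = map_letter (\<iota> n) a" if "a \<in> letters (G n)" for a
      using that by (cases a) (auto simp: limit_compat)
    then show "I (Suc n) (F n x) = I n x"
      using w by (auto simp: F I in_lists_conv_set intro!: arg_cong[where f = "word_class L E"])
  next
    fix z assume "z \<in> carrier (presented L E)"
    then obtain w where w: "w \<in> lists (letters L)" "z = word_class L E w"
      by auto
    then obtain n v where "v \<in> lists (letters (G n))" "w = map (map_letter (\<iota> n)) v"
      using eventually_happens'[OF _ words_surj_eventually[OF w(1)]] by auto
    then have "z = I n (word_class (G n) (D n) v)" "v \<in> lists (letters (G n))"
      using w by (simp_all add: I)
    then show "\<exists>n. z \<in> I n ` carrier (presented (G n) (D n))"
      by auto
  next
    fix x n y assume "x \<in> carrier (presented (G n) (D n))" "y \<in> carrier (presented (G n) (D n))"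
      and eq: "I n x = I n y"
    then obtain v w where v: "v \<in> lists (letters (G n))" "x = word_class (G n) (D n) v"
      and w: "w \<in> lists (letters (G n))" "y = word_class (G n) (D n) w"
      by auto
    have "word_eq L E (map (map_letter (\<iota> n)) v) (map (map_letter (\<iota> n)) w)"
      using eq v w by (simp add: I word_class_eq_iff)
    moreover have "map (map_letter (\<iota> n)) v \<in> lists (letters L)"
      using v(1) by (rule map_letters_in_lists[OF hom_limit])
    ultimately have "\<forall>\<^sub>F N in sequentially.
        word_eq (G N) (D N) (map (map_letter (transition n N)) v) (map (map_letter (transition n N)) w)"
      by (rule word_eq_lift[OF _ _ D E v(1) HOL.refl w(1) HOL.refl])
    then obtain N where "N \<ge> n"
        "word_eq (G N) (D N) (map (map_letter (transition n N)) v) (map (map_letter (transition n N)) w)"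
      unfolding eventually_sequentially by (meson linear)
    then have "push F n (N - n) x = push F n (N - n) y"
      by (simp add: v w push_F transition_def word_class_eq_iff)
    then show "\<exists>d. push F n d x = push F n d y"
      by blast
  qed
  then show ?thesis
    unfolding F_def I_def .
qed

text \<open>Stage 0 of the system of \<open>K_lim\<close> is the initial group itself and not a
  value of the outermost functor. It has to be dropped before the system can be recognized as the
  image of another one.\<close>

lemma direct_limit_shift:
  "direct_limit (\<lambda>n. G (Suc n)) (\<lambda>n. f (Suc n)) L (\<lambda>n. \<iota> (Suc n))"
proof (rule direct_limit.intro)
  fix z assume "z \<in> carrier L"
  from limit_surj_eventually[OF this] obtain M
    where "\<And>N. N \<ge> M \<Longrightarrow> z \<in> \<iota> N ` carrier (G N)"
    by (auto simp: eventually_sequentially)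
  then have "z \<in> \<iota> (Suc M) ` carrier (G (Suc M))"
    by simp
  then show "\<exists>n. z \<in> \<iota> (Suc n) ` carrier (G (Suc n))" ..
next
  have push: "push (\<lambda>n. f (Suc n)) n d x = push f (Suc n) d x" for n d x
    by (induction d) simp_all
  show "\<exists>d. push (\<lambda>n. f (Suc n)) n d x = push (\<lambda>n. f (Suc n)) n d y"
    if "x \<in> carrier (G (Suc n))" "y \<in> carrier (G (Suc n))" "\<iota> (Suc n) x = \<iota> (Suc n) y" for n x y
    unfolding push by (rule limit_inj[OF that])
qed (auto simp: group_system group_limit hom_system hom_limit limit_compat)

text \<open>The new maps are prescribed only on transported elements. Since each \<open>e n\<close>
  is onto the carrier of \<open>G' n\<close>, this determines them there, and their homomorphism
  laws follow from those of the old maps.\<close>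

lemma direct_limit_iso:
  assumes groups: "\<And>n. group (G' n)" "group L'"
    and e: "\<And>n. e n \<in> iso (G n) (G' n)" "\<epsilon> \<in> iso L L'"
    and f': "\<And>n x. x \<in> carrier (G n) \<Longrightarrow> f' n (e n x) = e (Suc n) (f n x)"
    and \<iota>': "\<And>n x. x \<in> carrier (G n) \<Longrightarrow> \<iota>' n (e n x) = \<epsilon> (\<iota> n x)"
  shows "direct_limit G' f' L' \<iota>'"
proof -
  have carr: "carrier (G' n) = e n ` carrier (G n)" for n
    using e(1)[of n] by (auto simp: iso_def bij_betw_def)
  have e_hom: "e n \<in> hom (G n) (G' n)" for n
    using e(1)[of n] by (simp add: iso_def)
  have \<epsilon>_hom: "\<epsilon> \<in> hom L L'"
    using e(2) by (simp add: iso_def)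
  have f_closed: "f n x \<in> carrier (G (Suc n))" if "x \<in> carrier (G n)" for n x
    using that hom_system by (auto simp: hom_def)
  have mult: "e n x \<otimes>\<^bsub>G' n\<^esub> e n y = e n (x \<otimes>\<^bsub>G n\<^esub> y)" if "x \<in> carrier (G n)" "y \<in> carrier (G n)" for n x y
    using that by (simp add: hom_mult[OF e_hom])
  have closed: "x \<otimes>\<^bsub>G n\<^esub> y \<in> carrier (G n)" if "x \<in> carrier (G n)" "y \<in> carrier (G n)" for n x y
    using group_system that by (simp add: group.is_monoid monoid.m_closed)
  have push: "push f n d x \<in> carrier (G (n + d)) \<and> push f' n d (e n x) = e (n + d) (push f n d x)"
    if "x \<in> carrier (G n)" for n d x
    by (induction d) (use that in \<open>simp_all add: f_closed f'\<close>)
  show ?thesis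
  proof (rule direct_limit.intro)
    show "f' n \<in> hom (G' n) (G' (Suc n))" for n
    proof (rule homI)
      show "f' n x \<in> carrier (G' (Suc n))" if "x \<in> carrier (G' n)" for x
        using that by (auto simp: carr f' f_closed)
      show "f' n (x \<otimes>\<^bsub>G' n\<^esub> y) = f' n x \<otimes>\<^bsub>G' (Suc n)\<^esub> f' n y"
        if "x \<in> carrier (G' n)" "y \<in> carrier (G' n)" for x y
        using that hom_mult[OF hom_system] by (auto simp: carr f' mult f_closed closed)
    qed
    show "\<iota>' n \<in> hom (G' n) L'" for n
    proof (rule homI)
      show "\<iota>' n x \<in> carrier L'" if "x \<in> carrier (G' n)" for x
        using that \<epsilon>_hom by (auto simp: carr \<iota>' limit_closed hom_def)
      show "\<iota>' n (x \<otimes>\<^bsub>G' n\<^esub> y) = \<iota>' n x \<otimes>\<^bsub>L'\<^esub> \<iota>' n y"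
        if "x \<in> carrier (G' n)" "y \<in> carrier (G' n)" for x y
        using that hom_mult[OF hom_limit] hom_mult[OF \<epsilon>_hom]
        by (auto simp: carr \<iota>' mult limit_closed closed)
    qed
  next
    fix x n assume "x \<in> carrier (G' n)"
    then show "\<iota>' (Suc n) (f' n x) = \<iota>' n x"
      by (auto simp: carr f' \<iota>' f_closed limit_compat)
  next
    fix z assume "z \<in> carrier L'"
    then obtain y where "y \<in> carrier L" "z = \<epsilon> y"
      using e(2) by (auto simp: iso_def bij_betw_def)
    then obtain n x where "x \<in> carrier (G n)" "z = \<epsilon> (\<iota> n x)"
      using limit_surj by blast
    then have "z = \<iota>' n (e n x)" "e n x \<in> carrier (G' n)"
      by (simp_all add: \<iota>' carr)
    then show "\<exists>n. z \<in> \<iota>' n ` carrier (G' n)"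
      by blast
  next
    fix x n y assume "x \<in> carrier (G' n)" "y \<in> carrier (G' n)" and eq: "\<iota>' n x = \<iota>' n y"
    then obtain x' y' where x': "x' \<in> carrier (G n)" "x = e n x'" and y': "y' \<in> carrier (G n)" "y = e n y'"
      by (auto simp: carr)
    have "inj_on \<epsilon> (carrier L)"
      using e(2) by (simp add: iso_def bij_betw_def)
    then have "\<iota> n x' = \<iota> n y'"
      using eq x' y' by (simp add: \<iota>' limit_closed inj_on_eq_iff)
    then obtain d where "push f n d x' = push f n d y'"
      using limit_inj x' y' by blast
    then show "\<exists>d. push f' n d x = push f' n d y"
      using push x' y' by metis
  qed (use groups in auto)
qed

text \<open>Which elements of the stages are identified depends on the system alone, since
  identification means equality at a later stage.\<close>

lemma limit_eq_transfer:
  assumes "direct_limit G f L' \<iota>'" "x \<in> carrier (G n)" "y \<in> carrier (G k)" "\<iota> n x = \<iota> k y"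
  shows "\<iota>' n x = \<iota>' k y"
proof -
  interpret L': direct_limit G f L' \<iota>' by fact
  have "\<forall>\<^sub>F N in sequentially. transition n N x = transition k N y"
    using assms(2-4) by (rule limit_inj_eventually)
  with eventually_ge_at_top[of n] eventually_ge_at_top[of k]
  have "\<forall>\<^sub>F N in sequentially. n \<le> N \<and> k \<le> N \<and> transition n N x = transition k N y"
    by eventually_elim auto
  then obtain N where "n \<le> N" "k \<le> N" "transition n N x = transition k N y"
    by (auto dest: eventually_happens)
  then show ?thesis
    using L'.limit_transition[of n N x] L'.limit_transition[of k N y] assms(2,3) by (simp add: transition_def L'.transition_def)
qed

end

section \<open>Uniqueness and existence of direct limits\<close>

lemma direct_limit_unique:
  assumes "direct_limit G f L \<iota>" "direct_limit G f L' \<iota>'"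
  shows "L \<cong> L'"
proof -
  interpret L: direct_limit G f L \<iota> by fact
  interpret L': direct_limit G f L' \<iota>' by fact
  define P where "P = (\<lambda>z (n, x). x \<in> carrier (G n) \<and> \<iota> n x = z)"
  \<comment> \<open>The map is defined through an arbitrary representative of \<open>z\<close> in
    some stage. The choice does not matter by \<open>limit_eq_transfer\<close>; the same fact with
    the two limits exchanged gives injectivity.\<close>
  define \<phi> where "\<phi> z = (case SOME p. P z p of (n, x) \<Rightarrow> \<iota>' n x)" for z
  have \<phi>: "\<phi> (\<iota> n x) = \<iota>' n x" if "x \<in> carrier (G n)" for n x
  proof -
    obtain k y where ky: "(SOME p. P (\<iota> n x) p) = (k, y)"
      by fastforce
    have "P (\<iota> n x) (n, x)"
      using that by (simp add: P_def)
    then have "P (\<iota> n x) (k, y)"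
      unfolding ky[symmetric] by (rule someI)
    then have "\<iota>' k y = \<iota>' n x"
      using that by (intro L.limit_eq_transfer[OF assms(2)]) (auto simp: P_def)
    then show ?thesis
      by (simp add: \<phi>_def ky)
  qed
  have "\<phi> \<in> hom L L'"
  proof (rule homI)
    fix y z assume "y \<in> carrier L" "z \<in> carrier L"
    from L.limit_surj_eventually[OF this(1)] L.limit_surj_eventually[OF this(2)]
    have "\<forall>\<^sub>F N in sequentially. y \<in> \<iota> N ` carrier (G N) \<and> z \<in> \<iota> N ` carrier (G N)"
      by eventually_elim auto
    then obtain N y' z' where "y' \<in> carrier (G N)" "z' \<in> carrier (G N)" "y = \<iota> N y'" "z = \<iota> N z'"
      by (auto dest: eventually_happens)
    moreover from this have "\<iota> N y' \<otimes>\<^bsub>L\<^esub> \<iota> N z' = \<iota> N (y' \<otimes>\<^bsub>G N\<^esub> z')" "y' \<otimes>\<^bsub>G N\<^esub> z' \<in> carrier (G N)"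
      by (simp_all add: hom_mult[OF L.hom_limit] L.group_system group.is_monoid monoid.m_closed)
    ultimately show "\<phi> (y \<otimes>\<^bsub>L\<^esub> z) = \<phi> y \<otimes>\<^bsub>L'\<^esub> \<phi> z"
      by (simp add: \<phi> hom_mult[OF L'.hom_limit])
  next
    fix y assume "y \<in> carrier L"
    then show "\<phi> y \<in> carrier L'"
      using L.limit_surj[of y] by (auto simp: \<phi> L'.limit_closed)
  qed
  moreover have "inj_on \<phi> (carrier L)"
  proof (rule inj_onI)
    fix y z assume "y \<in> carrier L" "z \<in> carrier L" and eq: "\<phi> y = \<phi> z"
    then obtain n y' k z' where yz: "y' \<in> carrier (G n)" "z' \<in> carrier (G k)" "y = \<iota> n y'" "z = \<iota> k z'"
      using L.limit_surj by (metis imageE)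
    then show "y = z"
      using eq L'.limit_eq_transfer[OF assms(1) yz(1,2)] by (simp add: \<phi>)
  qed
  moreover have "\<phi> ` carrier L = carrier L'"
  proof
    show "\<phi> ` carrier L \<subseteq> carrier L'"
      using \<open>\<phi> \<in> hom L L'\<close> by (auto simp: hom_def)
    show "carrier L' \<subseteq> \<phi> ` carrier L"
    proof
      fix z assume "z \<in> carrier L'"
      then obtain n x where "x \<in> carrier (G n)" "z = \<iota>' n x"
        using L'.limit_surj by blast
      then have "z = \<phi> (\<iota> n x)" "\<iota> n x \<in> carrier L"
        by (simp_all add: \<phi> L.limit_closed)
      then show "z \<in> \<phi> ` carrier L"
        by blast
    qed
  qed
  ultimately have "\<phi> \<in> iso L L'"
    by (simp add: iso_def bij_betw_def)
  then show ?thesis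
    by (auto simp: is_iso_def)
qed

lemma direct_limit_lim_group:
  assumes group: "\<And>n. group (G n)" and hom: "\<And>n. f n \<in> hom (G n) (G (Suc n))"
  shows "direct_limit G f (lim_group G f) (lim_class G f)"
proof -
  define eqv where "eqv n x k y \<longleftrightarrow> (\<exists>N\<ge>max n k. push f n (N - n) x = push f k (N - k) y)" for n x k y
  have push_mono: "push f n (M - n) x = push f k (M - k) y"
    if "push f n (N - n) x = push f k (N - k) y" "N \<ge> max n k" "M \<ge> N" for n x k y N M
  proof -
    have "push f n (M - n) x = push f N (M - N) (push f n (N - n) x)"
      using that push_add[of f n "N - n" "M - N" x] by simp
    also have "\<dots> = push f k (M - k) y"
      using that push_add[of f k "N - k" "M - N" y] by simp
    finally show ?thesis .
  qed
  have eqv_trans: "eqv n x l z" if eqv: "eqv n x k y" "eqv k y l z" for n x k y l z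
  proof -
    obtain N M where N: "N \<ge> max n k" "push f n (N - n) x = push f k (N - k) y"
      and M: "M \<ge> max k l" "push f k (M - k) y = push f l (M - l) z"
      using eqv by (auto simp: eqv_def)
    have "push f n (max M N - n) x = push f k (max M N - k) y"
      by (rule push_mono[OF N(2,1)]) simp
    also have "\<dots> = push f l (max M N - l) z"
      by (rule push_mono[OF M(2,1)]) simp
    finally show ?thesis
      using N M by (auto simp: eqv_def intro!: exI[of _ "max M N"])
  qed
  have eqv_sym: "eqv n x k y \<Longrightarrow> eqv k y n x" for n x k y
    by (auto simp: eqv_def)
  have eqv_refl: "eqv n x n x" for n x
    by (auto simp: eqv_def)
  have push_closed: "push f n d x \<in> carrier (G (n + d))" if "x \<in> carrier (G n)" for n d x
  proof (induction d)
    case (Suc d)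
    then show ?case
      using hom[of "n + d"] by (auto simp: hom_def)
  qed (simp add: that)
  have push_mult: "push f n d (x \<otimes>\<^bsub>G n\<^esub> y) = push f n d x \<otimes>\<^bsub>G (n + d)\<^esub> push f n d y"
    if "x \<in> carrier (G n)" "y \<in> carrier (G n)" for n d x y
  proof (induction d)
    case (Suc d)
    then show ?case
      using push_closed[of _ n d] that by (simp add: hom_mult[OF hom])
  qed simp
  have mem: "(k, y) \<in> lim_class G f n x \<longleftrightarrow> y \<in> carrier (G k) \<and> eqv n x k y" for n x k y
    by (simp add: lim_class_def eqv_def)
  have eq_iff: "lim_class G f n x = lim_class G f k y \<longleftrightarrow> eqv n x k y"
    if "x \<in> carrier (G n)" "y \<in> carrier (G k)" for n x k y
  proof
    assume "lim_class G f n x = lim_class G f k y"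
    then show "eqv n x k y"
      using mem[of k y n x] mem[of k y k y] that eqv_refl by auto
  next
    assume "eqv n x k y"
    then have "(l, z) \<in> lim_class G f n x \<longleftrightarrow> (l, z) \<in> lim_class G f k y" for l z
      unfolding mem using eqv_trans eqv_sym by blast
    then show "lim_class G f n x = lim_class G f k y"
      by auto
  qed
  have eqv_mult: "eqv n (x \<otimes>\<^bsub>G n\<^esub> y) k (x' \<otimes>\<^bsub>G k\<^esub> y')"
    if eqv: "eqv n x k x'" "eqv n y k y'" and carr: "x \<in> carrier (G n)" "y \<in> carrier (G n)"
      "x' \<in> carrier (G k)" "y' \<in> carrier (G k)" for n x y k x' y'
  proof -
    obtain N M where N: "N \<ge> max n k" "push f n (N - n) x = push f k (N - k) x'"
      and M: "M \<ge> max n k" "push f n (M - n) y = push f k (M - k) y'"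
      using eqv by (auto simp: eqv_def)
    have "push f n (max M N - n) x = push f k (max M N - k) x'"
      by (rule push_mono[OF N(2,1)]) simp
    moreover have "push f n (max M N - n) y = push f k (max M N - k) y'"
      by (rule push_mono[OF M(2,1)]) simp
    ultimately have "push f n (max M N - n) (x \<otimes>\<^bsub>G n\<^esub> y) = push f k (max M N - k) (x' \<otimes>\<^bsub>G k\<^esub> y')"
      using carr N by (simp add: push_mult le_max_iff_disj)
    then show ?thesis
      using N by (auto simp: eqv_def intro!: exI[of _ "max M N"])
  qed
  have closed: "x \<otimes>\<^bsub>G n\<^esub> y \<in> carrier (G n)" if "x \<in> carrier (G n)" "y \<in> carrier (G n)" for n x y
    using group that by (simp add: group.is_monoid monoid.m_closed)
  have mult: "lim_class G f n x \<otimes>\<^bsub>lim_group G f\<^esub> lim_class G f n y = lim_class G f n (x \<otimes>\<^bsub>G n\<^esub> y)"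
    if carr: "x \<in> carrier (G n)" "y \<in> carrier (G n)" for n x y
  proof -
    \<comment> \<open>The product in \<open>lim_group\<close> is a union over all pairs of
      representatives at a common stage. All of them give the same class, so the union is over a
      singleton.\<close>
    have "{lim_class G f k (x' \<otimes>\<^bsub>G k\<^esub> y') | k x' y'.
        (k, x') \<in> lim_class G f n x \<and> (k, y') \<in> lim_class G f n y} = {lim_class G f n (x \<otimes>\<^bsub>G n\<^esub> y)}"
      (is "?S = _")
    proof
      show "?S \<subseteq> {lim_class G f n (x \<otimes>\<^bsub>G n\<^esub> y)}"
      proof
        fix A assume "A \<in> ?S"
        then obtain k x' y' where *: "A = lim_class G f k (x' \<otimes>\<^bsub>G k\<^esub> y')"
            "x' \<in> carrier (G k)" "y' \<in> carrier (G k)" "eqv n x k x'" "eqv n y k y'"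
          by (auto simp: mem)
        have "eqv k (x' \<otimes>\<^bsub>G k\<^esub> y') n (x \<otimes>\<^bsub>G n\<^esub> y)"
          using * carr by (intro eqv_mult) (auto intro: eqv_sym)
        then show "A \<in> {lim_class G f n (x \<otimes>\<^bsub>G n\<^esub> y)}"
          using * carr by (simp add: eq_iff closed)
      qed
      show "{lim_class G f n (x \<otimes>\<^bsub>G n\<^esub> y)} \<subseteq> ?S"
        using carr eqv_refl by (auto simp: mem intro!: exI[of _ n])
    qed
    then show ?thesis
      by (simp add: lim_group_def)
  qed
  have carrier: "carrier (lim_group G f) = {lim_class G f n x | n x. x \<in> carrier (G n)}"
    by (simp add: lim_group_def)
  have one: "\<one>\<^bsub>lim_group G f\<^esub> = lim_class G f n \<one>\<^bsub>G n\<^esub>" for n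
  proof -
    have "push f 0 d \<one>\<^bsub>G 0\<^esub> = \<one>\<^bsub>G d\<^esub>" for d
      by (induction d) (simp_all add: hom_one[OF hom] group)
    then have "eqv 0 \<one>\<^bsub>G 0\<^esub> n \<one>\<^bsub>G n\<^esub>"
      unfolding eqv_def by (intro exI[of _ n]) simp
    then show ?thesis
      by (simp add: lim_group_def eq_iff group group.is_monoid)
  qed
  have stage: "\<exists>x'\<in>carrier (G N). lim_class G f n x = lim_class G f N x'"
    if "x \<in> carrier (G n)" "n \<le> N" for n x N
  proof
    show x': "push f n (N - n) x \<in> carrier (G N)"
      using push_closed[OF that(1), of "N - n"] that(2) by simp
    have "eqv n x N (push f n (N - n) x)"
      using that unfolding eqv_def by (intro exI[of _ N]) auto
    then show "lim_class G f n x = lim_class G f N (push f n (N - n) x)"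
      using that x' by (simp add: eq_iff)
  qed
  have stage2: "\<exists>n. \<exists>x\<in>carrier (G n). \<exists>y\<in>carrier (G n). A = lim_class G f n x \<and> B = lim_class G f n y"
    if AB: "A \<in> carrier (lim_group G f)" "B \<in> carrier (lim_group G f)" for A B
  proof -
    obtain n x k y where "x \<in> carrier (G n)" "y \<in> carrier (G k)"
        "A = lim_class G f n x" "B = lim_class G f k y"
      using AB unfolding carrier by blast
    then show ?thesis
      using stage[of x n "max n k"] stage[of y k "max n k"] by (metis max.cobounded1 max.cobounded2)
  qed
  have class_carrier: "lim_class G f n x \<in> carrier (lim_group G f)" if "x \<in> carrier (G n)" for n x
    using that unfolding carrier by blast
  show ?thesis
  proof (rule direct_limit.intro)
    show "group (lim_group G f)"
    proof (rule groupI)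
      fix A B assume "A \<in> carrier (lim_group G f)" "B \<in> carrier (lim_group G f)"
      then obtain n x y where "x \<in> carrier (G n)" "y \<in> carrier (G n)"
          "A = lim_class G f n x" "B = lim_class G f n y"
        using stage2 by blast
      then show "A \<otimes>\<^bsub>lim_group G f\<^esub> B \<in> carrier (lim_group G f)"
        by (simp add: mult class_carrier closed)
    next
      fix A B C
      assume "A \<in> carrier (lim_group G f)" "B \<in> carrier (lim_group G f)" "C \<in> carrier (lim_group G f)"
      then obtain n x y k z where *: "x \<in> carrier (G n)" "y \<in> carrier (G n)" "z \<in> carrier (G k)"
          "A = lim_class G f n x" "B = lim_class G f n y" "C = lim_class G f k z"
        using stage2[of A B] unfolding carrier by blast
      define N where "N = max n k"
      obtain x' y' z' where "x' \<in> carrier (G N)" "y' \<in> carrier (G N)" "z' \<in> carrier (G N)"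
          "A = lim_class G f N x'" "B = lim_class G f N y'" "C = lim_class G f N z'"
        using stage[OF *(1), of N] stage[OF *(2), of N] stage[OF *(3), of N] *(4-6)
        by (auto simp: N_def)
      then show "A \<otimes>\<^bsub>lim_group G f\<^esub> B \<otimes>\<^bsub>lim_group G f\<^esub> C
          = A \<otimes>\<^bsub>lim_group G f\<^esub> (B \<otimes>\<^bsub>lim_group G f\<^esub> C)"
        using group[of N] by (simp add: mult closed group.is_monoid monoid.m_assoc)
    next
      show "\<one>\<^bsub>lim_group G f\<^esub> \<in> carrier (lim_group G f)"
        using group[of 0] by (simp add: one[of 0] class_carrier group.is_monoid)
    next
      fix A assume "A \<in> carrier (lim_group G f)"
      then obtain n x where x: "x \<in> carrier (G n)" "A = lim_class G f n x"
        unfolding carrier by blast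
      show "\<one>\<^bsub>lim_group G f\<^esub> \<otimes>\<^bsub>lim_group G f\<^esub> A = A"
        using x group[of n] by (simp add: one[of n] mult group.is_monoid)
      have "lim_class G f n (inv\<^bsub>G n\<^esub> x) \<otimes>\<^bsub>lim_group G f\<^esub> A = \<one>\<^bsub>lim_group G f\<^esub>"
        using x group[of n] by (simp add: one[of n] mult group.l_inv)
      then show "\<exists>B\<in>carrier (lim_group G f). B \<otimes>\<^bsub>lim_group G f\<^esub> A = \<one>\<^bsub>lim_group G f\<^esub>"
        using x group[of n] by (metis class_carrier group.inv_closed)
    qed
    show "lim_class G f n \<in> hom (G n) (lim_group G f)" for n
      by (intro homI) (simp_all add: mult class_carrier)
  next
    fix x n assume x: "x \<in> carrier (G n)"
    then have "f n x \<in> carrier (G (Suc n))"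
      using hom by (auto simp: hom_def)
    moreover have "eqv (Suc n) (f n x) n x"
      unfolding eqv_def by (intro exI[of _ "Suc n"]) simp
    ultimately show "lim_class G f (Suc n) (f n x) = lim_class G f n x"
      using x by (simp add: eq_iff)
  next
    fix z assume "z \<in> carrier (lim_group G f)"
    then show "\<exists>n. z \<in> lim_class G f n ` carrier (G n)"
      unfolding carrier by blast
  next
    fix x n y assume "x \<in> carrier (G n)" "y \<in> carrier (G n)" "lim_class G f n x = lim_class G f n y"
    then show "\<exists>d. push f n d x = push f n d y"
      by (auto simp: eq_iff eqv_def)
  qed (use group hom in auto)
qed

text \<open>An isomorphism exhibits its target as the limit of a constant system. Together with
  uniqueness of limits, this lets any construction that preserves limits preserve isomorphisms
  too.\<close>

lemma direct_limit_const:
  assumes "group G" "group H" "\<phi> \<in> iso G H"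
  shows "direct_limit (\<lambda>_. G) (\<lambda>_. id) H (\<lambda>_. \<phi>)"
proof (rule direct_limit.intro)
  have push: "push (\<lambda>_. id) n d x = x" for n d and x :: 'a
    by (induction d) simp_all
  fix x y assume "x \<in> carrier G" "y \<in> carrier G" "\<phi> x = \<phi> y"
  then show "\<exists>d. push (\<lambda>_. id) n d x = push (\<lambda>_. id) n d y" for n
    using assms(3) by (auto simp: push iso_def bij_betw_def dest: inj_onD)
qed (use assms in \<open>auto simp: iso_def bij_betw_def hom_def\<close>)

section \<open>Copies of countable groups on the natural numbers\<close>

lemma to_nat_on_iso:
  assumes "countable (carrier G)" "group G"
  shows "to_nat_on (carrier G) \<in> iso G (nat_copy G)"
proof -
  have "to_nat_on (carrier G) (x \<otimes>\<^bsub>G\<^esub> y) =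
      to_nat_on (carrier G) x \<otimes>\<^bsub>nat_copy G\<^esub> to_nat_on (carrier G) y"
    if "x \<in> carrier G" "y \<in> carrier G" for x y
    using assms that by (simp add: nat_copy_def from_nat_into_to_nat_on)
  then show ?thesis
    using assms inj_on_to_nat_on[of "carrier G"] by (auto simp: iso_def hom_def bij_betw_def nat_copy_def)
qed

lemma group_nat_copy:
  assumes "countable (carrier G)" "group G"
  shows "group (nat_copy G)"
proof -
  have "nat_copy G = nat_copy G\<lparr>one := to_nat_on (carrier G) \<one>\<^bsub>G\<^esub>\<rparr>"
    by (simp add: nat_copy_def)
  then show ?thesis
    using group.iso_imp_img_group[OF assms(2) to_nat_on_iso[OF assms]] by simp
qed

lemma nat_copy_iso:
  assumes "countable (carrier G)" "group G"
  shows "G \<cong> nat_copy G"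
  using to_nat_on_iso[OF assms] by (auto simp: is_iso_def)

lemma direct_limit_nat_copy:
  fixes G :: "nat \<Rightarrow> 'a monoid" and L :: "'b monoid"
  assumes "direct_limit G f L \<iota>" "\<And>n. countable (carrier (G n))" "countable (carrier L)"
  shows "direct_limit (\<lambda>n. nat_copy (G n))
    (\<lambda>n x. to_nat_on (carrier (G (Suc n))) (f n (from_nat_into (carrier (G n)) x)))
    (nat_copy L) (\<lambda>n x. to_nat_on (carrier L) (\<iota> n (from_nat_into (carrier (G n)) x)))"
proof -
  interpret direct_limit G f L \<iota> by fact
  show ?thesis
    by (rule direct_limit_iso[where e = "\<lambda>n. to_nat_on (carrier (G n))" and \<epsilon> = "to_nat_on (carrier L)"])
      (use assms(2,3) in \<open>auto simp: group_nat_copy to_nat_on_iso group_system group_limit\<close>)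
qed

section \<open>The functors \<open>T\<^sub>0\<close> and \<open>T\<^sub>1\<close>\<close>

lemma group_tilde: "group \<Gamma> \<Longrightarrow> group (tilde_group \<Gamma>)"
  by (simp add: tilde_group_def)

lemma carrier_tilde:
  "group \<Gamma> \<Longrightarrow> carrier (tilde_group \<Gamma>) =
    {x \<in> {1..} \<rightarrow>\<^sub>E carrier \<Gamma>. finite {i \<in> {1..}. x i \<noteq> \<one>\<^bsub>\<Gamma>\<^esub>}}"
  by (simp add: tilde_group_def carrier_sum_group)

lemma mult_tilde: "x \<otimes>\<^bsub>tilde_group \<Gamma>\<^esub> y = (\<lambda>i\<in>{1..}. x i \<otimes>\<^bsub>\<Gamma>\<^esub> y i)"
  by (simp add: tilde_group_def)

lemma one_tilde: "\<one>\<^bsub>tilde_group \<Gamma>\<^esub> = (\<lambda>i\<in>{1..}. \<one>\<^bsub>\<Gamma>\<^esub>)"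
  by (simp add: tilde_group_def)

lemma tilde_map_hom:
  assumes "group \<Gamma>" "group \<Delta>" "f \<in> hom \<Gamma> \<Delta>"
  shows "tilde_map f \<in> hom (tilde_group \<Gamma>) (tilde_group \<Delta>)"
proof (rule homI)
  have one: "f \<one>\<^bsub>\<Gamma>\<^esub> = \<one>\<^bsub>\<Delta>\<^esub>"
    using assms by (simp add: hom_one)
  fix x assume x: "x \<in> carrier (tilde_group \<Gamma>)"
  then have "finite {i \<in> {1..}. x i \<noteq> \<one>\<^bsub>\<Gamma>\<^esub>}"
    using assms by (simp add: carrier_tilde)
  then have "finite {i \<in> {1..}. f (x i) \<noteq> \<one>\<^bsub>\<Delta>\<^esub>}"
    by (rule rev_finite_subset) (auto simp: one)
  then show "tilde_map f x \<in> carrier (tilde_group \<Delta>)"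
    using x assms by (auto simp: carrier_tilde tilde_map_def hom_def cong: conj_cong)
next
  fix x y assume "x \<in> carrier (tilde_group \<Gamma>)" "y \<in> carrier (tilde_group \<Gamma>)"
  then have "x i \<in> carrier \<Gamma>" "y i \<in> carrier \<Gamma>" if "i \<ge> 1" for i
    using assms(1) that by (auto simp: carrier_tilde)
  then show "tilde_map f (x \<otimes>\<^bsub>tilde_group \<Gamma>\<^esub> y) =
      tilde_map f x \<otimes>\<^bsub>tilde_group \<Delta>\<^esub> tilde_map f y"
    using hom_mult[OF assms(3)] by (auto simp: mult_tilde tilde_map_def fun_eq_iff)
qed

lemma countable_tilde:
  assumes "group \<Gamma>" "countable (carrier \<Gamma>)"
  shows "countable (carrier (tilde_group \<Gamma>))"
proof -
  define ext where "ext xs = (\<lambda>i\<in>{1::nat..}. if i < length xs then xs ! i else \<one>\<^bsub>\<Gamma>\<^esub>)" for xs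
  have "x \<in> ext ` lists (carrier \<Gamma>)" if "x \<in> carrier (tilde_group \<Gamma>)" for x
  proof -
    have x: "x \<in> {1..} \<rightarrow>\<^sub>E carrier \<Gamma>" "finite {i \<in> {1..}. x i \<noteq> \<one>\<^bsub>\<Gamma>\<^esub>}"
      using that assms by (auto simp: carrier_tilde)
    obtain N where N: "\<forall>i\<in>{i \<in> {1..}. x i \<noteq> \<one>\<^bsub>\<Gamma>\<^esub>}. i < N"
      using x(2) finite_nat_set_iff_bounded by blast
    \<comment> \<open>Indices start at 1, so entry 0 of the list is padding that \<open>ext\<close>
      ignores; \<open>N\<close> lies beyond the support, where \<open>ext\<close> supplies the
      identity.\<close>
    define xs where "xs = map (\<lambda>i. if i = 0 then \<one>\<^bsub>\<Gamma>\<^esub> else x i) [0..<N]"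
    have "x = ext xs"
      using x(1) N by (auto simp: ext_def xs_def fun_eq_iff PiE_def extensional_def)
    moreover have "xs \<in> lists (carrier \<Gamma>)"
      using x(1) assms(1) by (auto simp: xs_def PiE_iff group.is_monoid)
    ultimately show ?thesis
      by blast
  qed
  then show ?thesis
    using assms(2) by (meson countable_image countable_lists countable_subset subsetI)
qed

text \<open>Finite support is essential: only finitely many coordinates have to be lifted, or
  identified, and these share a stage. Outside the supports both coordinates are the
  identity.\<close>

lemma (in direct_limit) direct_limit_tilde:
  "direct_limit (\<lambda>n. tilde_group (G n)) (\<lambda>n. tilde_map (f n)) (tilde_group L) (\<lambda>n. tilde_map (\<iota> n))"
proof (rule direct_limit.intro)
  show "group (tilde_group (G n))" "group (tilde_group L)" for n
    by (intro group_tilde group_system group_limit)+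
  show "tilde_map (f n) \<in> hom (tilde_group (G n)) (tilde_group (G (Suc n)))"
       "tilde_map (\<iota> n) \<in> hom (tilde_group (G n)) (tilde_group L)" for n
    by (intro tilde_map_hom group_system group_limit hom_system hom_limit)+
next
  fix x n assume "x \<in> carrier (tilde_group (G n))"
  then show "tilde_map (\<iota> (Suc n)) (tilde_map (f n) x) = tilde_map (\<iota> n) x"
    by (auto simp: tilde_map_def carrier_tilde group_system PiE_iff fun_eq_iff intro!: limit_compat)
next
  fix y assume "y \<in> carrier (tilde_group L)"
  then have y: "y \<in> {1..} \<rightarrow>\<^sub>E carrier L" "finite {i \<in> {1..}. y i \<noteq> \<one>\<^bsub>L\<^esub>}"
    by (auto simp: carrier_tilde group_limit)
  have "\<forall>\<^sub>F n in sequentially. \<forall>i\<in>{i \<in> {1..}. y i \<noteq> \<one>\<^bsub>L\<^esub>}. y i \<in> \<iota> n ` carrier (G n)"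
    using y by (intro eventually_ball_finite) (auto intro!: limit_surj_eventually)
  then obtain n where n: "\<And>i. i \<ge> 1 \<Longrightarrow> y i \<noteq> \<one>\<^bsub>L\<^esub> \<Longrightarrow> y i \<in> \<iota> n ` carrier (G n)"
    by (auto dest!: eventually_happens'[OF sequentially_bot])
  \<comment> \<open>Trivial coordinates are lifted to the identity itself and not to an arbitrary
    preimage; otherwise the lift could have infinite support.\<close>
  define x where "x = (\<lambda>i\<in>{1..}. if y i = \<one>\<^bsub>L\<^esub> then \<one>\<^bsub>G n\<^esub> else inv_into (carrier (G n)) (\<iota> n) (y i))"
  have "x i \<in> carrier (G n) \<and> \<iota> n (x i) = y i" if "i \<ge> 1" for i
    using that n[OF that] group_system[of n]
    by (auto simp: x_def limit_one f_inv_into_f group.is_monoid intro!: inv_into_into)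
  moreover have "finite {i \<in> {1..}. x i \<noteq> \<one>\<^bsub>G n\<^esub>}"
    using y(2) by (rule rev_finite_subset) (auto simp: x_def)
  ultimately have "x \<in> carrier (tilde_group (G n))" "tilde_map (\<iota> n) x = y"
    using y(1) by (auto simp: carrier_tilde group_system tilde_map_def x_def PiE_def extensional_def
        fun_eq_iff)
  then show "\<exists>n. y \<in> tilde_map (\<iota> n) ` carrier (tilde_group (G n))"
    by blast
next
  fix x n y assume xy: "x \<in> carrier (tilde_group (G n))" "y \<in> carrier (tilde_group (G n))"
    and eq: "tilde_map (\<iota> n) x = tilde_map (\<iota> n) y"
  have x: "x \<in> {1..} \<rightarrow>\<^sub>E carrier (G n)" "finite {i \<in> {1..}. x i \<noteq> \<one>\<^bsub>G n\<^esub>}"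
    and y: "y \<in> {1..} \<rightarrow>\<^sub>E carrier (G n)" "finite {i \<in> {1..}. y i \<noteq> \<one>\<^bsub>G n\<^esub>}"
    using xy by (auto simp: carrier_tilde group_system)
  have push: "push (\<lambda>n. tilde_map (f n)) n d z = tilde_map (push f n d) z"
    if "z \<in> {1..} \<rightarrow>\<^sub>E carrier (G n)" for d z
    by (induction d) (use that in \<open>auto simp: tilde_map_def fun_eq_iff PiE_def extensional_def\<close>)
  let ?S = "{i \<in> {1..}. x i \<noteq> \<one>\<^bsub>G n\<^esub>} \<union> {i \<in> {1..}. y i \<noteq> \<one>\<^bsub>G n\<^esub>}"
  have "\<iota> n (x i) = \<iota> n (y i)" if "i \<ge> 1" for i
    using fun_cong[OF eq, of i] that by (simp add: tilde_map_def)
  then have "\<forall>\<^sub>F N in sequentially. \<forall>i\<in>?S. transition n N (x i) = transition n N (y i)"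
    using x y by (intro eventually_ball_finite) (auto intro!: limit_inj_eventually)
  then obtain N where N: "\<And>i. i \<in> ?S \<Longrightarrow> transition n N (x i) = transition n N (y i)"
    by (auto dest!: eventually_happens'[OF sequentially_bot])
  have "transition n N (x i) = transition n N (y i)" if "i \<ge> 1" for i
    using that N[of i] by (cases "i \<in> ?S") auto
  then have "push (\<lambda>n. tilde_map (f n)) n (N - n) x = push (\<lambda>n. tilde_map (f n)) n (N - n) y"
    using x y by (auto simp: push tilde_map_def transition_def fun_eq_iff)
  then show "\<exists>d. push (\<lambda>n. tilde_map (f n)) n d x = push (\<lambda>n. tilde_map (f n)) n d y"
    by blast
qed

section \<open>Finitely supported permutations and the semidirect product\<close>

lemma fin_perms_comp: "\<sigma> \<in> fin_perms \<Longrightarrow> \<rho> \<in> fin_perms \<Longrightarrow> \<sigma> \<circ> \<rho> \<in> fin_perms"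
proof -
  assume *: "\<sigma> \<in> fin_perms" "\<rho> \<in> fin_perms"
  then have "finite ({i. \<sigma> i \<noteq> i} \<union> {i. \<rho> i \<noteq> i})"
    by (simp add: fin_perms_def)
  then have "finite {i. (\<sigma> \<circ> \<rho>) i \<noteq> i}"
    by (rule rev_finite_subset) auto
  then show ?thesis
    using * by (auto simp: fin_perms_def intro: permutes_compose)
qed

lemma fin_perms_id: "id \<in> fin_perms"
  by (simp add: fin_perms_def permutes_id)

lemma fin_perms_bij: "\<sigma> \<in> fin_perms \<Longrightarrow> bij \<sigma>"
  by (auto simp: fin_perms_def permutes_bij)

lemma fin_perms_inv: "\<sigma> \<in> fin_perms \<Longrightarrow> inv_into UNIV \<sigma> \<in> fin_perms"
proof -
  assume \<sigma>: "\<sigma> \<in> fin_perms"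
  have "{i. inv_into UNIV \<sigma> i \<noteq> i} \<subseteq> {i. \<sigma> i \<noteq> i}"
    using fin_perms_bij[OF \<sigma>] by (auto simp: bij_is_surj surj_f_inv_f) (metis bij_inv_eq_iff)
  then show ?thesis
    using \<sigma> by (auto simp: fin_perms_def intro: permutes_inv finite_subset)
qed

lemma fin_perms_inv_ge: "\<sigma> \<in> fin_perms \<Longrightarrow> i \<ge> 1 \<Longrightarrow> inv_into UNIV \<sigma> i \<ge> 1"
  using fin_perms_inv[of \<sigma>] permutes_in_image[of "inv_into UNIV \<sigma>" "{1..}" i]
  by (simp add: fin_perms_def)

lemma countable_fin_perms: "countable fin_perms"
proof -
  define ext where "ext xs = (\<lambda>i. if i < length xs then xs ! i else i)" for xs :: "nat list"
  have "\<sigma> \<in> range ext" if \<sigma>: "\<sigma> \<in> fin_perms" for \<sigma>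
  proof -
    obtain N where "\<forall>i\<in>{i. \<sigma> i \<noteq> i}. i < N"
      using \<sigma> finite_nat_set_iff_bounded[of "{i. \<sigma> i \<noteq> i}"] by (auto simp: fin_perms_def)
    then have "\<sigma> = ext (map \<sigma> [0..<N])"
      by (auto simp: ext_def fun_eq_iff)
    then show ?thesis
      by blast
  qed
  then show ?thesis
    by (meson countableI_type countable_image countable_subset subsetI)
qed

lemma perm_act_closed:
  assumes "group \<Gamma>" "\<sigma> \<in> fin_perms" "x \<in> carrier (tilde_group \<Gamma>)"
  shows "perm_act \<sigma> x \<in> carrier (tilde_group \<Gamma>)"
proof -
  have x: "x \<in> {1..} \<rightarrow>\<^sub>E carrier \<Gamma>" "finite {i \<in> {1..}. x i \<noteq> \<one>\<^bsub>\<Gamma>\<^esub>}"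
    using assms by (auto simp: carrier_tilde)
  have "{i \<in> {1..}. x (inv_into UNIV \<sigma> i) \<noteq> \<one>\<^bsub>\<Gamma>\<^esub>} \<subseteq> \<sigma> ` {i \<in> {1..}. x i \<noteq> \<one>\<^bsub>\<Gamma>\<^esub>}"
  proof
    fix i assume "i \<in> {i \<in> {1..}. x (inv_into UNIV \<sigma> i) \<noteq> \<one>\<^bsub>\<Gamma>\<^esub>}"
    then have "inv_into UNIV \<sigma> i \<in> {i \<in> {1..}. x i \<noteq> \<one>\<^bsub>\<Gamma>\<^esub>}"
      using fin_perms_inv_ge[OF assms(2), of i] by simp
    moreover have "i = \<sigma> (inv_into UNIV \<sigma> i)"
      using fin_perms_bij[OF assms(2)] by (simp add: bij_is_surj surj_f_inv_f)
    ultimately show "i \<in> \<sigma> ` {i \<in> {1..}. x i \<noteq> \<one>\<^bsub>\<Gamma>\<^esub>}"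
      by blast
  qed
  then have "finite {i \<in> {1..}. x (inv_into UNIV \<sigma> i) \<noteq> \<one>\<^bsub>\<Gamma>\<^esub>}"
    using x(2) finite_subset by blast
  then show ?thesis
    using x(1) fin_perms_inv_ge[OF assms(2)] assms(1)
    by (auto simp: carrier_tilde perm_act_def PiE_iff cong: conj_cong)
qed

lemma perm_act_comp:
  assumes "\<sigma> \<in> fin_perms" "\<rho> \<in> fin_perms"
  shows "perm_act (\<sigma> \<circ> \<rho>) x = perm_act \<sigma> (perm_act \<rho> x)"
proof -
  have "inv_into UNIV (\<sigma> \<circ> \<rho>) i = inv_into UNIV \<rho> (inv_into UNIV \<sigma> i)" for i
    using assms by (simp add: o_inv_distrib fin_perms_bij)
  then show ?thesis
    using fin_perms_inv_ge[OF assms(1)] by (auto simp: perm_act_def fun_eq_iff)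
qed

lemma perm_act_mult:
  assumes "\<sigma> \<in> fin_perms"
  shows "perm_act \<sigma> (x \<otimes>\<^bsub>tilde_group \<Gamma>\<^esub> y) = perm_act \<sigma> x \<otimes>\<^bsub>tilde_group \<Gamma>\<^esub> perm_act \<sigma> y"
  using fin_perms_inv_ge[OF assms] by (auto simp: perm_act_def mult_tilde fun_eq_iff)

lemma tilde_map_perm_act:
  assumes "\<sigma> \<in> fin_perms"
  shows "tilde_map f (perm_act \<sigma> x) = perm_act \<sigma> (tilde_map f x)"
  using fin_perms_inv_ge[OF assms] by (auto simp: perm_act_def tilde_map_def fun_eq_iff)

lemma perm_act_id: "x \<in> carrier (tilde_group \<Gamma>) \<Longrightarrow> group \<Gamma> \<Longrightarrow> perm_act id x = x"
  by (auto simp: perm_act_def carrier_tilde PiE_def extensional_def fun_eq_iff)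

lemma carrier_semidirect [simp]:
  "carrier (tilde_semidirect \<Gamma>) = carrier (tilde_group \<Gamma>) \<times> fin_perms"
  by (simp add: tilde_semidirect_def)

lemma mult_semidirect [simp]:
  "(x, \<sigma>) \<otimes>\<^bsub>tilde_semidirect \<Gamma>\<^esub> (y, \<rho>) = (x \<otimes>\<^bsub>tilde_group \<Gamma>\<^esub> perm_act \<sigma> y, \<sigma> \<circ> \<rho>)"
  by (simp add: tilde_semidirect_def)

lemma one_semidirect [simp]: "\<one>\<^bsub>tilde_semidirect \<Gamma>\<^esub> = (\<one>\<^bsub>tilde_group \<Gamma>\<^esub>, id)"
  by (simp add: tilde_semidirect_def)

lemma group_semidirect:
  assumes "group \<Gamma>"
  shows "group (tilde_semidirect \<Gamma>)"
proof (rule groupI)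
  interpret group "tilde_group \<Gamma>"
    using assms by (rule group_tilde)
  note closed = perm_act_closed[OF assms]
  fix p assume "p \<in> carrier (tilde_semidirect \<Gamma>)"
  then obtain x \<sigma> where p: "p = (x, \<sigma>)" "x \<in> carrier (tilde_group \<Gamma>)" "\<sigma> \<in> fin_perms"
    by auto
  have inv: "inv_into UNIV \<sigma> \<in> fin_perms"
    using p by (simp add: fin_perms_inv)
  show "\<one>\<^bsub>tilde_semidirect \<Gamma>\<^esub> \<otimes>\<^bsub>tilde_semidirect \<Gamma>\<^esub> p = p"
    using p assms by (simp add: perm_act_id)
  let ?y = "(perm_act (inv_into UNIV \<sigma>) (inv\<^bsub>tilde_group \<Gamma>\<^esub> x), inv_into UNIV \<sigma>)"
  have "perm_act (inv_into UNIV \<sigma>) \<one>\<^bsub>tilde_group \<Gamma>\<^esub> = \<one>\<^bsub>tilde_group \<Gamma>\<^esub>"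
    using fin_perms_inv_ge[OF inv] by (auto simp: perm_act_def one_tilde fun_eq_iff)
  then have "?y \<otimes>\<^bsub>tilde_semidirect \<Gamma>\<^esub> p = \<one>\<^bsub>tilde_semidirect \<Gamma>\<^esub>"
    using p fin_perms_bij[of \<sigma>] by (simp add: perm_act_mult[OF inv, symmetric] l_inv bij_is_inj)
  then show "\<exists>q\<in>carrier (tilde_semidirect \<Gamma>). q \<otimes>\<^bsub>tilde_semidirect \<Gamma>\<^esub> p = \<one>\<^bsub>tilde_semidirect \<Gamma>\<^esub>"
    using p inv closed by (intro bexI[of _ ?y]) auto
  fix q assume "q \<in> carrier (tilde_semidirect \<Gamma>)"
  then show "p \<otimes>\<^bsub>tilde_semidirect \<Gamma>\<^esub> q \<in> carrier (tilde_semidirect \<Gamma>)"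
    using p closed by (auto simp: fin_perms_comp)
  fix r assume "r \<in> carrier (tilde_semidirect \<Gamma>)"
  then show "p \<otimes>\<^bsub>tilde_semidirect \<Gamma>\<^esub> q \<otimes>\<^bsub>tilde_semidirect \<Gamma>\<^esub> r =
      p \<otimes>\<^bsub>tilde_semidirect \<Gamma>\<^esub> (q \<otimes>\<^bsub>tilde_semidirect \<Gamma>\<^esub> r)"
    using p \<open>q \<in> _\<close> closed
    by (auto simp: perm_act_mult perm_act_comp m_assoc fin_perms_comp comp_assoc)
next
  interpret group "tilde_group \<Gamma>"
    using assms by (rule group_tilde)
  show "\<one>\<^bsub>tilde_semidirect \<Gamma>\<^esub> \<in> carrier (tilde_semidirect \<Gamma>)"
    by (simp add: fin_perms_id)
qed

lemma semidirect_map_hom: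
  assumes "group \<Gamma>" "group \<Delta>" "f \<in> hom \<Gamma> \<Delta>"
  shows "map_prod (tilde_map f) id \<in> hom (tilde_semidirect \<Gamma>) (tilde_semidirect \<Delta>)"
  using tilde_map_hom[OF assms] perm_act_closed[OF assms(1)]
  by (auto simp: hom_def Pi_iff tilde_map_perm_act)

text \<open>The maps of the system leave the permutation unchanged, so lifting elements and
  equalities reduces to the first coordinate.\<close>

lemma (in direct_limit) direct_limit_semidirect:
  "direct_limit (\<lambda>n. tilde_semidirect (G n)) (\<lambda>n. map_prod (tilde_map (f n)) id)
    (tilde_semidirect L) (\<lambda>n. map_prod (tilde_map (\<iota> n)) id)"
proof -
  interpret tilde: direct_limit "\<lambda>n. tilde_group (G n)" "\<lambda>n. tilde_map (f n)" "tilde_group L"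
      "\<lambda>n. tilde_map (\<iota> n)"
    by (rule direct_limit_tilde)
  have push: "push (\<lambda>n. map_prod (tilde_map (f n)) id) n d (x, \<sigma>) =
      (push (\<lambda>n. tilde_map (f n)) n d x, \<sigma>)" for n d x and \<sigma> :: "nat \<Rightarrow> nat"
    by (induction d) simp_all
  show ?thesis
  proof (rule direct_limit.intro)
    show "group (tilde_semidirect (G n))" "group (tilde_semidirect L)" for n
      by (intro group_semidirect group_system group_limit)+
    show "map_prod (tilde_map (f n)) id \<in> hom (tilde_semidirect (G n)) (tilde_semidirect (G (Suc n)))"
         "map_prod (tilde_map (\<iota> n)) id \<in> hom (tilde_semidirect (G n)) (tilde_semidirect L)" for n
      by (intro semidirect_map_hom group_system group_limit hom_system hom_limit)+
  next
    fix p n assume "p \<in> carrier (tilde_semidirect (G n))"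
    then show "map_prod (tilde_map (\<iota> (Suc n))) id (map_prod (tilde_map (f n)) id p) =
        map_prod (tilde_map (\<iota> n)) id p"
      using tilde.limit_compat by auto
  next
    fix p assume "p \<in> carrier (tilde_semidirect L)"
    then obtain y \<sigma> where p: "p = (y, \<sigma>)" "y \<in> carrier (tilde_group L)" "\<sigma> \<in> fin_perms"
      by auto
    from tilde.limit_surj[OF p(2)] obtain n x
      where "x \<in> carrier (tilde_group (G n))" "y = tilde_map (\<iota> n) x"
      by blast
    then have "p = map_prod (tilde_map (\<iota> n)) id (x, \<sigma>)" "(x, \<sigma>) \<in> carrier (tilde_semidirect (G n))"
      using p by simp_all
    then show "\<exists>n. p \<in> map_prod (tilde_map (\<iota> n)) id ` carrier (tilde_semidirect (G n))"
      by blast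
  next
    fix p n q assume "p \<in> carrier (tilde_semidirect (G n))" "q \<in> carrier (tilde_semidirect (G n))"
      "map_prod (tilde_map (\<iota> n)) id p = map_prod (tilde_map (\<iota> n)) id q"
    then show "\<exists>d. push (\<lambda>n. map_prod (tilde_map (f n)) id) n d p =
        push (\<lambda>n. map_prod (tilde_map (f n)) id) n d q"
      using tilde.limit_inj by (auto simp: push)
  qed
qed

lemma copy_emb_carrier:
  assumes "group \<Gamma>" "g \<in> carrier \<Gamma>"
  shows "copy_emb \<Gamma> n g \<in> carrier (tilde_group \<Gamma>)"
proof -
  have "finite {i \<in> {1..}. copy_emb \<Gamma> n g i \<noteq> \<one>\<^bsub>\<Gamma>\<^esub>}"
    by (rule finite_subset[of _ "{n}"]) (auto simp: copy_emb_def)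
  then show ?thesis
    using assms by (auto simp: carrier_tilde copy_emb_def group.is_monoid)
qed

lemma T0_comm_subset: "group \<Gamma> \<Longrightarrow> T0_comm \<Gamma> j \<subseteq> carrier (tilde_group \<Gamma>)"
  by (auto simp: T0_comm_def copy_emb_carrier)

lemma T1_comm_subset: "group \<Gamma> \<Longrightarrow> T1_comm \<Gamma> j \<subseteq> carrier (tilde_semidirect \<Gamma>)"
  using T0_comm_subset[of \<Gamma> j] by (auto simp: T1_comm_def fin_perms_id)

lemma tilde_map_copy_emb:
  "f \<one>\<^bsub>\<Gamma>\<^esub> = \<one>\<^bsub>\<Delta>\<^esub> \<Longrightarrow> tilde_map f (copy_emb \<Gamma> n g) = copy_emb \<Delta> n (f g)"
  by (auto simp: tilde_map_def copy_emb_def fun_eq_iff)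

lemma tilde_map_T0_comm:
  assumes "f \<in> hom \<Gamma> \<Delta>" "f \<one>\<^bsub>\<Gamma>\<^esub> = \<one>\<^bsub>\<Delta>\<^esub>"
  shows "tilde_map f ` T0_comm \<Gamma> j \<subseteq> T0_comm \<Delta> j"
  unfolding T0_comm_def image_UN image_image
    tilde_map_copy_emb[where f = f and \<Gamma> = \<Gamma> and \<Delta> = \<Delta>, OF assms(2)]
  using assms(1) by (intro UN_mono subset_refl) (auto simp: hom_def)

lemma semidirect_map_T1_comm:
  assumes "f \<in> hom \<Gamma> \<Delta>" "f \<one>\<^bsub>\<Gamma>\<^esub> = \<one>\<^bsub>\<Delta>\<^esub>"
  shows "map_prod (tilde_map f) id ` T1_comm \<Gamma> j \<subseteq> T1_comm \<Delta> j"
  using tilde_map_T0_comm[OF assms, of j] by (auto simp: T1_comm_def)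

text \<open>A relator lives in a single copy of the group and is lifted by lifting one element. The
  equality is the condition on relators required by \<open>direct_limit_presented\<close>.\<close>

lemma (in direct_limit) T0_comm_limit: "T0_comm L j = (\<Union>n. tilde_map (\<iota> n) ` T0_comm (G n) j)"
proof
  show "T0_comm L j \<subseteq> (\<Union>n. tilde_map (\<iota> n) ` T0_comm (G n) j)"
  proof
    fix x assume "x \<in> T0_comm L j"
    then obtain i y where y: "i \<ge> j" "y \<in> carrier L" "x = copy_emb L i y"
      by (auto simp: T0_comm_def)
    then obtain n z where "z \<in> carrier (G n)" "y = \<iota> n z"
      using limit_surj by blast
    then have "x = tilde_map (\<iota> n) (copy_emb (G n) i z)" "copy_emb (G n) i z \<in> T0_comm (G n) j"
      using y by (auto simp: tilde_map_copy_emb limit_one T0_comm_def)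
    then show "x \<in> (\<Union>n. tilde_map (\<iota> n) ` T0_comm (G n) j)"
      by blast
  qed
  show "(\<Union>n. tilde_map (\<iota> n) ` T0_comm (G n) j) \<subseteq> T0_comm L j"
    using tilde_map_T0_comm[OF hom_limit limit_one] by blast
qed

lemma T0_map_eq: "T0_map \<Delta> f = presented_map (tilde_group \<Delta>) (T0_comm \<Delta>) (tilde_map f)"
  by (simp add: fun_eq_iff T0_map_def presented_map_def)

lemma T1_map_eq:
  "T1_map \<Delta> f = presented_map (tilde_semidirect \<Delta>) (T1_comm \<Delta>) (map_prod (tilde_map f) id)"
  by (simp add: fun_eq_iff T1_map_def presented_map_def)

lemma (in direct_limit) direct_limit_T0:
  "direct_limit (\<lambda>n. T0 (G n)) (\<lambda>n. T0_map (G (Suc n)) (f n)) (T0 L) (\<lambda>n. T0_map L (\<iota> n))"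
  unfolding T0_def T0_map_eq
  by (rule direct_limit.direct_limit_presented[OF direct_limit_tilde])
    (auto simp: T0_comm_subset group_system T0_comm_limit
      intro!: subsetD[OF tilde_map_T0_comm[OF hom_system system_one]] simp del: image_subset_iff)

lemma (in direct_limit) direct_limit_T1:
  "direct_limit (\<lambda>n. T1 (G n)) (\<lambda>n. T1_map (G (Suc n)) (f n)) (T1 L) (\<lambda>n. T1_map L (\<iota> n))"
  unfolding T1_def T1_map_eq
proof (rule direct_limit.direct_limit_presented[OF direct_limit_semidirect])
  show "T1_comm (G n) j \<subseteq> carrier (tilde_semidirect (G n))" for n j
    by (intro T1_comm_subset group_system)
  show "map_prod (tilde_map (f n)) id ` T1_comm (G n) j \<subseteq> T1_comm (G (Suc n)) j" for n j
    by (intro semidirect_map_T1_comm hom_system system_one)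
  show "T1_comm L j = (\<Union>n. map_prod (tilde_map (\<iota> n)) id ` T1_comm (G n) j)" for j
    by (simp add: T1_comm_def T0_comm_limit image_UN image_image)
qed

section \<open>The functors on groups of natural numbers\<close>

lemma group_T0: "group \<Gamma> \<Longrightarrow> group (T0 \<Gamma>)"
  unfolding T0_def by (intro group_presented group_tilde)

lemma group_T1: "group \<Gamma> \<Longrightarrow> group (T1 \<Gamma>)"
  unfolding T1_def by (intro group_presented group_semidirect)

lemma countable_T0: "group \<Gamma> \<Longrightarrow> countable (carrier \<Gamma>) \<Longrightarrow> countable (carrier (T0 \<Gamma>))"
  unfolding T0_def by (intro countable_presented countable_tilde)

lemma countable_T1: "group \<Gamma> \<Longrightarrow> countable (carrier \<Gamma>) \<Longrightarrow> countable (carrier (T1 \<Gamma>))"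
  unfolding T1_def using countable_tilde[of \<Gamma>] countable_fin_perms
  by (intro countable_presented) simp

lemma group_T_nat: "group \<Gamma> \<Longrightarrow> group (T_nat b \<Gamma>)"
  by (simp add: T_nat_def group_nat_copy group_T0 group_T1 countable_T0 countable_T1)

lemma direct_limit_T_nat:
  assumes "direct_limit G f L \<iota>"
  shows "direct_limit (\<lambda>n. T_nat b (G n)) (\<lambda>n. T_map b (G n) (G (Suc n)) (f n))
    (T_nat b L) (\<lambda>n. T_map b (G n) L (\<iota> n))"
proof -
  interpret direct_limit G f L \<iota> by fact
  show ?thesis
  proof (cases b)
    case True
    then show ?thesis
      using direct_limit_nat_copy[OF direct_limit_T1]
      by (simp add: T_nat_def T_map_def[abs_def] countable_T1 group_system group_limit)
  next
    case False
    then show ?thesis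
      using direct_limit_nat_copy[OF direct_limit_T0]
      by (simp add: T_nat_def T_map_def[abs_def] countable_T0 group_system group_limit)
  qed
qed

lemma nat_copy_hom:
  assumes "group G" "countable (carrier G)" "group H" "countable (carrier H)" "\<phi> \<in> hom G H"
  shows "(\<lambda>x. to_nat_on (carrier H) (\<phi> (from_nat_into (carrier G) x))) \<in> hom (nat_copy G) (nat_copy H)"
proof -
  have "\<phi> x \<in> carrier H" if "x \<in> carrier G" for x
    using that assms(5) by (auto simp: hom_def)
  moreover have "x \<otimes>\<^bsub>G\<^esub> y \<in> carrier G" if "x \<in> carrier G" "y \<in> carrier G" for x y
    using that assms(1) by (simp add: group.is_monoid monoid.m_closed)
  ultimately show ?thesis
    using assms(2,4) hom_mult[OF assms(5)] by (auto simp: hom_def nat_copy_def)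
qed

lemma T_map_hom:
  assumes "group \<Gamma>" "group \<Delta>" "f \<in> hom \<Gamma> \<Delta>"
  shows "T_map b \<Gamma> \<Delta> f \<in> hom (T_nat b \<Gamma>) (T_nat b \<Delta>)"
proof -
  have one: "f \<one>\<^bsub>\<Gamma>\<^esub> = \<one>\<^bsub>\<Delta>\<^esub>"
    using assms by (simp add: hom_one)
  have "T0_map \<Delta> f \<in> hom (T0 \<Gamma>) (T0 \<Delta>)"
    unfolding T0_map_eq T0_def
    by (intro presented_map_hom tilde_map_hom tilde_map_T0_comm assms one
        hom_one[OF tilde_map_hom[OF assms]] group_tilde)
  moreover have "T1_map \<Delta> f \<in> hom (T1 \<Gamma>) (T1 \<Delta>)"
    unfolding T1_map_eq T1_def
    by (intro presented_map_hom semidirect_map_hom semidirect_map_T1_comm assms one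
        hom_one[OF semidirect_map_hom[OF assms]] group_semidirect)
  ultimately show ?thesis
    using assms(1,2) by (cases b)
      (simp_all add: T_nat_def T_map_def[abs_def] nat_copy_hom group_T0 group_T1 countable_T0 countable_T1)
qed

lemma copy_emb_hom:
  assumes "group \<Gamma>"
  shows "copy_emb \<Gamma> n \<in> hom \<Gamma> (tilde_group \<Gamma>)"
proof (rule homI)
  show "copy_emb \<Gamma> n (x \<otimes>\<^bsub>\<Gamma>\<^esub> y) = copy_emb \<Gamma> n x \<otimes>\<^bsub>tilde_group \<Gamma>\<^esub> copy_emb \<Gamma> n y" for x y
    using assms by (auto simp: mult_tilde fun_eq_iff copy_emb_def group.is_monoid)
qed (rule copy_emb_carrier[OF assms])

lemma Grp_hom: "(\<lambda>x. word_class H D [Grp x]) \<in> hom H (presented H D)"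
  by (rule homI) (auto simp: word_class_eq_iff intro!: imageI word_eq.sym[OF word_eq.grp_mult])

lemma T_emb_hom:
  assumes "group \<Gamma>"
  shows "T_emb b \<Gamma> \<in> hom \<Gamma> (T_nat b \<Gamma>)"
proof -
  have "T0_incl \<Gamma> \<circ> copy_emb \<Gamma> 1 \<in> hom \<Gamma> (T0 \<Gamma>)"
    unfolding T0_def T0_incl_def[abs_def] by (intro hom_compose[OF copy_emb_hom Grp_hom] assms)
  then have T0: "to_nat_on (carrier (T0 \<Gamma>)) \<circ> (T0_incl \<Gamma> \<circ> copy_emb \<Gamma> 1) \<in> hom \<Gamma> (nat_copy (T0 \<Gamma>))"
    by (rule hom_compose) (use to_nat_on_iso[of "T0 \<Gamma>"] assms in \<open>auto simp: iso_def countable_T0 group_T0\<close>)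
  have "(\<lambda>x. (x, id)) \<in> hom (tilde_group \<Gamma>) (tilde_semidirect \<Gamma>)"
    using assms by (auto intro!: homI simp: fin_perms_id perm_act_id)
  then have "T1_incl \<Gamma> \<circ> copy_emb \<Gamma> 1 \<in> hom \<Gamma> (T1 \<Gamma>)"
    using hom_compose[OF hom_compose[OF copy_emb_hom[OF assms, of 1]] Grp_hom]
    unfolding T1_def T1_incl_def[abs_def] comp_def by blast
  then have T1: "to_nat_on (carrier (T1 \<Gamma>)) \<circ> (T1_incl \<Gamma> \<circ> copy_emb \<Gamma> 1) \<in> hom \<Gamma> (nat_copy (T1 \<Gamma>))"
    by (rule hom_compose) (use to_nat_on_iso[of "T1 \<Gamma>"] assms in \<open>auto simp: iso_def countable_T1 group_T1\<close>)
  show ?thesis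
    using T0 T1 by (cases b) (simp_all add: T_emb_def[abs_def] T_nat_def comp_def)
qed

text \<open>Both groups are limits of the constant system at \<Gamma>, one through the identity and
  one through the isomorphism. Applying the functor to both leaves two limits of one system,
  whatever the functor does to the identity map.\<close>

lemma T_nat_cong:
  assumes "group \<Gamma>" "group \<Delta>" "\<Gamma> \<cong> \<Delta>"
  shows "T_nat b \<Gamma> \<cong> T_nat b \<Delta>"
proof -
  obtain \<phi> where \<phi>: "\<phi> \<in> iso \<Gamma> \<Delta>"
    using assms(3) by (auto simp: is_iso_def)
  have id: "id \<in> iso \<Gamma> \<Gamma>"
    by (simp add: iso_def hom_def)
  from direct_limit_T_nat[OF direct_limit_const[OF assms(1,1) id]]
    direct_limit_T_nat[OF direct_limit_const[OF assms(1,2) \<phi>]]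
  show ?thesis
    by (rule direct_limit_unique)
qed

section \<open>Iterated groups\<close>

lemma T_iter_append: "T_iter (bs @ cs) \<Gamma> = T_iter bs (T_iter cs \<Gamma>)"
  by (induction bs) simp_all

lemma group_T_iter: "group \<Gamma> \<Longrightarrow> group (T_iter bs \<Gamma>)"
  by (induction bs) (simp_all add: group_T_nat)

lemma T_iter_map_hom:
  assumes "group \<Gamma>" "group \<Delta>" "f \<in> hom \<Gamma> \<Delta>"
  shows "T_iter_map bs \<Gamma> \<Delta> f \<in> hom (T_iter bs \<Gamma>) (T_iter bs \<Delta>)"
  using assms by (induction bs) (simp_all add: T_map_hom group_T_iter)

lemma T_iter_cong:
  assumes "group \<Gamma>" "group \<Delta>" "\<Gamma> \<cong> \<Delta>"
  shows "T_iter bs \<Gamma> \<cong> T_iter bs \<Delta>"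
  using assms by (induction bs) (simp_all add: T_nat_cong group_T_iter)

lemma prefix_Suc_snoc: "prefix (Suc n) \<alpha> = prefix n \<alpha> @ [\<alpha> n]"
  by simp

text \<open>Prefixes are unfolded in two ways: at the end, where the next stage changes the
  innermost group, and at the front, where the outermost functor is removed.\<close>

lemma prefix_Suc_Cons: "prefix (Suc n) \<alpha> = \<alpha> 0 # prefix n (suffix 1 \<alpha>)"
  by (induction n) (simp_all add: prefix_Suc_snoc del: subsequence_def)

lemma group_K_fin: "group \<Gamma> \<Longrightarrow> countable (carrier \<Gamma>) \<Longrightarrow> group (K_fin bs \<Gamma>)"
  by (simp add: K_fin_def group_T_iter group_nat_copy)

lemma direct_limit_K_lim:
  assumes "group \<Gamma>" "countable (carrier \<Gamma>)"
  shows "\<exists>\<iota>. direct_limit (\<lambda>n. K_fin (prefix n \<alpha>) \<Gamma>) (K_step \<alpha> \<Gamma>) (K_lim \<alpha> \<Gamma>) \<iota>"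
proof -
  define G where "G n = K_fin (prefix n \<alpha>) \<Gamma>" for n
  have copy: "group (nat_copy \<Gamma>)"
    using assms by (intro group_nat_copy)
  have G: "group (G n)" for n
    using assms by (simp add: G_def group_K_fin)
  \<comment> \<open>The next stage is the same iterated functor applied to a larger innermost group;
    thus it is the target of \<open>T_iter_map\<close> applied to the embedding
    \<open>T_emb\<close>.\<close>
  have "G (Suc n) = T_iter (prefix n \<alpha>) (T_nat (\<alpha> n) (nat_copy \<Gamma>))" for n
    unfolding G_def K_fin_def prefix_Suc_snoc T_iter_append by simp
  then have "K_step \<alpha> \<Gamma> n \<in> hom (G n) (G (Suc n))" for n
    using copy unfolding K_step_def by (simp add: G_def K_fin_def T_iter_map_hom group_T_nat T_emb_hom)
  then interpret lim: direct_limit G "K_step \<alpha> \<Gamma>" "lim_group G (K_step \<alpha> \<Gamma>)" "lim_class G (K_step \<alpha> \<Gamma>)"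
    using G by (intro direct_limit_lim_group)
  have "carrier (lim_group G (K_step \<alpha> \<Gamma>)) \<subseteq> (\<Union>n. lim_class G (K_step \<alpha> \<Gamma>) n ` carrier (G n))"
    using lim.limit_surj by blast
  \<comment> \<open>The stages consist of natural numbers, so the limit is a countable union of
    countable sets. Countability makes \<open>nat_copy\<close> an isomorphic copy of it.\<close>
  then have c: "countable (carrier (lim_group G (K_step \<alpha> \<Gamma>)))"
    by (rule countable_subset) auto
  have "direct_limit G (K_step \<alpha> \<Gamma>) (nat_copy (lim_group G (K_step \<alpha> \<Gamma>)))
      (\<lambda>n x. to_nat_on (carrier (lim_group G (K_step \<alpha> \<Gamma>))) (lim_class G (K_step \<alpha> \<Gamma>) n x))"
    by (rule lim.direct_limit_iso[where e = "\<lambda>_ x. x"])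
      (use c in \<open>auto simp: G lim.group_limit group_nat_copy to_nat_on_iso iso_set_refl\<close>)
  then show ?thesis
    unfolding K_lim_def G_def by blast
qed

lemma group_K_lim:
  assumes "group \<Gamma>" "countable (carrier \<Gamma>)"
  shows "group (K_lim \<alpha> \<Gamma>)"
  using direct_limit_K_lim[OF assms] direct_limit.group_limit by blast

text \<open>Without its stage 0, the system of the sequence is the image of the system of its tail
  under the first functor, maps included. Both sides are therefore limits of the same
  system.\<close>

lemma K_lim_rec:
  assumes "group \<Gamma>" "countable (carrier \<Gamma>)"
  shows "K_lim \<alpha> \<Gamma> \<cong> T_nat (\<alpha> 0) (K_lim (suffix 1 \<alpha>) \<Gamma>)"
proof -
  let ?\<beta> = "suffix 1 \<alpha>"
  obtain \<iota> where "direct_limit (\<lambda>n. K_fin (prefix n \<alpha>) \<Gamma>) (K_step \<alpha> \<Gamma>) (K_lim \<alpha> \<Gamma>) \<iota>"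
    using direct_limit_K_lim[OF assms] by blast
  note 1 = direct_limit.direct_limit_shift[OF this]
  obtain \<kappa> where "direct_limit (\<lambda>n. K_fin (prefix n ?\<beta>) \<Gamma>) (K_step ?\<beta> \<Gamma>) (K_lim ?\<beta> \<Gamma>) \<kappa>"
    using direct_limit_K_lim[OF assms] by blast
  note 2 = direct_limit_T_nat[OF this, of "\<alpha> 0"]
  have "K_fin (prefix (Suc n) \<alpha>) \<Gamma> = T_nat (\<alpha> 0) (K_fin (prefix n ?\<beta>) \<Gamma>)" for n
    unfolding K_fin_def prefix_Suc_Cons by simp
  moreover have "K_step \<alpha> \<Gamma> (Suc n) =
      T_map (\<alpha> 0) (K_fin (prefix n ?\<beta>) \<Gamma>) (K_fin (prefix (Suc n) ?\<beta>) \<Gamma>) (K_step ?\<beta> \<Gamma> n)" for n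
    unfolding K_step_def prefix_Suc_Cons[where n = n and \<alpha> = \<alpha>] prefix_Suc_snoc[where n = n and \<alpha> = ?\<beta>] K_fin_def T_iter_append
    by simp
  ultimately show ?thesis
    using direct_limit_unique[OF 1] 2 by simp
qed

lemma K_lim_iso_T_iter:
  assumes "group \<Gamma>" "countable (carrier \<Gamma>)"
  shows "K_lim \<alpha> \<Gamma> \<cong> T_iter (prefix k \<alpha>) (K_lim (suffix k \<alpha>) \<Gamma>)"
proof (induction k)
  case 0
  have "K_lim \<alpha> \<Gamma> \<cong> K_lim \<alpha> \<Gamma>"
    by (auto simp: is_iso_def intro: iso_set_refl)
  then show ?case
    by simp
next
  case (Suc k)
  have "K_lim (suffix k \<alpha>) \<Gamma> \<cong> T_nat (\<alpha> k) (K_lim (suffix (Suc k) \<alpha>) \<Gamma>)"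
    using K_lim_rec[OF assms, of "suffix k \<alpha>"] by simp
  then have "T_iter (prefix k \<alpha>) (K_lim (suffix k \<alpha>) \<Gamma>) \<cong>
      T_iter (prefix k \<alpha>) (T_nat (\<alpha> k) (K_lim (suffix (Suc k) \<alpha>) \<Gamma>))"
    using assms by (intro T_iter_cong group_T_nat group_K_lim)
  also have "T_iter (prefix k \<alpha>) (T_nat (\<alpha> k) (K_lim (suffix (Suc k) \<alpha>) \<Gamma>)) =
      T_iter (prefix (Suc k) \<alpha>) (K_lim (suffix (Suc k) \<alpha>) \<Gamma>)"
    unfolding prefix_Suc_snoc T_iter_append by simp
  finally show ?case
    using Suc iso_trans by blast
qed

text \<open>\<open>K_fin\<close> begins by copying its argument, even though this is already a group
  on the natural numbers. One more congruence absorbs the copy.\<close>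

lemma K_lim_iso_K_fin:
  assumes "group \<Gamma>" "countable (carrier \<Gamma>)"
  shows "K_lim \<alpha> \<Gamma> \<cong> K_fin (prefix k \<alpha>) (K_lim (suffix k \<alpha>) \<Gamma>)"
proof -
  have "group (K_lim (suffix k \<alpha>) \<Gamma>)"
    by (intro group_K_lim assms)
  then have "T_iter (prefix k \<alpha>) (K_lim (suffix k \<alpha>) \<Gamma>) \<cong> K_fin (prefix k \<alpha>) (K_lim (suffix k \<alpha>) \<Gamma>)"
    unfolding K_fin_def by (intro T_iter_cong group_nat_copy nat_copy_iso) auto
  then show ?thesis
    using K_lim_iso_T_iter[OF assms] iso_trans by blast
qed

section \<open>Nonamenability\<close>

lemma amenableE:
  assumes "amenable G"
  obtains \<mu> :: "'a set \<Rightarrow> real" where "\<And>A. A \<subseteq> carrier G \<Longrightarrow> 0 \<le> \<mu> A" "\<mu> (carrier G) = 1"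
    "\<And>A B. A \<subseteq> carrier G \<Longrightarrow> B \<subseteq> carrier G \<Longrightarrow> A \<inter> B = {} \<Longrightarrow> \<mu> (A \<union> B) = \<mu> A + \<mu> B"
    "\<And>g A. g \<in> carrier G \<Longrightarrow> A \<subseteq> carrier G \<Longrightarrow> \<mu> (g <#\<^bsub>G\<^esub> A) = \<mu> A"
proof -
  from assms obtain \<mu> :: "'a set \<Rightarrow> real" where \<mu>: "\<forall>A\<subseteq>carrier G. 0 \<le> \<mu> A" "\<mu> (carrier G) = 1"
      "\<forall>A\<subseteq>carrier G. \<forall>B\<subseteq>carrier G. A \<inter> B = {} \<longrightarrow> \<mu> (A \<union> B) = \<mu> A + \<mu> B"
      "\<forall>g\<in>carrier G. \<forall>A\<subseteq>carrier G. \<mu> (g <#\<^bsub>G\<^esub> A) = \<mu> A"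
    unfolding amenable_def by (elim exE conjE) (rule that)
  then show thesis
    by (intro that[of \<mu>]) blast+
qed

text \<open>The mean is pushed forward: a set receives the mean of its preimage. Invariance holds
  because the preimage of a translate by the image of g is the translate by g of the
  preimage.\<close>

lemma amenable_hom_image:
  assumes "group G" "group H" "\<phi> \<in> hom G H" "\<phi> ` carrier G = carrier H" "amenable G"
  shows "amenable H"
proof -
  obtain \<mu> :: "'a set \<Rightarrow> real" where \<mu>: "\<And>A. A \<subseteq> carrier G \<Longrightarrow> 0 \<le> \<mu> A" "\<mu> (carrier G) = 1"
      "\<And>A B. A \<subseteq> carrier G \<Longrightarrow> B \<subseteq> carrier G \<Longrightarrow> A \<inter> B = {} \<Longrightarrow> \<mu> (A \<union> B) = \<mu> A + \<mu> B"
      "\<And>g A. g \<in> carrier G \<Longrightarrow> A \<subseteq> carrier G \<Longrightarrow> \<mu> (g <#\<^bsub>G\<^esub> A) = \<mu> A"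
    using amenableE[OF assms(5)] by blast
  define pre where "pre A = {x \<in> carrier G. \<phi> x \<in> A}" for A
  interpret G: group G by fact
  interpret H: group H by fact
  have \<phi>: "\<phi> x \<in> carrier H" if "x \<in> carrier G" for x
    using that assms(4) by blast
  have "pre (\<phi> g <#\<^bsub>H\<^esub> A) = g <#\<^bsub>G\<^esub> pre A" if g: "g \<in> carrier G" and A: "A \<subseteq> carrier H" for g A
  proof
    show "g <#\<^bsub>G\<^esub> pre A \<subseteq> pre (\<phi> g <#\<^bsub>H\<^esub> A)"
      using g by (auto simp: pre_def l_coset_def hom_mult[OF assms(3)])
    show "pre (\<phi> g <#\<^bsub>H\<^esub> A) \<subseteq> g <#\<^bsub>G\<^esub> pre A"
    proof
      fix x assume "x \<in> pre (\<phi> g <#\<^bsub>H\<^esub> A)"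
      then obtain a where x: "x \<in> carrier G" "a \<in> A" "\<phi> x = \<phi> g \<otimes>\<^bsub>H\<^esub> a"
        by (auto simp: pre_def l_coset_def)
      have inv: "\<phi> (inv\<^bsub>G\<^esub> g) \<otimes>\<^bsub>H\<^esub> \<phi> g = \<one>\<^bsub>H\<^esub>"
        using g hom_mult[OF assms(3), of "inv\<^bsub>G\<^esub> g" g] hom_one[OF assms(3,1,2)] by simp
      have "\<phi> (inv\<^bsub>G\<^esub> g \<otimes>\<^bsub>G\<^esub> x) = \<phi> (inv\<^bsub>G\<^esub> g) \<otimes>\<^bsub>H\<^esub> (\<phi> g \<otimes>\<^bsub>H\<^esub> a)"
        using g x by (simp add: hom_mult[OF assms(3)])
      also have "\<dots> = a"
        using g x A \<phi> inv by (subst H.m_assoc[symmetric]) auto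
      finally have "inv\<^bsub>G\<^esub> g \<otimes>\<^bsub>G\<^esub> x \<in> pre A"
        using g x by (simp add: pre_def)
      moreover have "x = g \<otimes>\<^bsub>G\<^esub> (inv\<^bsub>G\<^esub> g \<otimes>\<^bsub>G\<^esub> x)"
        using g x by (simp add: G.m_assoc[symmetric])
      ultimately show "x \<in> g <#\<^bsub>G\<^esub> pre A"
        by (auto simp: l_coset_def)
    qed
  qed
  moreover have "pre A \<subseteq> carrier G" "pre (A \<union> B) = pre A \<union> pre B" "A \<inter> B = {} \<Longrightarrow> pre A \<inter> pre B = {}"
    for A B
    by (auto simp: pre_def)
  moreover have "pre (carrier H) = carrier G"
    using \<phi> by (auto simp: pre_def)
  ultimately show ?thesis
    unfolding amenable_def using \<mu>
    by (intro exI[of _ "\<lambda>A. \<mu> (pre A)"]) (auto simp: assms(4)[symmetric])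
qed

lemma amenable_iso:
  assumes "group G" "group H" "G \<cong> H" "amenable G"
  shows "amenable H"
  using assms amenable_hom_image[of G H] by (auto simp: is_iso_def iso_def bij_betw_def)

text \<open>A presented group acts on the plane: the group \<open>H\<close> acts trivially and the generators of
  \<open>\<Lambda>\<^sub>1\<close> and \<open>\<Lambda>\<^sub>2\<close> act by two transvections that play ping-pong.\<close>

fun lam_act :: "nat \<Rightarrow> int \<Rightarrow> int \<times> int \<Rightarrow> int \<times> int" where
  "lam_act j k (x, y) =
    (if j = 1 then (x + 3 * k * y, y) else if j = 2 then (x, y + 3 * k * x) else (x, y))"

fun letter_act :: "'h letter \<Rightarrow> int \<times> int \<Rightarrow> int \<times> int" where
  "letter_act (Grp x) p = p"
| "letter_act (Lam j k) p = lam_act j k p"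

definition word_act :: "'h letter list \<Rightarrow> int \<times> int \<Rightarrow> int \<times> int" where
  "word_act w = foldr letter_act w"

lemma word_act_Nil [simp]: "word_act [] p = p"
  by (simp add: word_act_def)

lemma word_act_Cons [simp]: "word_act (a # w) p = letter_act a (word_act w p)"
  by (simp add: word_act_def)

lemma word_act_append [simp]: "word_act (v @ w) p = word_act v (word_act w p)"
  by (simp add: word_act_def)

text \<open>Letters of \<open>H\<close> act trivially, so the commutation relations are respected
  for every choice of \<open>D\<close>; the other relations say that k maps to an additive family of
  shears.\<close>

lemma word_eq_word_act: "word_eq H D v w \<Longrightarrow> word_act v = word_act w"
proof (induction rule: word_eq.induct)
  case (cong v w p q)
  then show ?case
    by (intro ext) simp
qed (auto simp: fun_eq_iff algebra_simps)

lemma word_act_nonzero: "p \<noteq> (0, 0) \<Longrightarrow> word_act w p \<noteq> (0, 0)"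
proof (induction w)
  case (Cons a w)
  then show ?case
    by (cases a; cases "word_act w p") auto
qed simp

text \<open>The orbit map of (1, 0) pulls the regions |x| \<le> |y| and |y| \<le> |x| back to two
  sets that cover the group. Nontrivial elements of one \<Lambda> move the first region off itself,
  away from the origin; those of the other do so with the second. Each set thus has mean at most
  1/3, and together they cannot have mean 1.\<close>

lemma not_amenable_presented:
  assumes "group H"
  shows "\<not> amenable (presented H D)"
proof
  define G where "G = presented H D"
  assume "amenable (presented H D)"
  then obtain \<mu> :: "'a letter list set set \<Rightarrow> real"
    where \<mu>: "\<And>A. A \<subseteq> carrier G \<Longrightarrow> 0 \<le> \<mu> A" "\<mu> (carrier G) = 1"
      "\<And>A B. A \<subseteq> carrier G \<Longrightarrow> B \<subseteq> carrier G \<Longrightarrow> A \<inter> B = {} \<Longrightarrow> \<mu> (A \<union> B) = \<mu> A + \<mu> B"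
      "\<And>g A. g \<in> carrier G \<Longrightarrow> A \<subseteq> carrier G \<Longrightarrow> \<mu> (g <#\<^bsub>G\<^esub> A) = \<mu> A"
    unfolding G_def using amenableE by blast
  interpret G: group G
    unfolding G_def using assms by (rule group_presented)
  have \<mu>_mono: "\<mu> A \<le> \<mu> B" if "A \<subseteq> B" "B \<subseteq> carrier G" for A B
  proof -
    have "\<mu> (A \<union> (B - A)) = \<mu> A + \<mu> (B - A)"
      using that by (intro \<mu>(3)) auto
    moreover have "A \<union> (B - A) = B" "0 \<le> \<mu> (B - A)"
      using that by (auto intro: \<mu>(1))
    ultimately show ?thesis
      by simp
  qed
  \<comment> \<open>Equivalent words act in the same way, so the chosen representative is
    immaterial. The base point is nonzero and stays so under all words, which keeps orbits away from
    the common point of the two regions' boundaries where shears have no effect.\<close>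
  define orb where "orb g = word_act (SOME w. w \<in> g) (1, 0)" for g :: "'a letter list set"
  have orb: "orb (word_class H D w) = word_act w (1, 0)" for w
  proof -
    have "(SOME v. v \<in> word_class H D w) \<in> word_class H D w"
      using self_in_word_class by (rule someI)
    then show ?thesis
      by (simp add: orb_def in_word_class_iff word_eq_word_act)
  qed
  define lam where "lam j k = word_class H D [Lam j k]" for j k
  have lam: "lam j k \<in> carrier G" if "1 \<le> j" for j k
    using that by (auto simp: lam_def G_def)
  have orb_lam: "orb (lam j k \<otimes>\<^bsub>G\<^esub> g) = lam_act j k (orb g)" if "g \<in> carrier G" for j k g
    using that by (auto simp: lam_def G_def orb)
  have third: "3 * \<mu> {g \<in> carrier G. P (orb g)} \<le> 1"
    if j: "1 \<le> j" and P: "\<And>k p. k \<noteq> 0 \<Longrightarrow> p \<noteq> (0, 0) \<Longrightarrow> P p \<Longrightarrow> \<not> P (lam_act j k p)" for j P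
  proof -
    let ?S = "{g \<in> carrier G. P (orb g)}"
    have S: "?S \<subseteq> carrier G"
      by blast
    have nonzero: "orb g \<noteq> (0, 0)" if "g \<in> carrier G" for g
      using that by (auto simp: G_def orb word_act_nonzero)
    have lam_lam: "lam j k \<otimes>\<^bsub>G\<^esub> lam j l = lam j (k + l)" for k l
      using j by (simp add: lam_def G_def word_class_eq_iff word_eq.lam_add)
    have disj: "(lam j k <#\<^bsub>G\<^esub> ?S) \<inter> (lam j l <#\<^bsub>G\<^esub> ?S) = {}" if kl: "k \<noteq> l" for k l
    proof (rule ccontr)
      assume "(lam j k <#\<^bsub>G\<^esub> ?S) \<inter> (lam j l <#\<^bsub>G\<^esub> ?S) \<noteq> {}"
      then obtain g h where gh: "g \<in> ?S" "h \<in> ?S" "lam j k \<otimes>\<^bsub>G\<^esub> g = lam j l \<otimes>\<^bsub>G\<^esub> h"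
        by (auto simp: l_coset_def)
      have "lam j (k - l) \<otimes>\<^bsub>G\<^esub> g = lam j (- l) \<otimes>\<^bsub>G\<^esub> (lam j k \<otimes>\<^bsub>G\<^esub> g)"
        using gh lam[OF j] lam_lam[of "- l" k] by (subst G.m_assoc[symmetric]) auto
      also have "\<dots> = lam j 0 \<otimes>\<^bsub>G\<^esub> h"
        unfolding gh(3) using gh lam[OF j] lam_lam[of "- l" l] by (subst G.m_assoc[symmetric]) auto
      finally have "lam_act j (k - l) (orb g) = lam_act j 0 (orb h)"
        using orb_lam[of g j "k - l"] orb_lam[of h j 0] gh by simp
      also have "\<dots> = orb h"
        by (cases "orb h") simp
      finally show False
        using P[of "k - l" "orb g"] kl gh nonzero by auto
    qed
    have coset: "lam j k <#\<^bsub>G\<^esub> ?S \<subseteq> carrier G" for k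
      using lam[OF j] by (auto simp: l_coset_def)
    \<comment> \<open>Three disjoint translates are used because two would only give the bound 1/2
      for each region, and 1/2 + 1/2 = 1 is no contradiction.\<close>
    have "\<mu> ((lam j 0 <#\<^bsub>G\<^esub> ?S) \<union> (lam j 1 <#\<^bsub>G\<^esub> ?S) \<union> (lam j 2 <#\<^bsub>G\<^esub> ?S)) =
        \<mu> (lam j 0 <#\<^bsub>G\<^esub> ?S) + \<mu> (lam j 1 <#\<^bsub>G\<^esub> ?S) + \<mu> (lam j 2 <#\<^bsub>G\<^esub> ?S)"
      using coset disj[of 0 1] disj[of 0 2] disj[of 1 2] by (simp add: \<mu>(3) Int_Un_distrib2)
    also have "\<dots> = 3 * \<mu> ?S"
      using lam[OF j] S by (simp add: \<mu>(4))
    finally show ?thesis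
      using \<mu>_mono[of "(lam j 0 <#\<^bsub>G\<^esub> ?S) \<union> (lam j 1 <#\<^bsub>G\<^esub> ?S) \<union> (lam j 2 <#\<^bsub>G\<^esub> ?S)" "carrier G"]
        coset \<mu>(2) by auto
  qed
  \<comment> \<open>The factor 3 in \<open>lam_act\<close> comes from here: |x + 3ky| \<ge> 3|y| -
    |x| \<ge> 2|y| > |y|. With factor 2 the inequality would not be strict, as x = -y, k = 1
    shows.\<close>
  have ping_pong: "\<bar>y\<bar> < \<bar>x + 3 * k * y\<bar>" if "k \<noteq> 0" "y \<noteq> 0" "\<bar>x\<bar> \<le> \<bar>y\<bar>" for x y k :: int
  proof -
    have "1 * \<bar>y\<bar> \<le> \<bar>k\<bar> * \<bar>y\<bar>"
      using that by (intro mult_right_mono) auto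
    then have "3 * \<bar>y\<bar> \<le> \<bar>3 * k * y\<bar>"
      by (simp add: abs_mult)
    then show ?thesis
      using that by linarith
  qed
  let ?A = "{g \<in> carrier G. (\<lambda>(x, y). \<bar>x\<bar> \<le> \<bar>y\<bar>) (orb g)}"
  let ?B = "{g \<in> carrier G. (\<lambda>(x, y). \<bar>y\<bar> \<le> \<bar>x\<bar>) (orb g)}"
  have "3 * \<mu> ?A \<le> 1"
  proof (rule third[where j = 1])
    fix k :: int and p :: "int \<times> int" assume *: "k \<noteq> 0" "p \<noteq> (0, 0)" "(\<lambda>(x, y). \<bar>x\<bar> \<le> \<bar>y\<bar>) p"
    then show "\<not> (\<lambda>(x, y). \<bar>x\<bar> \<le> \<bar>y\<bar>) (lam_act 1 k p)"
    proof -
      obtain x y where p: "p = (x, y)"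
        by (cases p)
      have "y \<noteq> 0" "\<bar>x\<bar> \<le> \<bar>y\<bar>"
        using *(2,3) by (auto simp: p)
      with *(1) have "\<bar>y\<bar> < \<bar>x + 3 * k * y\<bar>"
        by (rule ping_pong)
      then show ?thesis
        by (simp add: p)
    qed
  qed simp
  moreover have "3 * \<mu> ?B \<le> 1"
  proof (rule third[where j = 2])
    fix k :: int and p :: "int \<times> int" assume *: "k \<noteq> 0" "p \<noteq> (0, 0)" "(\<lambda>(x, y). \<bar>y\<bar> \<le> \<bar>x\<bar>) p"
    then show "\<not> (\<lambda>(x, y). \<bar>y\<bar> \<le> \<bar>x\<bar>) (lam_act 2 k p)"
    proof -
      obtain x y where p: "p = (x, y)"
        by (cases p)
      have "x \<noteq> 0" "\<bar>y\<bar> \<le> \<bar>x\<bar>"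
        using *(2,3) by (auto simp: p)
      with *(1) have "\<bar>x\<bar> < \<bar>y + 3 * k * x\<bar>"
        by (rule ping_pong)
      then show ?thesis
        by (simp add: p)
    qed
  qed simp
  moreover have "\<mu> (carrier G) = \<mu> (?A \<union> (?B - ?A))"
    by (rule arg_cong[where f = \<mu>]) auto
  moreover have "\<mu> (?A \<union> (?B - ?A)) = \<mu> ?A + \<mu> (?B - ?A)"
    by (rule \<mu>(3)) auto
  moreover have "\<mu> (?B - ?A) \<le> \<mu> ?B"
    by (rule \<mu>_mono) auto
  ultimately show False
    using \<mu>(2) by linarith
qed

lemma not_amenable_nat_copy:
  assumes "group G" "countable (carrier G)" "\<not> amenable G"
  shows "\<not> amenable (nat_copy G)"
proof
  have "nat_copy G \<cong> G"
    using nat_copy_iso[OF assms(2,1)] by (rule group.iso_sym[OF assms(1)])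
  moreover assume "amenable (nat_copy G)"
  ultimately show False
    using amenable_iso[OF group_nat_copy[OF assms(2,1)] assms(1)] assms(3) by blast
qed

lemma not_amenable_T_nat:
  assumes "group \<Gamma>"
  shows "\<not> amenable (T_nat b \<Gamma>)"
proof -
  have "\<not> amenable (T0 \<Gamma>)" "\<not> amenable (T1 \<Gamma>)"
    unfolding T0_def T1_def
    by (intro not_amenable_presented group_tilde group_semidirect assms)+
  then show ?thesis
    using assms
    by (simp add: T_nat_def not_amenable_nat_copy group_T0 group_T1 countable_T0 countable_T1)
qed

lemma not_amenable_K_lim:
  assumes "group \<Gamma>" "countable (carrier \<Gamma>)"
  shows "\<not> amenable (K_lim \<alpha> \<Gamma>)"
proof
  assume "amenable (K_lim \<alpha> \<Gamma>)"
  moreover have "group (K_lim (suffix 1 \<alpha>) \<Gamma>)"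
    by (intro group_K_lim assms)
  ultimately have "amenable (T_nat (\<alpha> 0) (K_lim (suffix 1 \<alpha>) \<Gamma>))"
    by (intro amenable_iso[OF _ _ K_lim_rec[OF assms]] group_K_lim group_T_nat assms)
  then show False
    using not_amenable_T_nat group_K_lim[OF assms] by blast
qed

section \<open>Bounded operators\<close>

lemma summable_on_finite_sum:
  fixes f :: "'i \<Rightarrow> 'k \<Rightarrow> complex"
  assumes "finite F" "\<And>i. f i summable_on A"
  shows "(\<lambda>k. \<Sum>i\<in>F. f i k) summable_on A"
  using assms(1) by (induction F) (simp_all add: summable_on_add assms(2))

lemma infsum_finite_sum:
  fixes f :: "'i \<Rightarrow> 'k \<Rightarrow> complex"
  assumes "finite F" "\<And>i. f i summable_on A"
  shows "(\<Sum>\<^sub>\<infinity>k\<in>A. \<Sum>i\<in>F. f i k) = (\<Sum>i\<in>F. \<Sum>\<^sub>\<infinity>k\<in>A. f i k)"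
  using assms(1)
  by (induction F) (simp_all add: infsum_add summable_on_finite_sum assms(2))

text \<open>The \<ell>2 norm is at most \<open>P\<close>. Bounding the finite partial sums makes
  square summability a consequence instead of a side condition.\<close>

definition l2_bound :: "('i \<Rightarrow> complex) \<Rightarrow> real \<Rightarrow> bool" where
  "l2_bound x P \<longleftrightarrow> (\<forall>F. finite F \<longrightarrow> L2_set (\<lambda>i. cmod (x i)) F \<le> P)"

lemma l2_bound_nonneg: "l2_bound x P \<Longrightarrow> 0 \<le> P"
  unfolding l2_bound_def by (metis L2_set_empty finite.emptyI)

lemma sum_square_le_of_l2_bound:
  assumes "l2_bound x P" "finite F"
  shows "(\<Sum>i\<in>F. (cmod (x i))\<^sup>2) \<le> P\<^sup>2"
proof -
  have "L2_set (\<lambda>i. cmod (x i)) F \<le> P"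
    using assms by (simp add: l2_bound_def)
  then have "(L2_set (\<lambda>i. cmod (x i)) F)\<^sup>2 \<le> P\<^sup>2"
    by (intro power_mono) (simp_all add: L2_set_nonneg)
  then show ?thesis
    by (simp add: L2_set_def sum_nonneg)
qed

lemma l2_bound_summable:
  assumes "l2_bound x P"
  shows "(\<lambda>i. (cmod (x i))\<^sup>2) summable_on A"
proof (rule nonneg_bdd_above_summable_on)
  show "bdd_above (sum (\<lambda>i. (cmod (x i))\<^sup>2) ` {F. F \<subseteq> A \<and> finite F})"
    by (rule bdd_aboveI[of _ "P\<^sup>2"]) (use sum_square_le_of_l2_bound[OF assms] in blast)
qed simp

lemma l2_bound_summable_mult:
  assumes "l2_bound x P" "l2_bound y Q"
  shows "(\<lambda>i. cmod (x i * y i)) summable_on A"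
proof (rule abs_summable_product)
  show "(\<lambda>i. cmod (x i * x i)) summable_on A" "(\<lambda>i. cmod (y i * y i)) summable_on A"
    using l2_bound_summable[OF assms(1), of A] l2_bound_summable[OF assms(2), of A]
    by (simp_all add: norm_mult power2_eq_square)
qed

lemma l2_bound_summable_prod:
  assumes "l2_bound x P" "l2_bound y Q"
  shows "(\<lambda>i. x i * y i) summable_on A"
  by (rule abs_summable_summable[OF l2_bound_summable_mult[OF assms]])

lemma l2_bound_Cauchy_Schwarz:
  assumes "l2_bound x P" "l2_bound y Q"
  shows "cmod (\<Sum>\<^sub>\<infinity>i\<in>A. x i * y i) \<le> P * Q"
proof -
  have abs: "(\<lambda>i. cmod (x i * y i)) summable_on A"
    using assms by (rule l2_bound_summable_mult)
  then have "cmod (\<Sum>\<^sub>\<infinity>i\<in>A. x i * y i) \<le> (\<Sum>\<^sub>\<infinity>i\<in>A. cmod (x i * y i))"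
    by (rule norm_infsum_bound)
  also have "\<dots> \<le> P * Q"
  proof (rule infsum_le_finite_sums[OF abs])
    fix F :: "'a set" assume F: "finite F"
    have "(\<Sum>i\<in>F. cmod (x i * y i)) \<le> L2_set (\<lambda>i. cmod (x i)) F * L2_set (\<lambda>i. cmod (y i)) F"
      using L2_set_mult_ineq[of "\<lambda>i. cmod (x i)" "\<lambda>i. cmod (y i)" F] by (simp add: norm_mult)
    also have "\<dots> \<le> P * Q"
      using assms F l2_bound_nonneg[OF assms(1)]
      by (intro mult_mono) (simp_all add: l2_bound_def L2_set_nonneg)
    finally show "(\<Sum>i\<in>F. cmod (x i * y i)) \<le> P * Q" .
  qed
  finally show ?thesis .
qed

text \<open>The converse of the Cauchy-Schwarz inequality: testing against the conjugate of
  \<open>z\<close> gives N * N \<le> P * N for the norm N of \<open>z\<close>.\<close>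

lemma L2_set_le_by_duality:
  fixes z :: "'i \<Rightarrow> complex"
  assumes "\<And>y. cmod (\<Sum>i\<in>G. z i * y i) \<le> P * L2_set (\<lambda>i. cmod (y i)) G" "0 \<le> P"
  shows "L2_set (\<lambda>i. cmod (z i)) G \<le> P"
proof -
  let ?N = "L2_set (\<lambda>i. cmod (z i)) G"
  have "(\<Sum>i\<in>G. z i * cnj (z i)) = of_real (\<Sum>i\<in>G. (cmod (z i))\<^sup>2)"
    by (simp add: complex_norm_square[symmetric] del: of_real_power)
  then have "cmod (\<Sum>i\<in>G. z i * cnj (z i)) = (\<Sum>i\<in>G. (cmod (z i))\<^sup>2)"
    by (simp only: norm_of_real) (simp add: sum_nonneg)
  also have "\<dots> = ?N * ?N"
    by (simp add: L2_set_def sum_nonneg)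
  finally have *: "?N * ?N \<le> P * ?N"
    using assms(1)[of "\<lambda>i. cnj (z i)"] by simp
  show ?thesis
  proof (cases "?N = 0")
    case False
    then have "?N > 0"
      using L2_set_nonneg[of "\<lambda>i. cmod (z i)" G] by (simp add: less_le)
    with * show ?thesis
      by (rule mult_right_le_imp_le)
  qed (use assms(2) in simp)
qed

text \<open>In contrast to \<open>norm_le\<close>, rows and columns are tested on independent finite
  sets and without conjugation. This makes the notion symmetric under transposition and lets row and
  column sums be estimated one at a time.\<close>

definition op_bound :: "'i op \<Rightarrow> real \<Rightarrow> bool" where
  "op_bound a B \<longleftrightarrow> 0 \<le> B \<and> (\<forall>F G x y. finite F \<and> finite G \<longrightarrow>
     cmod (\<Sum>i\<in>F. \<Sum>j\<in>G. x i * a i j * y j)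
       \<le> B * L2_set (\<lambda>i. cmod (x i)) F * L2_set (\<lambda>j. cmod (y j)) G)"

lemma op_boundD:
  assumes "op_bound a B" "finite F" "finite G"
  shows "cmod (\<Sum>i\<in>F. \<Sum>j\<in>G. x i * a i j * y j)
    \<le> B * L2_set (\<lambda>i. cmod (x i)) F * L2_set (\<lambda>j. cmod (y j)) G"
  using assms(1)[unfolded op_bound_def, THEN conjunct2, rule_format, OF conjI[OF assms(2,3)]] .

lemma op_bound_nonneg: "op_bound a B \<Longrightarrow> 0 \<le> B"
  by (simp add: op_bound_def)

lemma op_bound_transpose:
  assumes "op_bound a B"
  shows "op_bound (\<lambda>i j. a j i) B"
  unfolding op_bound_def
proof (intro conjI allI impI)
  fix F G :: "'a set" and x y :: "'a \<Rightarrow> complex" assume "finite F \<and> finite G"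
  then show "cmod (\<Sum>i\<in>F. \<Sum>j\<in>G. x i * a j i * y j)
      \<le> B * L2_set (\<lambda>i. cmod (x i)) F * L2_set (\<lambda>j. cmod (y j)) G"
    using op_boundD[OF assms, of G F y x] by (subst sum.swap) (simp add: mult_ac)
qed (use assms in \<open>simp add: op_bound_def\<close>)

lemma op_bound_row_sum:
  assumes "op_bound a B" "finite F"
  shows "l2_bound (\<lambda>j. \<Sum>i\<in>F. x i * a i j) (B * L2_set (\<lambda>i. cmod (x i)) F)"
  unfolding l2_bound_def
proof (intro allI impI L2_set_le_by_duality)
  fix G :: "'a set" and y assume "finite G"
  then show "cmod (\<Sum>j\<in>G. (\<Sum>i\<in>F. x i * a i j) * y j)
      \<le> B * L2_set (\<lambda>i. cmod (x i)) F * L2_set (\<lambda>j. cmod (y j)) G"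
    using op_boundD[OF assms, of G x y] sum.swap[of "\<lambda>i j. x i * a i j * y j" G F]
    by (simp add: sum_distrib_right)
qed (simp add: op_bound_nonneg[OF assms(1)] L2_set_nonneg)

lemma op_bound_col_sum:
  assumes "op_bound a B" "finite G"
  shows "l2_bound (\<lambda>i. \<Sum>j\<in>G. a i j * y j) (B * L2_set (\<lambda>j. cmod (y j)) G)"
  using op_bound_row_sum[OF op_bound_transpose[OF assms(1)] assms(2), of y] by (simp add: mult.commute)

lemma op_bound_row: "op_bound a B \<Longrightarrow> l2_bound (\<lambda>j. a i j) B"
  using op_bound_row_sum[of a B "{i}" "\<lambda>_. 1"] by simp

lemma op_bound_col: "op_bound a B \<Longrightarrow> l2_bound (\<lambda>i. a i j) B"
  using op_bound_col_sum[of a B "{j}" "\<lambda>_. 1"] by simp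

lemma summable_mult_bounded:
  assumes "op_bound a A" "op_bound b B"
  shows "(\<lambda>k. a i k * b k j) summable_on S"
  by (rule l2_bound_summable_prod[OF op_bound_row[OF assms(1)] op_bound_col[OF assms(2)]])

text \<open>Tested against finite vectors, the product becomes the pairing of a row combination of
  \<open>a\<close> with a column combination of \<open>b\<close>. Both are square-summable with the
  right bounds, so Cauchy-Schwarz applies.\<close>

lemma op_bound_mult:
  assumes "op_bound a A" "op_bound b B"
  shows "op_bound (a \<star> b) (A * B)"
  unfolding op_bound_def
proof (intro conjI allI impI)
  fix F G :: "'a set" and x y :: "'a \<Rightarrow> complex" assume FG: "finite F \<and> finite G"
  have summable: "(\<lambda>k. x i * (a i k * b k j) * y j) summable_on UNIV" for i j
    by (intro summable_on_cmult_left summable_on_cmult_right summable_mult_bounded[OF assms])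
  have "(\<Sum>i\<in>F. \<Sum>j\<in>G. x i * (a \<star> b) i j * y j)
      = (\<Sum>i\<in>F. \<Sum>j\<in>G. \<Sum>\<^sub>\<infinity>k. x i * (a i k * b k j) * y j)"
    by (simp add: op_mult_def infsum_cmult_left' infsum_cmult_right')
  also have "\<dots> = (\<Sum>i\<in>F. \<Sum>\<^sub>\<infinity>k. \<Sum>j\<in>G. x i * (a i k * b k j) * y j)"
    using summable FG by (simp add: infsum_finite_sum)
  also have "\<dots> = (\<Sum>\<^sub>\<infinity>k. \<Sum>i\<in>F. \<Sum>j\<in>G. x i * (a i k * b k j) * y j)"
    using summable FG by (simp add: infsum_finite_sum summable_on_finite_sum)
  also have "\<dots> = (\<Sum>\<^sub>\<infinity>k. (\<Sum>i\<in>F. x i * a i k) * (\<Sum>j\<in>G. b k j * y j))"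
    by (simp add: sum_product mult.assoc)
  finally have "cmod (\<Sum>i\<in>F. \<Sum>j\<in>G. x i * (a \<star> b) i j * y j)
      \<le> (A * L2_set (\<lambda>i. cmod (x i)) F) * (B * L2_set (\<lambda>j. cmod (y j)) G)"
    using FG l2_bound_Cauchy_Schwarz[OF op_bound_row_sum[OF assms(1)] op_bound_col_sum[OF assms(2)]]
    by simp
  then show "cmod (\<Sum>i\<in>F. \<Sum>j\<in>G. x i * (a \<star> b) i j * y j)
      \<le> A * B * L2_set (\<lambda>i. cmod (x i)) F * L2_set (\<lambda>j. cmod (y j)) G"
    by (simp add: mult_ac)
qed (use assms in \<open>simp add: op_bound_def\<close>)

lemma op_bound_row_infsum:
  assumes "op_bound b B" "l2_bound u P"
  shows "l2_bound (\<lambda>l. \<Sum>\<^sub>\<infinity>k. u k * b k l) (B * P)"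
  unfolding l2_bound_def
proof (intro allI impI L2_set_le_by_duality)
  fix G :: "'a set" and y assume G: "finite G"
  have summable: "(\<lambda>k. u k * b k l * y l) summable_on UNIV" for l
    by (intro summable_on_cmult_left
        l2_bound_summable_prod[OF assms(2) op_bound_col[OF assms(1)]])
  have "(\<Sum>l\<in>G. (\<Sum>\<^sub>\<infinity>k. u k * b k l) * y l) = (\<Sum>l\<in>G. \<Sum>\<^sub>\<infinity>k. u k * b k l * y l)"
    by (simp add: infsum_cmult_left')
  also have "\<dots> = (\<Sum>\<^sub>\<infinity>k. \<Sum>l\<in>G. u k * b k l * y l)"
    using summable G by (simp add: infsum_finite_sum)
  also have "\<dots> = (\<Sum>\<^sub>\<infinity>k. u k * (\<Sum>l\<in>G. b k l * y l))"
    by (simp add: sum_distrib_left mult.assoc)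
  finally show "cmod (\<Sum>l\<in>G. (\<Sum>\<^sub>\<infinity>k. u k * b k l) * y l) \<le> B * P * L2_set (\<lambda>i. cmod (y i)) G"
    using l2_bound_Cauchy_Schwarz[OF assms(2) op_bound_col_sum[OF assms(1) G, where y = y], where A = UNIV]
    by (simp add: mult_ac)
qed (simp add: op_bound_nonneg[OF assms(1)] l2_bound_nonneg[OF assms(2)])

lemma l2_bound_tail:
  assumes "l2_bound u P" "\<epsilon> > 0"
  shows "\<forall>\<^sub>F F in finite_subsets_at_top UNIV. l2_bound (\<lambda>k. if k \<in> F then 0 else u k) \<epsilon>"
proof -
  define s where "s = (\<Sum>\<^sub>\<infinity>k. (cmod (u k))\<^sup>2)"
  have "((\<lambda>k. (cmod (u k))\<^sup>2) has_sum s) UNIV"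
    unfolding s_def by (rule has_sum_infsum[OF l2_bound_summable[OF assms(1)]])
  then have "\<forall>\<^sub>F F in finite_subsets_at_top UNIV. (\<Sum>k\<in>F. (cmod (u k))\<^sup>2) > s - \<epsilon>\<^sup>2"
    unfolding has_sum_def by (rule order_tendstoD) (use assms(2) in simp)
  moreover have "\<forall>\<^sub>F F in finite_subsets_at_top (UNIV :: 'a set). finite F \<and> F \<subseteq> UNIV"
    by (rule eventually_finite_subsets_at_top_weakI) simp
  ultimately show ?thesis
  proof eventually_elim
    case (elim F)
    show ?case
      unfolding l2_bound_def
    proof (intro allI impI)
      fix G :: "'a set" assume G: "finite G"
      have "(\<Sum>k\<in>G. (cmod (if k \<in> F then 0 else u k))\<^sup>2) = (\<Sum>k\<in>G - F. (cmod (u k))\<^sup>2)"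
        using G by (intro sum.mono_neutral_cong_right) auto
      also have "\<dots> = (\<Sum>k\<in>F \<union> (G - F). (cmod (u k))\<^sup>2) - (\<Sum>k\<in>F. (cmod (u k))\<^sup>2)"
        using G elim by (subst sum.union_disjoint) auto
      also have "(\<Sum>k\<in>F \<union> (G - F). (cmod (u k))\<^sup>2) \<le> s"
        unfolding s_def using G elim
        by (intro finite_sum_le_infsum l2_bound_summable[OF assms(1)]) auto
      finally have "(\<Sum>k\<in>G. (cmod (if k \<in> F then 0 else u k))\<^sup>2) \<le> \<epsilon>\<^sup>2"
        using elim by linarith
      then show "L2_set (\<lambda>k. cmod (if k \<in> F then 0 else u k)) G \<le> \<epsilon>"
        unfolding L2_set_def using assms(2) by (intro real_le_lsqrt) auto
    qed
  qed
qed

text \<open>The double series need not converge absolutely. The two iterated sums agree because they do so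
  when \<open>u\<close> is finitely supported, and both sides are continuous in \<open>u\<close> for the \<open>\<ell>\<^sup>2\<close> norm.\<close>

lemma infsum_swap_bounded:
  assumes b: "op_bound b B" and u: "l2_bound u P" and w: "l2_bound w Q"
  shows "(\<Sum>\<^sub>\<infinity>l. (\<Sum>\<^sub>\<infinity>k. u k * b k l) * w l) = (\<Sum>\<^sub>\<infinity>k. u k * (\<Sum>\<^sub>\<infinity>l. b k l * w l))"
    (is "?L = ?R")
proof -
  have bw: "l2_bound (\<lambda>k. \<Sum>\<^sub>\<infinity>l. b k l * w l) (B * Q)"
    using op_bound_row_infsum[OF op_bound_transpose[OF b] w] by (simp add: mult.commute)
  define S where "S F = (\<Sum>k\<in>F. u k * (\<Sum>\<^sub>\<infinity>l. b k l * w l))" for F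
  have "((\<lambda>k. u k * (\<Sum>\<^sub>\<infinity>l. b k l * w l)) has_sum ?R) UNIV"
    by (intro has_sum_infsum l2_bound_summable_prod[OF u bw])
  then have "(S \<longlongrightarrow> ?R) (finite_subsets_at_top UNIV)"
    by (simp add: has_sum_def S_def[abs_def])
  moreover have "(S \<longlongrightarrow> ?L) (finite_subsets_at_top UNIV)"
  proof (rule tendstoI)
    fix e :: real assume e: "e > 0"
    \<comment> \<open>Chosen so that B * \<epsilon> * Q, the bound for the contribution of a tail of
      norm \<epsilon>, is below \<open>e\<close>; the summand 1 avoids division by zero when B * Q =
      0.\<close>
    define \<epsilon> where "\<epsilon> = e / (2 * (B * Q + 1))"
    have BQ: "0 \<le> B * Q"
      using op_bound_nonneg[OF b] l2_bound_nonneg[OF w] by simp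
    then have \<epsilon>: "\<epsilon> > 0"
      using e by (simp add: \<epsilon>_def)
    have less: "B * \<epsilon> * Q < e"
    proof -
      have "B * \<epsilon> * Q = e * ((B * Q) / (2 * (B * Q + 1)))"
        by (simp add: \<epsilon>_def)
      also have "\<dots> < e * 1"
        using BQ e by (intro mult_strict_left_mono) (simp_all add: divide_less_eq)
      finally show ?thesis
        by simp
    qed
    have "\<forall>\<^sub>F F in finite_subsets_at_top (UNIV :: 'a set). finite F \<and> F \<subseteq> UNIV"
      by (rule eventually_finite_subsets_at_top_weakI) simp
    with l2_bound_tail[OF u \<epsilon>] show "\<forall>\<^sub>F F in finite_subsets_at_top UNIV. dist (S F) ?L < e"
    proof eventually_elim
      case (elim F)
      \<comment> \<open>The tail of \<open>u\<close> outside \<open>F\<close>. For the finitely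
        supported part u - t the sums may be exchanged, which gives \<open>S F\<close>; the
        difference from the left-hand side is then the pairing of \<open>t\<close>, transformed by
        \<open>b\<close>, with \<open>w\<close>.\<close>
      define t where "t k = (if k \<in> F then 0 else u k)" for k
      have t: "l2_bound t \<epsilon>"
        using elim by (simp add: t_def[abs_def])
      have head: "(\<Sum>\<^sub>\<infinity>k. (u k - t k) * b k l) = (\<Sum>k\<in>F. u k * b k l)" for l
      proof -
        have "(\<Sum>\<^sub>\<infinity>k. (u k - t k) * b k l) = (\<Sum>\<^sub>\<infinity>k\<in>F. u k * b k l)"
          by (rule infsum_cong_neutral) (auto simp: t_def)
        then show ?thesis
          using elim by simp
      qed
      have diff: "(\<Sum>\<^sub>\<infinity>k. u k * b k l) = (\<Sum>k\<in>F. u k * b k l) + (\<Sum>\<^sub>\<infinity>k. t k * b k l)" for l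
      proof -
        have "(\<Sum>\<^sub>\<infinity>k. u k * b k l) - (\<Sum>\<^sub>\<infinity>k. t k * b k l) = (\<Sum>\<^sub>\<infinity>k. u k * b k l - t k * b k l)"
          using infsum_add[of "\<lambda>k. u k * b k l" UNIV "\<lambda>k. - (t k * b k l)"]
            l2_bound_summable_prod[OF u op_bound_col[OF b]]
            l2_bound_summable_prod[OF t op_bound_col[OF b]]
          by (simp add: infsum_uminus summable_on_uminus)
        then show ?thesis
          using head[of l] by (simp add: algebra_simps)
      qed
      have s1: "(\<lambda>l. (\<Sum>k\<in>F. u k * b k l) * w l) summable_on UNIV"
        using elim by (intro l2_bound_summable_prod[OF op_bound_row_sum[OF b] w]) auto
      have tb: "l2_bound (\<lambda>l. \<Sum>\<^sub>\<infinity>k. t k * b k l) (B * \<epsilon>)"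
        by (rule op_bound_row_infsum[OF b t])
      have s2: "(\<lambda>l. (\<Sum>\<^sub>\<infinity>k. t k * b k l) * w l) summable_on UNIV"
        by (intro l2_bound_summable_prod[OF tb w])
      have "S F = (\<Sum>k\<in>F. \<Sum>\<^sub>\<infinity>l. u k * b k l * w l)"
        by (simp add: S_def infsum_cmult_right' mult.assoc)
      also have "\<dots> = (\<Sum>\<^sub>\<infinity>l. \<Sum>k\<in>F. u k * b k l * w l)"
      proof (rule infsum_finite_sum[symmetric])
        show "finite F"
          using elim by simp
        show "(\<lambda>l. u k * b k l * w l) summable_on UNIV" for k
          unfolding mult.assoc
          by (intro summable_on_cmult_right
              l2_bound_summable_prod[OF op_bound_row[OF b] w])
      qed
      also have "\<dots> = (\<Sum>\<^sub>\<infinity>l. (\<Sum>k\<in>F. u k * b k l) * w l)"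
        by (simp add: sum_distrib_right)
      finally have "?L = S F + (\<Sum>\<^sub>\<infinity>l. (\<Sum>\<^sub>\<infinity>k. t k * b k l) * w l)"
        using infsum_add[OF s1 s2] by (simp add: diff distrib_right)
      then have "dist (S F) ?L \<le> B * \<epsilon> * Q"
        using l2_bound_Cauchy_Schwarz[OF tb w, of UNIV] by (simp add: dist_norm)
      then show ?case
        using less by simp
    qed
  qed
  ultimately show ?thesis
    by (intro tendsto_unique[of _ S]) auto
qed

lemma op_mult_assoc:
  assumes "op_bound a A" "op_bound b B" "op_bound c C"
  shows "(a \<star> b) \<star> c = a \<star> (b \<star> c)"
  using infsum_swap_bounded[OF assms(2) op_bound_row[OF assms(1)] op_bound_col[OF assms(3)]]
  by (simp add: op_mult_def fun_eq_iff)

section \<open>The algebra of bounded operators\<close>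

lemma bounded_opsI:
  assumes "\<And>i j. i \<notin> X \<or> j \<notin> X \<Longrightarrow> a i j = 0" "op_bound a B"
  shows "a \<in> bounded_ops X"
proof -
  have "norm_le X a B"
    unfolding norm_le_def
  proof (intro allI impI)
    fix F x y assume "finite F \<and> F \<subseteq> X"
    then show "cmod (\<Sum>i\<in>F. \<Sum>j\<in>F. cnj (x i) * a i j * y j)
        \<le> B * L2_set (\<lambda>i. cmod (x i)) F * L2_set (\<lambda>j. cmod (y j)) F"
      using op_boundD[OF assms(2), of F F "\<lambda>i. cnj (x i)" y] by simp
  qed
  then show ?thesis
    using assms(1) unfolding bounded_ops_def by blast
qed

lemma bounded_ops_supp: "a \<in> bounded_ops X \<Longrightarrow> i \<notin> X \<or> j \<notin> X \<Longrightarrow> a i j = 0"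
  by (auto simp: bounded_ops_def)

text \<open>Two finite test sets are merged into one subset of \<open>X\<close>, on which the
  vectors are extended by zero. The maximum with 0 is taken because \<open>norm_le\<close> admits
  negative constants when \<open>X\<close> is empty.\<close>

lemma bounded_opsE:
  assumes "a \<in> bounded_ops X"
  obtains B where "op_bound a B"
proof -
  obtain B0 where B0: "norm_le X a B0"
    using assms by (auto simp: bounded_ops_def)
  define B where "B = max B0 0"
  have "op_bound a B"
    unfolding op_bound_def
  proof (intro conjI allI impI)
    fix F G :: "'a set" and x y :: "'a \<Rightarrow> complex" assume FG: "finite F \<and> finite G"
    define H where "H = (F \<union> G) \<inter> X"
    have H: "finite H" "H \<subseteq> X"
      using FG by (auto simp: H_def)
    define x' where "x' i = (if i \<in> F then cnj (x i) else 0)" for i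
    define y' where "y' j = (if j \<in> G then y j else 0)" for j
    have y': "(\<Sum>j\<in>G. x i * a i j * y j) = (\<Sum>j\<in>H. x i * a i j * y' j)" for i
      using FG H bounded_ops_supp[OF assms] by (intro sum.mono_neutral_cong) (auto simp: H_def y'_def)
    have "(\<Sum>i\<in>F. \<Sum>j\<in>G. x i * a i j * y j) = (\<Sum>i\<in>F. \<Sum>j\<in>H. x i * a i j * y' j)"
      by (simp add: y')
    also have "\<dots> = (\<Sum>i\<in>H. \<Sum>j\<in>H. cnj (x' i) * a i j * y' j)"
      using FG H bounded_ops_supp[OF assms] by (intro sum.mono_neutral_cong) (auto simp: H_def x'_def)
    finally have "cmod (\<Sum>i\<in>F. \<Sum>j\<in>G. x i * a i j * y j)
        \<le> B0 * L2_set (\<lambda>i. cmod (x' i)) H * L2_set (\<lambda>j. cmod (y' j)) H"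
      using B0 H unfolding norm_le_def by simp
    also have "\<dots> \<le> B * L2_set (\<lambda>i. cmod (x' i)) H * L2_set (\<lambda>j. cmod (y' j)) H"
      by (intro mult_right_mono) (auto simp: B_def L2_set_nonneg)
    also have "\<dots> \<le> B * L2_set (\<lambda>i. cmod (x i)) F * L2_set (\<lambda>j. cmod (y j)) G"
    proof -
      have "(\<Sum>i\<in>H. (cmod (x' i))\<^sup>2) = (\<Sum>i\<in>H \<inter> F. (cmod (x i))\<^sup>2)"
        using H by (intro sum.mono_neutral_cong_right) (auto simp: x'_def)
      also have "\<dots> \<le> (\<Sum>i\<in>F. (cmod (x i))\<^sup>2)"
        using FG by (intro sum_mono2) auto
      finally have 1: "L2_set (\<lambda>i. cmod (x' i)) H \<le> L2_set (\<lambda>i. cmod (x i)) F"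
        by (simp add: L2_set_def)
      have "(\<Sum>i\<in>H. (cmod (y' i))\<^sup>2) = (\<Sum>i\<in>H \<inter> G. (cmod (y i))\<^sup>2)"
        using H by (intro sum.mono_neutral_cong_right) (auto simp: y'_def)
      also have "\<dots> \<le> (\<Sum>i\<in>G. (cmod (y i))\<^sup>2)"
        using FG by (intro sum_mono2) auto
      finally have 2: "L2_set (\<lambda>i. cmod (y' i)) H \<le> L2_set (\<lambda>i. cmod (y i)) G"
        by (simp add: L2_set_def)
      show ?thesis
        using 1 2 by (intro mult_mono mult_left_mono) (auto simp: B_def L2_set_nonneg)
    qed
    finally show "cmod (\<Sum>i\<in>F. \<Sum>j\<in>G. x i * a i j * y j)
        \<le> B * L2_set (\<lambda>i. cmod (x i)) F * L2_set (\<lambda>j. cmod (y j)) G" .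
  qed (simp add: B_def)
  then show thesis
    by (rule that)
qed

lemma op_bound_add:
  assumes "op_bound a A" "op_bound b B"
  shows "op_bound (a + b) (A + B)"
  unfolding op_bound_def
proof (intro conjI allI impI)
  fix F G :: "'a set" and x y :: "'a \<Rightarrow> complex" assume FG: "finite F \<and> finite G"
  have "(\<Sum>i\<in>F. \<Sum>j\<in>G. x i * (a + b) i j * y j) =
      (\<Sum>i\<in>F. \<Sum>j\<in>G. x i * a i j * y j) + (\<Sum>i\<in>F. \<Sum>j\<in>G. x i * b i j * y j)"
    by (simp add: sum.distrib distrib_left distrib_right)
  then show "cmod (\<Sum>i\<in>F. \<Sum>j\<in>G. x i * (a + b) i j * y j)
      \<le> (A + B) * L2_set (\<lambda>i. cmod (x i)) F * L2_set (\<lambda>j. cmod (y j)) G"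
    using op_boundD[OF assms(1), of F G x y] op_boundD[OF assms(2), of F G x y] FG
    by (intro order.trans[OF eq_refl[OF arg_cong[where f = cmod]] norm_triangle_le])
      (auto simp: distrib_right)
qed (use assms in \<open>simp add: op_bound_def\<close>)

lemma op_bound_scale:
  assumes "op_bound a A"
  shows "op_bound (op_scale c a) (cmod c * A)"
  unfolding op_bound_def
proof (intro conjI allI impI)
  fix F G :: "'a set" and x y :: "'a \<Rightarrow> complex" assume FG: "finite F \<and> finite G"
  have "(\<Sum>i\<in>F. \<Sum>j\<in>G. x i * op_scale c a i j * y j) = c * (\<Sum>i\<in>F. \<Sum>j\<in>G. x i * a i j * y j)"
    by (simp add: op_scale_def sum_distrib_left mult_ac)
  then show "cmod (\<Sum>i\<in>F. \<Sum>j\<in>G. x i * op_scale c a i j * y j)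
      \<le> cmod c * A * L2_set (\<lambda>i. cmod (x i)) F * L2_set (\<lambda>j. cmod (y j)) G"
    using op_boundD[OF assms, of F G x y] FG mult_left_mono[of _ _ "cmod c"]
    by (simp add: norm_mult mult.assoc)
qed (use assms in \<open>simp add: op_bound_def\<close>)

lemma op_bound_adj:
  assumes "op_bound a A"
  shows "op_bound (op_adj a) A"
  unfolding op_bound_def
proof (intro conjI allI impI)
  fix F G :: "'a set" and x y :: "'a \<Rightarrow> complex" assume FG: "finite F \<and> finite G"
  have "(\<Sum>i\<in>F. \<Sum>j\<in>G. x i * op_adj a i j * y j) =
      cnj (\<Sum>j\<in>G. \<Sum>i\<in>F. cnj (y j) * a j i * cnj (x i))"
    by (subst sum.swap) (simp add: op_adj_def mult_ac)
  then have "cmod (\<Sum>i\<in>F. \<Sum>j\<in>G. x i * op_adj a i j * y j) =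
      cmod (\<Sum>j\<in>G. \<Sum>i\<in>F. cnj (y j) * a j i * cnj (x i))"
    by (simp only: complex_mod_cnj)
  then show "cmod (\<Sum>i\<in>F. \<Sum>j\<in>G. x i * op_adj a i j * y j)
      \<le> A * L2_set (\<lambda>i. cmod (x i)) F * L2_set (\<lambda>j. cmod (y j)) G"
    using op_boundD[OF assms, of G F "\<lambda>j. cnj (y j)" "\<lambda>i. cnj (x i)"] FG
    by (simp add: mult_ac)
qed (use assms in \<open>simp add: op_bound_def\<close>)

text \<open>Such a matrix sends distinct basis vectors to distinct basis vectors or to zero. The
  form becomes a sum over the graph \<open>R\<close>, both of whose projections are injective, and
  Cauchy-Schwarz on \<open>R\<close> gives norm at most 1. Identities and translations are
  instances.\<close>

lemma op_bound_partial_injection: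
  assumes "\<And>i j j'. P i j \<Longrightarrow> P i j' \<Longrightarrow> j = j'" "\<And>i i' j. P i j \<Longrightarrow> P i' j \<Longrightarrow> i = i'"
  shows "op_bound (\<lambda>i j. if P i j then 1 else 0) 1"
  unfolding op_bound_def
proof (intro conjI allI impI)
  fix F G :: "'a set" and x y :: "'a \<Rightarrow> complex" assume FG: "finite F \<and> finite G"
  define R where "R = {p \<in> F \<times> G. P (fst p) (snd p)}"
  have R: "finite R"
    using FG by (simp add: R_def)
  have inj: "inj_on fst R" "inj_on snd R"
    using assms by (auto simp: inj_on_def R_def)
  have "(\<Sum>i\<in>F. \<Sum>j\<in>G. x i * (if P i j then 1 else 0) * y j) =
      (\<Sum>p\<in>F \<times> G. x (fst p) * (if P (fst p) (snd p) then 1 else 0) * y (snd p))"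
    by (simp add: sum.cartesian_product case_prod_unfold)
  also have "\<dots> = (\<Sum>p\<in>R. x (fst p) * y (snd p))"
    unfolding R_def using FG by (intro sum.mono_neutral_cong_right) auto
  finally have "cmod (\<Sum>i\<in>F. \<Sum>j\<in>G. x i * (if P i j then 1 else 0) * y j)
      \<le> (\<Sum>p\<in>R. cmod (x (fst p)) * cmod (y (snd p)))"
    using norm_sum[of "\<lambda>p. x (fst p) * y (snd p)" R] by (simp add: norm_mult)
  also have "\<dots> \<le> L2_set (\<lambda>p. cmod (x (fst p))) R * L2_set (\<lambda>p. cmod (y (snd p))) R"
    using L2_set_mult_ineq[of "\<lambda>p. cmod (x (fst p))" "\<lambda>p. cmod (y (snd p))" R] by simp
  also have "\<dots> \<le> L2_set (\<lambda>i. cmod (x i)) F * L2_set (\<lambda>j. cmod (y j)) G"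
  proof -
    have "(\<Sum>p\<in>R. (cmod (x (fst p)))\<^sup>2) = (\<Sum>i\<in>fst ` R. (cmod (x i))\<^sup>2)"
      using inj by (simp add: sum.reindex)
    also have "\<dots> \<le> (\<Sum>i\<in>F. (cmod (x i))\<^sup>2)"
      using FG by (intro sum_mono2) (auto simp: R_def)
    finally have 1: "L2_set (\<lambda>p. cmod (x (fst p))) R \<le> L2_set (\<lambda>i. cmod (x i)) F"
      by (simp add: L2_set_def)
    have "(\<Sum>p\<in>R. (cmod (y (snd p)))\<^sup>2) = (\<Sum>i\<in>snd ` R. (cmod (y i))\<^sup>2)"
      using inj by (simp add: sum.reindex)
    also have "\<dots> \<le> (\<Sum>i\<in>G. (cmod (y i))\<^sup>2)"
      using FG by (intro sum_mono2) (auto simp: R_def)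
    finally have 2: "L2_set (\<lambda>p. cmod (y (snd p))) R \<le> L2_set (\<lambda>i. cmod (y i)) G"
      by (simp add: L2_set_def)
    show ?thesis
      using 1 2 by (intro mult_mono) (auto simp: L2_set_nonneg)
  qed
  finally show "cmod (\<Sum>i\<in>F. \<Sum>j\<in>G. x i * (if P i j then 1 else 0) * y j)
      \<le> 1 * L2_set (\<lambda>i. cmod (x i)) F * L2_set (\<lambda>j. cmod (y j)) G"
    by simp
qed simp

lemma bounded_ops_one: "op_one X \<in> bounded_ops X"
proof -
  have "op_bound (op_one X) 1"
    unfolding op_one_def by (rule op_bound_partial_injection) auto
  then show ?thesis
    by (rule bounded_opsI[rotated]) (auto simp: op_one_def)
qed

lemma bounded_ops_add:
  assumes "a \<in> bounded_ops X" "b \<in> bounded_ops X"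
  shows "a + b \<in> bounded_ops X"
proof -
  obtain A B where "op_bound a A" "op_bound b B"
    using assms by (meson bounded_opsE)
  then have "op_bound (a + b) (A + B)"
    by (rule op_bound_add)
  then show ?thesis
    using bounded_ops_supp[OF assms(1)] bounded_ops_supp[OF assms(2)]
    by (intro bounded_opsI) auto
qed

lemma bounded_ops_scale:
  assumes "a \<in> bounded_ops X"
  shows "op_scale c a \<in> bounded_ops X"
proof -
  obtain A where "op_bound a A"
    using assms by (rule bounded_opsE)
  then have "op_bound (op_scale c a) (cmod c * A)"
    by (rule op_bound_scale)
  then show ?thesis
    using bounded_ops_supp[OF assms] by (intro bounded_opsI) (auto simp: op_scale_def)
qed

lemma bounded_ops_adj:
  assumes "a \<in> bounded_ops X"
  shows "op_adj a \<in> bounded_ops X"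
proof -
  obtain A where "op_bound a A"
    using assms by (rule bounded_opsE)
  then have "op_bound (op_adj a) A"
    by (rule op_bound_adj)
  then show ?thesis
    using bounded_ops_supp[OF assms] by (intro bounded_opsI) (auto simp: op_adj_def)
qed

lemma bounded_ops_mult:
  assumes "a \<in> bounded_ops X" "b \<in> bounded_ops X"
  shows "a \<star> b \<in> bounded_ops X"
proof -
  obtain A B where "op_bound a A" "op_bound b B"
    using assms by (meson bounded_opsE)
  then have "op_bound (a \<star> b) (A * B)"
    by (rule op_bound_mult)
  then show ?thesis
    using bounded_ops_supp[OF assms(1)] bounded_ops_supp[OF assms(2)]
    by (intro bounded_opsI) (auto simp: op_mult_def)
qed

lemma bounded_ops_assoc:
  assumes "a \<in> bounded_ops X" "b \<in> bounded_ops X" "c \<in> bounded_ops X"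
  shows "(a \<star> b) \<star> c = a \<star> (b \<star> c)"
  using assms by (meson bounded_opsE op_mult_assoc)

lemma bounded_ops_distrib:
  assumes "a \<in> bounded_ops X" "b \<in> bounded_ops X" "c \<in> bounded_ops X"
  shows "(a + b) \<star> c = a \<star> c + b \<star> c" "c \<star> (a + b) = c \<star> a + c \<star> b"
proof -
  obtain A B C where "op_bound a A" "op_bound b B" "op_bound c C"
    using assms by (meson bounded_opsE)
  then show "(a + b) \<star> c = a \<star> c + b \<star> c" "c \<star> (a + b) = c \<star> a + c \<star> b"
    by (auto simp: op_mult_def fun_eq_iff distrib_left distrib_right
        infsum_add[OF summable_mult_bounded summable_mult_bounded])
qed

lemma op_scale_mult: "op_scale c a \<star> b = op_scale c (a \<star> b)" "a \<star> op_scale c b = op_scale c (a \<star> b)"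
  by (simp_all add: op_scale_def op_mult_def fun_eq_iff mult.assoc mult.left_commute infsum_cmult_right')

lemma op_adj_mult: "op_adj (a \<star> b) = op_adj b \<star> op_adj a"
  by (simp add: op_adj_def op_mult_def fun_eq_iff mult.commute flip: infsum_cnj)

lemma op_adj_adj [simp]: "op_adj (op_adj a) = a"
  by (simp add: op_adj_def)

lemma op_one_mult:
  assumes "a \<in> bounded_ops X"
  shows "op_one X \<star> a = a" "a \<star> op_one X = a"
proof -
  have "(\<Sum>\<^sub>\<infinity>k. op_one X i k * a k j) = (\<Sum>\<^sub>\<infinity>k\<in>{i}. a k j)" for i j
    using bounded_ops_supp[OF assms] by (intro infsum_cong_neutral) (auto simp: op_one_def)
  then show "op_one X \<star> a = a"
    by (simp add: op_mult_def)
  have "(\<Sum>\<^sub>\<infinity>k. a i k * op_one X k j) = (\<Sum>\<^sub>\<infinity>k\<in>{j}. a i k)" for i j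
    using bounded_ops_supp[OF assms] by (intro infsum_cong_neutral) (auto simp: op_one_def)
  then show "a \<star> op_one X = a"
    by (simp add: op_mult_def)
qed

lemma op_adj_one: "op_adj (op_one X) = op_one X"
  by (auto simp: op_adj_def op_one_def fun_eq_iff)

lemma op_diff_eq: "a - b = a + op_scale (- 1) b" for a b :: "'i op"
  by (simp add: fun_eq_iff op_scale_def)

section \<open>Commutants and von Neumann algebras\<close>

lemma commutant_subset: "commutant X S \<subseteq> bounded_ops X"
  by (auto simp: commutant_def)

lemma commutant_antimono: "S \<subseteq> T \<Longrightarrow> commutant X T \<subseteq> commutant X S"
  by (auto simp: commutant_def)

lemma subset_bicommutant: "S \<subseteq> bounded_ops X \<Longrightarrow> S \<subseteq> commutant X (commutant X S)"
  by (auto simp: commutant_def)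

lemma commutant_bicommutant:
  assumes "S \<subseteq> bounded_ops X"
  shows "commutant X (commutant X (commutant X S)) = commutant X S"
  using commutant_antimono[OF subset_bicommutant[OF assms]] subset_bicommutant[OF commutant_subset]
  by blast

lemma commutant_one: "S \<subseteq> bounded_ops X \<Longrightarrow> op_one X \<in> commutant X S"
  by (auto simp: commutant_def bounded_ops_one op_one_mult subset_eq)

lemma commutant_scale: "a \<in> commutant X S \<Longrightarrow> op_scale c a \<in> commutant X S"
  by (simp add: commutant_def bounded_ops_scale op_scale_mult)

lemma commutant_add:
  assumes "S \<subseteq> bounded_ops X" "a \<in> commutant X S" "b \<in> commutant X S"
  shows "a + b \<in> commutant X S"
  using assms by (auto simp: commutant_def bounded_ops_add bounded_ops_distrib[of a X b] subset_eq)

lemma commutant_mult: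
  assumes "S \<subseteq> bounded_ops X" "a \<in> commutant X S" "b \<in> commutant X S"
  shows "a \<star> b \<in> commutant X S"
proof -
  have ab: "a \<in> bounded_ops X" "b \<in> bounded_ops X"
    using assms(2,3) by (auto simp: commutant_def)
  have "(a \<star> b) \<star> s = s \<star> (a \<star> b)" if s: "s \<in> S" for s
  proof -
    have s': "s \<in> bounded_ops X"
      using s assms(1) by blast
    have comm: "a \<star> s = s \<star> a" "b \<star> s = s \<star> b"
      using s assms(2,3) by (auto simp: commutant_def)
    have "(a \<star> b) \<star> s = a \<star> (b \<star> s)"
      using ab s' by (rule bounded_ops_assoc)
    also have "\<dots> = (a \<star> s) \<star> b"
      unfolding comm(2) using ab s' by (simp add: bounded_ops_assoc)
    also have "\<dots> = s \<star> (a \<star> b)"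
      unfolding comm(1) using ab s' by (simp add: bounded_ops_assoc)
    finally show ?thesis .
  qed
  then show ?thesis
    using ab by (simp add: commutant_def bounded_ops_mult)
qed

lemma commutant_adj:
  assumes "op_adj ` S \<subseteq> S" "a \<in> commutant X S"
  shows "op_adj a \<in> commutant X S"
proof -
  have "op_adj a \<star> s = s \<star> op_adj a" if "s \<in> S" for s
  proof -
    have "a \<star> op_adj s = op_adj s \<star> a"
      using that assms by (auto simp: commutant_def)
    then have "op_adj (a \<star> op_adj s) = op_adj (op_adj s \<star> a)"
      by simp
    then show ?thesis
      by (simp add: op_adj_mult)
  qed
  then show ?thesis
    using assms(2) by (simp add: commutant_def bounded_ops_adj)
qed

text \<open>The algebraic closure properties are read off from \<open>M\<close> being a commutant,
  namely that of its own commutant.\<close>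

locale vna =
  fixes X :: "'i set" and M :: "'i op set"
  assumes vna: "von_neumann_algebra X M"
begin

lemma bounded: "M \<subseteq> bounded_ops X"
  using vna by (simp add: von_neumann_algebra_def)

lemma bicommutant: "commutant X (commutant X M) = M"
  using vna by (simp add: von_neumann_algebra_def)

lemma adj_closed: "a \<in> M \<Longrightarrow> op_adj a \<in> M"
  using vna by (auto simp: von_neumann_algebra_def)

lemma one_closed: "op_one X \<in> M"
  using commutant_one[OF commutant_subset] bicommutant by metis

lemma scale_closed: "a \<in> M \<Longrightarrow> op_scale c a \<in> M"
  using commutant_scale bicommutant by metis

lemma add_closed: "a \<in> M \<Longrightarrow> b \<in> M \<Longrightarrow> a + b \<in> M"
  using commutant_add[OF commutant_subset] bicommutant by metis

lemma diff_closed: "a \<in> M \<Longrightarrow> b \<in> M \<Longrightarrow> a - b \<in> M"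
  by (simp add: op_diff_eq add_closed scale_closed)

lemma zero_closed: "0 \<in> M"
  using diff_closed[OF one_closed one_closed] by simp

lemma mult_closed: "a \<in> M \<Longrightarrow> b \<in> M \<Longrightarrow> a \<star> b \<in> M"
  using commutant_mult[OF commutant_subset] bicommutant by metis

lemma vN_gen_self: "vN_gen X M = M"
proof -
  have "M \<union> op_adj ` M = M"
    using adj_closed by auto
  then show ?thesis
    by (simp add: vN_gen_def bicommutant)
qed

end

lemma von_neumann_algebra_vN_gen:
  assumes "S \<subseteq> bounded_ops X"
  shows "von_neumann_algebra X (vN_gen X S)"
proof -
  let ?T = "S \<union> op_adj ` S"
  have T: "?T \<subseteq> bounded_ops X"
    using assms bounded_ops_adj by blast
  have "op_adj ` ?T \<subseteq> ?T"
    by auto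
  then have "op_adj ` commutant X ?T \<subseteq> commutant X ?T"
    using commutant_adj by blast
  then have "op_adj ` vN_gen X S \<subseteq> vN_gen X S"
    unfolding vN_gen_def using commutant_adj by blast
  then show ?thesis
    unfolding von_neumann_algebra_def
    using commutant_bicommutant[OF T] by (auto simp: vN_gen_def commutant_subset[THEN subsetD])
qed

section \<open>Transport along bijections\<close>

text \<open>For a bijection \<open>g\<close> from \<open>Y\<close> to \<open>X\<close> this is
  conjugation by the induced unitary between the \<ell>2 spaces. The map goes from the new indices
  to the old ones so that transport is mere composition; the zero values keep the matrix supported
  in \<open>Y\<close>.\<close>

definition tr_op :: "'j set \<Rightarrow> ('j \<Rightarrow> 'i) \<Rightarrow> 'i op \<Rightarrow> 'j op" where
  "tr_op Y g a = (\<lambda>i j. if i \<in> Y \<and> j \<in> Y then a (g i) (g j) else 0)"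

lemma tr_op_add: "tr_op Y g (a + b) = tr_op Y g a + tr_op Y g b"
  by (auto simp: tr_op_def fun_eq_iff)

lemma tr_op_diff: "tr_op Y g (a - b) = tr_op Y g a - tr_op Y g b"
  by (auto simp: tr_op_def fun_eq_iff)

lemma tr_op_zero: "tr_op Y g 0 = 0"
  by (auto simp: tr_op_def fun_eq_iff)

lemma tr_op_scale: "tr_op Y g (op_scale c a) = op_scale c (tr_op Y g a)"
  by (auto simp: tr_op_def op_scale_def fun_eq_iff)

lemma tr_op_adj: "tr_op Y g (op_adj a) = op_adj (tr_op Y g a)"
  by (auto simp: tr_op_def op_adj_def fun_eq_iff)

locale transport =
  fixes X :: "'i set" and Y :: "'j set" and g :: "'j \<Rightarrow> 'i"
  assumes bij: "bij_betw g Y X"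
begin

abbreviation "tr \<equiv> tr_op Y g"

lemma g_in: "i \<in> Y \<Longrightarrow> g i \<in> X"
  using bij by (auto simp: bij_betw_def)

lemma transport_inv: "transport Y X (inv_into Y g)"
  by unfold_locales (rule bij_betw_inv_into[OF bij])

lemma tr_inverse:
  assumes "a \<in> bounded_ops X"
  shows "tr_op X (inv_into Y g) (tr a) = a"
  using bounded_ops_supp[OF assms] bij
  by (auto simp: tr_op_def fun_eq_iff bij_betw_inv_into_right inv_into_into bij_betw_imp_surj_on)

lemma tr_inverse':
  assumes "b \<in> bounded_ops Y"
  shows "tr (tr_op X (inv_into Y g) b) = b"
  using bounded_ops_supp[OF assms] bij g_in
  by (auto simp: tr_op_def fun_eq_iff bij_betw_inv_into_left)

lemma tr_inj: "a \<in> bounded_ops X \<Longrightarrow> b \<in> bounded_ops X \<Longrightarrow> tr a = tr b \<longleftrightarrow> a = b"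
  using tr_inverse by metis

lemma tr_one: "tr (op_one X) = op_one Y"
  using bij g_in by (auto simp: tr_op_def op_one_def fun_eq_iff bij_betw_def inj_on_eq_iff)

lemma tr_mult:
  assumes "a \<in> bounded_ops X"
  shows "tr (a \<star> b) = tr a \<star> tr b"
proof (intro ext)
  fix i j
  show "tr (a \<star> b) i j = (tr a \<star> tr b) i j"
  proof (cases "i \<in> Y \<and> j \<in> Y")
    case True
    have "(tr a \<star> tr b) i j = (\<Sum>\<^sub>\<infinity>k\<in>Y. a (g i) (g k) * b (g k) (g j))"
      unfolding op_mult_def using True by (intro infsum_cong_neutral) (auto simp: tr_op_def)
    also have "\<dots> = (\<Sum>\<^sub>\<infinity>k\<in>X. a (g i) k * b k (g j))"
      by (rule infsum_reindex_bij_betw[OF bij])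
    also have "\<dots> = (a \<star> b) (g i) (g j)"
      unfolding op_mult_def using bounded_ops_supp[OF assms]
      by (intro infsum_cong_neutral) auto
    finally show ?thesis
      using True by (simp add: tr_op_def)
  next
    case False
    then have "(\<Sum>\<^sub>\<infinity>k. tr a i k * tr b k j) = 0"
      by (intro infsum_0) (auto simp: tr_op_def)
    moreover have "tr (a \<star> b) i j = 0"
      using False by (auto simp: tr_op_def)
    ultimately show ?thesis
      by (simp add: op_mult_def)
  qed
qed

lemma norm_le_tr:
  assumes "norm_le X a B"
  shows "norm_le Y (tr a) B"
  unfolding norm_le_def
proof (intro allI impI)
  fix F x y assume F: "finite F \<and> F \<subseteq> Y"
  define h where "h = inv_into Y g"
  have h: "h (g i) = i" if "i \<in> F" for i
    using that F bij by (auto simp: h_def bij_betw_inv_into_left)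
  have inj: "inj_on g F"
    using F bij by (auto simp: bij_betw_def intro: inj_on_subset)
  have "(\<Sum>i\<in>F. \<Sum>j\<in>F. cnj (x i) * tr a i j * y j) =
      (\<Sum>i\<in>g ` F. \<Sum>j\<in>g ` F. cnj (x (h i)) * a i j * y (h j))"
    using F by (auto simp: sum.reindex[OF inj] h tr_op_def subset_eq intro!: sum.cong)
  also have "cmod \<dots> \<le> B * L2_set (\<lambda>i. cmod (x (h i))) (g ` F) * L2_set (\<lambda>j. cmod (y (h j))) (g ` F)"
    using assms[unfolded norm_le_def, rule_format, of "g ` F" "\<lambda>i. x (h i)" "\<lambda>j. y (h j)"] F g_in
    by auto
  also have "\<dots> = B * L2_set (\<lambda>i. cmod (x i)) F * L2_set (\<lambda>j. cmod (y j)) F"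
    by (simp add: L2_set_def sum.reindex[OF inj] h)
  finally show "cmod (\<Sum>i\<in>F. \<Sum>j\<in>F. cnj (x i) * tr a i j * y j)
      \<le> B * L2_set (\<lambda>i. cmod (x i)) F * L2_set (\<lambda>j. cmod (y j)) F" .
qed

lemma norm_le_tr_iff: "a \<in> bounded_ops X \<Longrightarrow> norm_le Y (tr a) B \<longleftrightarrow> norm_le X a B"
  using norm_le_tr transport.norm_le_tr[OF transport_inv] tr_inverse by metis

lemma tr_bounded: "a \<in> bounded_ops X \<Longrightarrow> tr a \<in> bounded_ops Y"
  using norm_le_tr unfolding bounded_ops_def by (auto simp: tr_op_def)

lemma commutant_tr:
  assumes "S \<subseteq> bounded_ops X"
  shows "commutant Y (tr ` S) = tr ` commutant X S"
proof
  interpret inv: transport Y X "inv_into Y g"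
    by (rule transport_inv)
  show "tr ` commutant X S \<subseteq> commutant Y (tr ` S)"
    using assms by (auto simp: commutant_def tr_bounded subset_eq simp flip: tr_mult)
  show "commutant Y (tr ` S) \<subseteq> tr ` commutant X S"
  proof
    fix b assume b: "b \<in> commutant Y (tr ` S)"
    then have b': "b \<in> bounded_ops Y"
      by (simp add: commutant_def)
    have "inv.tr b \<star> s = s \<star> inv.tr b" if s: "s \<in> S" for s
    proof -
      have s': "s \<in> bounded_ops X"
        using s assms by blast
      have "inv.tr b \<star> s = inv.tr (b \<star> tr s)"
        using tr_inverse[OF s'] b' by (simp add: inv.tr_mult)
      also have "b \<star> tr s = tr s \<star> b"
        using b s by (simp add: commutant_def)
      also have "inv.tr (tr s \<star> b) = s \<star> inv.tr b"
        using tr_inverse[OF s'] s' by (simp add: inv.tr_mult tr_bounded)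
      finally show ?thesis .
    qed
    then have "inv.tr b \<in> commutant X S"
      using b' by (simp add: commutant_def inv.tr_bounded)
    then show "b \<in> tr ` commutant X S"
      using tr_inverse'[OF b'] by (metis imageI)
  qed
qed

lemma vN_gen_tr:
  assumes "S \<subseteq> bounded_ops X"
  shows "vN_gen Y (tr ` S) = tr ` vN_gen X S"
proof -
  have "tr ` S \<union> op_adj ` tr ` S = tr ` (S \<union> op_adj ` S)"
    by (simp add: image_Un image_image tr_op_adj)
  moreover have "S \<union> op_adj ` S \<subseteq> bounded_ops X"
    using assms bounded_ops_adj by blast
  ultimately show ?thesis
    by (simp add: vN_gen_def commutant_tr commutant_subset)
qed

lemma von_neumann_algebra_tr:
  assumes "von_neumann_algebra X M"
  shows "von_neumann_algebra Y (tr ` M)"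
proof -
  interpret vna X M
    by unfold_locales (rule assms)
  show ?thesis
    using bounded adj_closed
    by (auto simp: von_neumann_algebra_def commutant_tr commutant_subset bicommutant tr_bounded
        simp flip: tr_op_adj)
qed

end

section \<open>Invariance of the values of sentences\<close>

text \<open>The traces are compared on the algebra only: a trace obtained by choice has no
  controlled values elsewhere.\<close>

locale tvna_transport = transport X Y g
  for X :: "'i set" and Y :: "'j set" and g :: "'j \<Rightarrow> 'i" +
  fixes M :: "'i tvna" and N :: "'j tvna"
  assumes base_M: "base M = X" and base_N: "base N = Y"
    and vna_M: "von_neumann_algebra X (ops M)"
    and ops_N: "ops N = tr ` ops M"
    and trc_N: "a \<in> ops M \<Longrightarrow> trc N (tr a) = trc M a"
begin

sublocale M: vna X "ops M"
  by unfold_locales (rule vna_M)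

lemma bounded_M: "a \<in> ops M \<Longrightarrow> a \<in> bounded_ops X"
  using M.bounded by blast

lemma eval_trm_closed: "(\<And>x. e x \<in> ops M) \<Longrightarrow> eval_trm M e t \<in> ops M"
  by (induction t) (simp_all add: M.zero_closed M.one_closed M.add_closed M.mult_closed
      M.adj_closed M.scale_closed base_M)

lemma eval_trm_tr:
  "(\<And>x. e x \<in> ops M) \<Longrightarrow> eval_trm N (\<lambda>x. tr (e x)) t = tr (eval_trm M e t)"
  by (induction t) (simp_all add: tr_op_zero tr_one tr_op_add tr_mult tr_op_adj tr_op_scale
      base_M base_N eval_trm_closed bounded_M)

lemma norm2_tr: "a \<in> ops M \<Longrightarrow> norm2 N (tr a) = norm2 M a"
  by (simp add: norm2_def trc_N M.mult_closed M.adj_closed bounded_M bounded_ops_adj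
      flip: tr_op_adj tr_mult)

lemma quant_dom_tr: "quant_dom N q = tr ` quant_dom M q"
proof (cases q)
  case Quant_Ball
  then show ?thesis
    using bounded_M by (auto simp: unit_ball_def ops_N base_M base_N norm_le_tr_iff)
next
  case Quant_Unitary
  have "unitary_op Y (tr a) \<longleftrightarrow> unitary_op X a" if "a \<in> ops M" for a
    using that bounded_M[OF that]
    by (simp add: unitary_op_def bounded_ops_adj bounded_ops_mult bounded_ops_one tr_inj
        flip: tr_op_adj tr_mult tr_one)
  then show ?thesis
    using Quant_Unitary by (auto simp: unitaries_def ops_N base_M base_N)
qed

lemma quant_dom_closed: "a \<in> quant_dom M q \<Longrightarrow> a \<in> ops M"
  by (cases q) (auto simp: unit_ball_def unitaries_def)

text \<open>Transport matches the quantifier domains of the two algebras, so each supremum or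
  infimum is taken over the same set of reals on both sides, bounded or not.\<close>

lemma eval_fm_tr: "(\<And>x. e x \<in> ops M) \<Longrightarrow> eval_fm N (\<lambda>x. tr (e x)) \<phi> = eval_fm M e \<phi>"
proof (induction \<phi> arbitrary: e)
  case (Dist s t)
  then show ?case
    by (simp add: eval_trm_tr eval_trm_closed norm2_tr M.diff_closed flip: tr_op_diff)
next
  case (Conn f \<phi>s)
  then have "map (eval_fm N (\<lambda>x. tr (e x))) \<phi>s = map (eval_fm M e) \<phi>s"
    by simp
  then show ?case
    by (simp only: eval_fm.simps)
next
  case (QSup q x \<phi>)
  have "eval_fm N ((\<lambda>x. tr (e x))(x := tr a)) \<phi> = eval_fm M (e(x := a)) \<phi>" if "a \<in> quant_dom M q" for a
  proof -
    have "(\<lambda>x. tr (e x))(x := tr a) = (\<lambda>y. tr ((e(x := a)) y))"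
      by auto
    moreover have "eval_fm N (\<lambda>y. tr ((e(x := a)) y)) \<phi> = eval_fm M (e(x := a)) \<phi>"
      using QSup.prems quant_dom_closed[OF that] by (intro QSup.IH) auto
    ultimately show ?thesis
      by (simp only:)
  qed
  then show ?case
    unfolding eval_fm.simps quant_dom_tr image_image by (rule SUP_cong[OF HOL.refl])
next
  case (QInf q x \<phi>)
  have "eval_fm N ((\<lambda>x. tr (e x))(x := tr a)) \<phi> = eval_fm M (e(x := a)) \<phi>" if "a \<in> quant_dom M q" for a
  proof -
    have "(\<lambda>x. tr (e x))(x := tr a) = (\<lambda>y. tr ((e(x := a)) y))"
      by auto
    moreover have "eval_fm N (\<lambda>y. tr ((e(x := a)) y)) \<phi> = eval_fm M (e(x := a)) \<phi>"
      using QInf.prems quant_dom_closed[OF that] by (intro QInf.IH) auto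
    ultimately show ?thesis
      by (simp only:)
  qed
  then show ?case
    unfolding eval_fm.simps quant_dom_tr image_image by (rule INF_cong[OF HOL.refl])
qed (simp_all add: eval_trm_tr eval_trm_closed trc_N)

lemma value_in_tr: "value_in N \<theta> = value_in M \<theta>"
  using eval_fm_tr[of "\<lambda>_. 0"] by (simp add: value_in_def tr_op_zero M.zero_closed)

end

section \<open>Group von Neumann algebras\<close>

lemma bounded_translation:
  assumes "group G" "g \<in> carrier G"
  shows "translation G g \<in> bounded_ops (carrier G)"
proof (rule bounded_opsI)
  interpret group G by fact
  show "op_bound (translation G g) 1"
    unfolding translation_def using assms(2) by (intro op_bound_partial_injection) auto
qed (auto simp: translation_def)

lemma adj_translation:
  assumes "group G" "g \<in> carrier G"
  shows "op_adj (translation G g) = translation G (inv\<^bsub>G\<^esub> g)"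
proof -
  interpret group G by fact
  have "x = g \<otimes>\<^bsub>G\<^esub> y \<longleftrightarrow> y = inv\<^bsub>G\<^esub> g \<otimes>\<^bsub>G\<^esub> x" if "x \<in> carrier G" "y \<in> carrier G" for x y
    using that assms(2) by (metis inv_closed inv_inv inv_solve_left)
  then show ?thesis
    by (auto simp: op_adj_def translation_def fun_eq_iff)
qed

lemma translations_bounded:
  "group G \<Longrightarrow> translation G ` carrier G \<subseteq> bounded_ops (carrier G)"
  by (auto simp: bounded_translation)

lemma vna_group:
  assumes "group G"
  shows "von_neumann_algebra (carrier G) (subgroup_ops G (carrier G))"
  unfolding subgroup_ops_def
  by (intro von_neumann_algebra_vN_gen translations_bounded assms)

text \<open>Right translations lie in the commutant, so the matrix of an element of the group algebra is
  constant along right translates.\<close>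

lemma subgroup_ops_right_invariant:
  assumes "group G" and a: "a \<in> subgroup_ops G (carrier G)"
    and carr: "g \<in> carrier G" "i \<in> carrier G" "j \<in> carrier G"
  shows "a (i \<otimes>\<^bsub>G\<^esub> g) (j \<otimes>\<^bsub>G\<^esub> g) = a i j"
proof -
  interpret group G by fact
  let ?C = "carrier G"
  \<comment> \<open>The matrix of right translation, sending the basis vector at y to the one at y
    times the inverse of g. Multiplying by it on either side shifts one index by g, so commutation
    with \<open>a\<close> compares the two entries in question.\<close>
  define \<rho> :: "'a op" where "\<rho> = (\<lambda>x y. if x \<in> ?C \<and> y \<in> ?C \<and> y = x \<otimes>\<^bsub>G\<^esub> g then 1 else 0)"
  have "op_bound \<rho> 1"
    unfolding \<rho>_def using carr by (intro op_bound_partial_injection) auto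
  then have \<rho>: "\<rho> \<in> bounded_ops ?C"
    by (rule bounded_opsI[rotated]) (auto simp: \<rho>_def)
  have mult_\<rho>: "(b \<star> \<rho>) x (y \<otimes>\<^bsub>G\<^esub> g) = b x y" if "y \<in> ?C" for b :: "'a op" and x y
  proof -
    have "(b \<star> \<rho>) x (y \<otimes>\<^bsub>G\<^esub> g) = (\<Sum>\<^sub>\<infinity>k\<in>{y}. b x k)"
      unfolding op_mult_def using that carr by (intro infsum_cong_neutral) (auto simp: \<rho>_def)
    then show ?thesis
      by simp
  qed
  have \<rho>_mult: "(\<rho> \<star> b) x y = b (x \<otimes>\<^bsub>G\<^esub> g) y" if "x \<in> ?C" for b :: "'a op" and x y
  proof -
    have "(\<rho> \<star> b) x y = (\<Sum>\<^sub>\<infinity>k\<in>{x \<otimes>\<^bsub>G\<^esub> g}. b k y)"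
      unfolding op_mult_def using that carr by (intro infsum_cong_neutral) (auto simp: \<rho>_def)
    then show ?thesis
      by simp
  qed
  have "\<rho> \<star> translation G h = translation G h \<star> \<rho>" if h: "h \<in> ?C" for h
  proof (intro ext)
    fix x y
    show "(\<rho> \<star> translation G h) x y = (translation G h \<star> \<rho>) x y"
    proof (cases "x \<in> ?C \<and> y \<in> ?C")
      case True
      define z where "z = y \<otimes>\<^bsub>G\<^esub> inv\<^bsub>G\<^esub> g"
      have z: "z \<in> ?C" "y = z \<otimes>\<^bsub>G\<^esub> g"
        using True carr by (auto simp: z_def m_assoc)
      have "translation G h (x \<otimes>\<^bsub>G\<^esub> g) (z \<otimes>\<^bsub>G\<^esub> g) = translation G h x z"
        using True z carr h by (auto simp: translation_def simp flip: m_assoc)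
      then show ?thesis
        using True z by (simp add: \<rho>_mult mult_\<rho>)
    next
      case False
      have "\<rho> \<star> translation G h \<in> bounded_ops ?C" "translation G h \<star> \<rho> \<in> bounded_ops ?C"
        using \<rho> h assms(1) by (simp_all add: bounded_ops_mult bounded_translation)
      then show ?thesis
        using False by (metis bounded_ops_supp)
    qed
  qed
  then have "\<rho> \<in> commutant ?C (translation G ` ?C \<union> op_adj ` translation G ` ?C)"
    using \<rho> assms(1) by (auto simp: commutant_def adj_translation)
  then have "a \<star> \<rho> = \<rho> \<star> a"
    using a by (simp add: subgroup_ops_def vN_gen_def commutant_def)
  then have "(a \<star> \<rho>) i (j \<otimes>\<^bsub>G\<^esub> g) = (\<rho> \<star> a) i (j \<otimes>\<^bsub>G\<^esub> g)"
    by simp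
  then show ?thesis
    using carr by (simp add: \<rho>_mult mult_\<rho>)
qed

lemma subgroup_ops_bounded:
  "a \<in> subgroup_ops G S \<Longrightarrow> a \<in> bounded_ops (carrier G)"
  by (auto simp: subgroup_ops_def vN_gen_def commutant_def)

text \<open>By right invariance the entry of the identity row at k is that of the identity column at
  the inverse of k. Inverting the summation index therefore exchanges the two factors.\<close>

lemma group_trace_commute:
  assumes "group G" and a: "a \<in> subgroup_ops G (carrier G)" and b: "b \<in> subgroup_ops G (carrier G)"
  shows "(a \<star> b) \<one>\<^bsub>G\<^esub> \<one>\<^bsub>G\<^esub> = (b \<star> a) \<one>\<^bsub>G\<^esub> \<one>\<^bsub>G\<^esub>"
proof -
  interpret group G by fact
  let ?C = "carrier G"
  have restrict: "(c \<star> d) \<one>\<^bsub>G\<^esub> \<one>\<^bsub>G\<^esub> = (\<Sum>\<^sub>\<infinity>k\<in>?C. c \<one>\<^bsub>G\<^esub> k * d k \<one>\<^bsub>G\<^esub>)"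
    if "c \<in> bounded_ops ?C" for c d
    unfolding op_mult_def using bounded_ops_supp[OF that] by (intro infsum_cong_neutral) auto
  have inv: "c \<one>\<^bsub>G\<^esub> k = c (inv\<^bsub>G\<^esub> k) \<one>\<^bsub>G\<^esub>" "c k \<one>\<^bsub>G\<^esub> = c \<one>\<^bsub>G\<^esub> (inv\<^bsub>G\<^esub> k)"
    if "c \<in> subgroup_ops G ?C" "k \<in> ?C" for c k
    using subgroup_ops_right_invariant[OF assms(1) that(1), of "inv\<^bsub>G\<^esub> k" "\<one>\<^bsub>G\<^esub>" k]
      subgroup_ops_right_invariant[OF assms(1) that(1), of "inv\<^bsub>G\<^esub> k" k "\<one>\<^bsub>G\<^esub>"] that(2)
    by simp_all
  have "(a \<star> b) \<one>\<^bsub>G\<^esub> \<one>\<^bsub>G\<^esub> = (\<Sum>\<^sub>\<infinity>k\<in>?C. a \<one>\<^bsub>G\<^esub> k * b k \<one>\<^bsub>G\<^esub>)"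
    by (rule restrict[OF subgroup_ops_bounded[OF a]])
  also have "\<dots> = (\<Sum>\<^sub>\<infinity>k\<in>?C. b \<one>\<^bsub>G\<^esub> (inv\<^bsub>G\<^esub> k) * a (inv\<^bsub>G\<^esub> k) \<one>\<^bsub>G\<^esub>)"
    using inv[OF a] inv[OF b] by (intro infsum_cong) (simp add: mult.commute)
  also have "\<dots> = (\<Sum>\<^sub>\<infinity>k\<in>?C. b \<one>\<^bsub>G\<^esub> k * a k \<one>\<^bsub>G\<^esub>)"
  proof (rule infsum_reindex_bij_betw)
    show "bij_betw (\<lambda>k. inv\<^bsub>G\<^esub> k) ?C ?C"
      by (rule bij_betwI[where g = "\<lambda>k. inv\<^bsub>G\<^esub> k"]) auto
  qed
  also have "\<dots> = (b \<star> a) \<one>\<^bsub>G\<^esub> \<one>\<^bsub>G\<^esub>"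
    by (rule restrict[OF subgroup_ops_bounded[OF b], symmetric])
  finally show ?thesis .
qed

text \<open>Right invariance makes the column at the identity determine the whole matrix: the basis
  vector at the identity is separating.\<close>

lemma group_trace_separating:
  assumes "group G" and a: "a \<in> subgroup_ops G (carrier G)" and 0: "\<And>k. a k \<one>\<^bsub>G\<^esub> = 0"
  shows "a = 0"
proof -
  interpret group G by fact
  have "a i j = 0" for i j
  proof (cases "i \<in> carrier G \<and> j \<in> carrier G")
    case True
    then have "a i j = a (i \<otimes>\<^bsub>G\<^esub> inv\<^bsub>G\<^esub> j) (j \<otimes>\<^bsub>G\<^esub> inv\<^bsub>G\<^esub> j)"
      by (intro subgroup_ops_right_invariant[OF assms(1) a, symmetric]) auto
    then show ?thesis
      using True 0 by simp
  next
    case False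
    then show ?thesis
      using bounded_ops_supp[OF subgroup_ops_bounded[OF a]] by blast
  qed
  then show ?thesis
    by (simp add: fun_eq_iff)
qed

text \<open>Linearity, positivity and normality hold for every vector state. What remains specific
  to the algebra is the trace identity and, for faithfulness, that the vector is separating.\<close>

lemma tracial_vna_vector_state:
  assumes "von_neumann_algebra X A" "p \<in> X"
    and comm: "\<And>a b. a \<in> A \<Longrightarrow> b \<in> A \<Longrightarrow> (a \<star> b) p p = (b \<star> a) p p"
    and sep: "\<And>a. a \<in> A \<Longrightarrow> (\<And>k. a k p = 0) \<Longrightarrow> a = 0"
  shows "tracial_vna \<lparr>base = X, ops = A, trc = (\<lambda>a. a p p)\<rparr>"
proof -
  interpret vna X A
    by unfold_locales (rule assms(1))
  have square: "(op_adj a \<star> a) p p = of_real (\<Sum>\<^sub>\<infinity>k. (cmod (a k p))\<^sup>2)"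
    and summable: "(\<lambda>k. (cmod (a k p))\<^sup>2) summable_on UNIV" if a: "a \<in> A" for a
  proof -
    obtain B where "op_bound a B"
      using a bounded bounded_opsE by blast
    then show "(\<lambda>k. (cmod (a k p))\<^sup>2) summable_on UNIV"
      by (intro l2_bound_summable op_bound_col)
    then have "((\<lambda>k. complex_of_real ((cmod (a k p))\<^sup>2)) has_sum
        of_real (\<Sum>\<^sub>\<infinity>k. (cmod (a k p))\<^sup>2)) UNIV"
      by (intro has_sum_of_real has_sum_infsum)
    moreover have "complex_of_real ((cmod (a k p))\<^sup>2) = cnj (a k p) * a k p" for k
      by (simp only: complex_norm_square mult.commute)
    ultimately show "(op_adj a \<star> a) p p = of_real (\<Sum>\<^sub>\<infinity>k. (cmod (a k p))\<^sup>2)"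
      by (simp add: op_mult_def op_adj_def infsumI)
  qed
  have nonneg: "0 \<le> (\<Sum>\<^sub>\<infinity>k. (cmod (a k p))\<^sup>2)" for a :: "'a op"
    by (intro infsum_nonneg) simp
  have faithful: "a = 0" if a: "a \<in> A" and "(op_adj a \<star> a) p p = 0" for a
  proof (rule sep[OF a])
    fix k
    have "(\<Sum>\<^sub>\<infinity>k. (cmod (a k p))\<^sup>2) = 0"
      using that square[OF a] by simp
    then have "(cmod (a k p))\<^sup>2 = 0"
      by (intro nonneg_infsum_le_0D[OF _ summable[OF a]]) auto
    then show "a k p = 0"
      by simp
  qed
  have "ultraweakly_continuous A (\<lambda>a. a p p)"
  proof -
    \<comment> \<open>Both sequences of vectors in the definition of ultraweak continuity are taken
      to be the basis vector at p, followed by zeros.\<close>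
    define \<xi> :: "nat \<Rightarrow> 'a \<Rightarrow> complex" where "\<xi> n i = (if n = 0 \<and> i = p then 1 else 0)" for n i
    have "(\<lambda>(n, i). (cmod (\<xi> n i))\<^sup>2) summable_on {(0, p)}"
      by simp
    then have "(\<lambda>(n, i). (cmod (\<xi> n i))\<^sup>2) summable_on UNIV"
      by (rule summable_on_cong_neutral[THEN iffD1, rotated -1]) (auto simp: \<xi>_def split: if_splits)
    moreover have "a p p = (\<Sum>\<^sub>\<infinity>n. \<Sum>\<^sub>\<infinity>i. cnj (\<xi> n i) * (\<Sum>\<^sub>\<infinity>j. a i j * \<xi> n j))" for a :: "'a op"
    proof -
      have "(\<Sum>\<^sub>\<infinity>j. a i j * \<xi> 0 j) = (\<Sum>\<^sub>\<infinity>j\<in>{p}. a i j)" for i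
        by (rule infsum_cong_neutral) (auto simp: \<xi>_def)
      then have "(\<Sum>\<^sub>\<infinity>i. cnj (\<xi> 0 i) * (\<Sum>\<^sub>\<infinity>j. a i j * \<xi> 0 j)) = (\<Sum>\<^sub>\<infinity>i\<in>{p}. a i p)"
        by (intro infsum_cong_neutral) (auto simp: \<xi>_def)
      moreover have "(\<Sum>\<^sub>\<infinity>n. \<Sum>\<^sub>\<infinity>i. cnj (\<xi> n i) * (\<Sum>\<^sub>\<infinity>j. a i j * \<xi> n j)) =
          (\<Sum>\<^sub>\<infinity>n\<in>{0}. \<Sum>\<^sub>\<infinity>i. cnj (\<xi> n i) * (\<Sum>\<^sub>\<infinity>j. a i j * \<xi> n j))"
        by (rule infsum_cong_neutral) (auto simp: \<xi>_def)
      ultimately show ?thesis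
        by simp
    qed
    ultimately show ?thesis
      unfolding ultraweakly_continuous_def by blast
  qed
  then show ?thesis
    using assms nonneg faithful
    by (simp add: tracial_vna_def op_one_def op_scale_def square)
qed

text \<open>Stated for an arbitrary index set since it serves three times: for the group itself, for
  lists of length 1, and for pairs with a constant second entry.\<close>

lemma tracial_vna_tr_group:
  assumes "group G" "bij_betw g Y (carrier G)" "p \<in> Y" "g p = \<one>\<^bsub>G\<^esub>"
  shows "tracial_vna \<lparr>base = Y, ops = tr_op Y g ` subgroup_ops G (carrier G), trc = (\<lambda>a. a p p)\<rparr>"
proof -
  interpret transport "carrier G" Y g
    by unfold_locales (rule assms(2))
  have eval: "tr a i p = a (g i) \<one>\<^bsub>G\<^esub>" if "i \<in> Y" for a :: "'a op" and i
    using that assms by (simp add: tr_op_def)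
  show ?thesis
  proof (rule tracial_vna_vector_state)
    show "von_neumann_algebra Y (tr ` subgroup_ops G (carrier G))"
      by (intro von_neumann_algebra_tr vna_group assms)
    show "p \<in> Y"
      by fact
  next
    fix a b assume "a \<in> tr ` subgroup_ops G (carrier G)" "b \<in> tr ` subgroup_ops G (carrier G)"
    then show "(a \<star> b) p p = (b \<star> a) p p"
      using group_trace_commute[OF assms(1)] assms(3,4)
      by (auto simp: eval subgroup_ops_bounded simp flip: tr_mult)
  next
    fix b assume "b \<in> tr ` subgroup_ops G (carrier G)" and 0: "\<And>k. b k p = 0"
    then obtain a where a: "a \<in> subgroup_ops G (carrier G)" "b = tr a"
      by blast
    have "a = 0"
    proof (rule group_trace_separating[OF assms(1) a(1)])
      fix k
      show "a k \<one>\<^bsub>G\<^esub> = 0"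
      proof (cases "k \<in> carrier G")
        case True
        then obtain i where "i \<in> Y" "k = g i"
          using assms(2) by (auto simp: bij_betw_def)
        then show ?thesis
          using 0[of i] a(2) by (simp add: eval)
      next
        case False
        then show ?thesis
          using bounded_ops_supp[OF subgroup_ops_bounded[OF a(1)]] by blast
      qed
    qed
    then show "b = 0"
      by (simp add: a tr_op_zero)
  qed
qed

lemma tracial_group_vna:
  assumes "group G"
  shows "tracial_vna (group_vna G)"
proof -
  have "tr_op (carrier G) id a = a" if "a \<in> subgroup_ops G (carrier G)" for a
    using bounded_ops_supp[OF subgroup_ops_bounded[OF that]] by (auto simp: tr_op_def fun_eq_iff)
  then have "tr_op (carrier G) id ` subgroup_ops G (carrier G) = subgroup_ops G (carrier G)"
    by force
  then show ?thesis
    using tracial_vna_tr_group[OF assms bij_betw_id, of "\<one>\<^bsub>G\<^esub>"] assms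
    by (simp add: group_vna_def group.is_monoid)
qed

section \<open>Invariance under group isomorphisms and one-fold tensor powers\<close>

lemma group_vna_simps [simp]:
  "base (group_vna G) = carrier G" "ops (group_vna G) = subgroup_ops G (carrier G)"
  "trc (group_vna G) = (\<lambda>a. a \<one>\<^bsub>G\<^esub> \<one>\<^bsub>G\<^esub>)"
  by (simp_all add: group_vna_def)

lemma value_in_group_vna_iso:
  assumes "group G" "group H" "G \<cong> H"
  shows "value_in (group_vna G) \<theta> = value_in (group_vna H) \<theta>"
proof -
  obtain \<phi> where \<phi>: "\<phi> \<in> iso G H"
    using assms(3) by (auto simp: is_iso_def)
  then have hom: "\<phi> \<in> hom G H" and bij: "bij_betw \<phi> (carrier G) (carrier H)"
    by (auto simp: iso_def)
  \<comment> \<open>Composition with \<phi> pulls matrices back, so the isomorphism from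
    \<open>G\<close> to \<open>H\<close> carries the algebra of \<open>H\<close> to that of
    \<open>G\<close>.\<close>
  interpret transport "carrier H" "carrier G" \<phi>
    by unfold_locales (rule bij)
  have mult: "\<phi> x = \<phi> g \<otimes>\<^bsub>H\<^esub> \<phi> y \<longleftrightarrow> x = g \<otimes>\<^bsub>G\<^esub> y"
    if "x \<in> carrier G" "y \<in> carrier G" "g \<in> carrier G" for x y g
  proof -
    have "g \<otimes>\<^bsub>G\<^esub> y \<in> carrier G"
      using that assms(1) by (simp add: group.is_monoid monoid.m_closed)
    then have "\<phi> x = \<phi> (g \<otimes>\<^bsub>G\<^esub> y) \<longleftrightarrow> x = g \<otimes>\<^bsub>G\<^esub> y"
      by (rule inj_on_eq_iff[OF bij_betw_imp_inj_on[OF bij] that(1)])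
    then show ?thesis
      using that by (simp add: hom_mult[OF hom])
  qed
  have "tr (translation H (\<phi> g)) = translation G g" if "g \<in> carrier G" for g
    using that g_in by (auto simp: tr_op_def translation_def fun_eq_iff mult)
  then have "tr ` translation H ` carrier H = translation G ` carrier G"
    unfolding bij_betw_imp_surj_on[OF bij, symmetric] by (simp add: image_image)
  then have ops: "subgroup_ops G (carrier G) = tr ` subgroup_ops H (carrier H)"
    using vN_gen_tr[OF translations_bounded[OF assms(2)]] by (simp add: subgroup_ops_def)
  interpret tvna_transport "carrier H" "carrier G" \<phi> "group_vna H" "group_vna G"
    using vna_group[OF assms(2)] hom_one[OF hom assms(1,2)] assms(1)
    by unfold_locales (simp_all add: ops, simp add: tr_op_def group.is_monoid)
  show ?thesis
    by (rule value_in_tr)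
qed

lemma value_in_tensor_power_1:
  assumes "group G"
  shows "value_in (tensor_power (group_vna G) 1) \<theta> = value_in (group_vna G) \<theta>"
proof -
  let ?X = "carrier G" and ?A = "subgroup_ops G (carrier G)"
  define Y where "Y = {xs. length xs = 1 \<and> set xs \<subseteq> ?X}"
  define E where "E = {as. length as = 1 \<and> set as \<subseteq> ?A}"
  have Y: "Y = (\<lambda>x. [x]) ` ?X"
    by (auto simp: Y_def length_Suc_conv)
  have E: "E = (\<lambda>a. [a]) ` ?A"
    by (auto simp: E_def length_Suc_conv)
  have bij: "bij_betw hd Y ?X"
    by (rule bij_betwI[where g = "\<lambda>x. [x]"]) (auto simp: Y)
  interpret transport ?X Y hd
    by unfold_locales (rule bij)
  have kron: "kron_list [a] = tr a" if "a \<in> ?A" for a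
  proof -
    have "i \<in> ?X" "j \<in> ?X" if "a i j \<noteq> 0" for i j
      using bounded_ops_supp[OF subgroup_ops_bounded[OF \<open>a \<in> ?A\<close>]] that by blast+
    then show ?thesis
      by (fastforce simp: kron_list_def tr_op_def Y_def fun_eq_iff length_Suc_conv)
  qed
  then have "kron_list ` E = tr ` ?A"
    by (simp add: E image_image)
  moreover have "vN_gen Y (tr ` ?A) = tr ` ?A"
    by (intro vna.vN_gen_self vna.intro von_neumann_algebra_tr vna_group assms)
  ultimately have gen: "vN_gen Y (kron_list ` E) = tr ` ?A"
    by simp
  define P where "P \<sigma> \<longleftrightarrow> tracial_vna \<lparr>base = Y, ops = tr ` ?A, trc = \<sigma>\<rparr> \<and>
    (\<forall>as\<in>E. \<sigma> (kron_list as) = (\<Prod>a\<leftarrow>as. trc (group_vna G) a))" for \<sigma>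
  have one: "[\<one>\<^bsub>G\<^esub>] \<in> Y"
    using assms by (auto simp: Y group.is_monoid)
  \<comment> \<open>Some functional satisfying the specification has to exist before
    \<open>SOME\<close> says anything; the vector state at the singleton list of the identity is
    one.\<close>
  then have "P (\<lambda>b. b [\<one>\<^bsub>G\<^esub>] [\<one>\<^bsub>G\<^esub>])"
    using tracial_vna_tr_group[OF assms bij one]
    by (auto simp: P_def E kron) (simp add: tr_op_def)
  then have P: "P (SOME \<sigma>. P \<sigma>)"
    by (rule someI[of P])
  have "tensor_power (group_vna G) 1 = \<lparr>base = Y, ops = tr ` ?A, trc = (SOME \<sigma>. P \<sigma>)\<rparr>"
    using gen unfolding P_def by (simp add: tensor_power_def Let_def Y_def E_def)
  \<comment> \<open>With a single factor every element of the algebra is an elementary tensor, so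
    the prescribed values fix the chosen trace on the whole algebra.\<close>
  moreover have "(SOME \<sigma>. P \<sigma>) (tr a) = a \<one>\<^bsub>G\<^esub> \<one>\<^bsub>G\<^esub>" if "a \<in> ?A" for a
    using P that by (auto simp: P_def E simp flip: kron)
  ultimately interpret tvna_transport ?X Y hd "group_vna G" "tensor_power (group_vna G) 1"
    using vna_group[OF assms] by unfold_locales auto
  show ?thesis
    by (rule value_in_tr)
qed

text \<open>With \<open>m = 0\<close> the inequality would say that \<open>L(T\<^sub>0(\<Gamma>)) \<otimes> Q\<close> is zero; we test this
  on \<open>Q = \<complex>\<close>, realized as the algebra of a trivial group.\<close>

lemma nonamenability_constants_pos:
  assumes "group \<Gamma>" "nonamenability_constants TYPE('h) \<Gamma> m C"
  shows "1 \<le> m"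
proof (rule ccontr)
  assume "\<not> 1 \<le> m"
  then have m: "m = 0"
    by simp
  \<comment> \<open>The test algebra has to act on a set of elements of the fixed type
    \<open>'h\<close>; every type has an element, and one point is enough for the complex
    numbers.\<close>
  define q :: 'h where "q = undefined"
  define T :: "'h monoid" where "T = \<lparr>carrier = {q}, monoid.mult = (\<lambda>_ _. q), one = q\<rparr>"
  define G where "G = T0 \<Gamma>"
  have G: "group G"
    unfolding G_def using assms(1) by (rule group_T0)
  have T: "group T"
    by (rule groupI) (auto simp: T_def)
  let ?X = "carrier G" and ?A = "subgroup_ops G (carrier G)"
  let ?B = "subgroup_ops T (carrier T)"
  define Y where "Y = ?X \<times> {q}"
  have bij: "bij_betw fst Y ?X"
    by (rule bij_betwI[where g = "\<lambda>x. (x, q)"]) (auto simp: Y_def)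
  interpret transport ?X Y fst
    by unfold_locales (rule bij)
  interpret A: vna ?X ?A
    by unfold_locales (rule vna_group[OF G])
  interpret B: vna "carrier T" ?B
    by unfold_locales (rule vna_group[OF T])
  have kron: "kron a b = tr (op_scale (b q q) a)" if "a \<in> ?A" "b \<in> ?B" for a b
  proof -
    have "i \<in> ?X" "j \<in> ?X" if "a i j \<noteq> 0" for i j
      using bounded_ops_supp[OF subgroup_ops_bounded[OF \<open>a \<in> ?A\<close>]] that by blast+
    moreover have "i = q" "j = q" if "b i j \<noteq> 0" for i j
      using bounded_ops_supp[OF subgroup_ops_bounded[OF \<open>b \<in> ?B\<close>], of i j] that
      by (auto simp: T_def)
    ultimately show ?thesis
      by (fastforce simp: kron_def tr_op_def op_scale_def Y_def fun_eq_iff)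
  qed
  have "{kron a b | a b. a \<in> ?A \<and> b \<in> ?B} = tr ` ?A"
  proof
    show "{kron a b | a b. a \<in> ?A \<and> b \<in> ?B} \<subseteq> tr ` ?A"
      using kron A.scale_closed by auto
    have "tr a = kron a (op_one (carrier T))" if "a \<in> ?A" for a
      using kron[OF that B.one_closed] by (simp add: op_one_def T_def op_scale_def)
    then show "tr ` ?A \<subseteq> {kron a b | a b. a \<in> ?A \<and> b \<in> ?B}"
      using B.one_closed by blast
  qed
  moreover have "vN_gen Y (tr ` ?A) = tr ` ?A"
    by (intro vna.vN_gen_self vna.intro von_neumann_algebra_tr vna_group G)
  ultimately have gen: "tensor_ops ?X ?A (carrier T) ?B = tr ` ?A"
    by (simp add: tensor_ops_def Y_def T_def)
  define P where "P \<sigma> \<longleftrightarrow> tracial_vna \<lparr>base = Y, ops = tr ` ?A, trc = \<sigma>\<rparr> \<and>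
    (\<forall>a\<in>?A. \<forall>b\<in>?B. \<sigma> (kron a b) = trc (group_vna G) a * trc (group_vna T) b)" for \<sigma>
  have one: "(\<one>\<^bsub>G\<^esub>, q) \<in> Y"
    using G by (auto simp: Y_def group.is_monoid)
  have "P (\<lambda>b. b (\<one>\<^bsub>G\<^esub>, q) (\<one>\<^bsub>G\<^esub>, q))"
    using tracial_vna_tr_group[OF G bij one] by (simp add: P_def) (simp add: kron_def T_def)
  then have P: "P (SOME \<sigma>. P \<sigma>)"
    by (rule someI[of P])
  define M where "M = tensor (group_vna G) (group_vna T)"
  have M: "M = \<lparr>base = Y, ops = tr ` ?A, trc = (SOME \<sigma>. P \<sigma>)\<rparr>"
    using gen unfolding M_def P_def tensor_def Let_def by (simp add: Y_def T_def)
  then have tracial: "tracial_vna M"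
    using P by (simp add: P_def)
  have one_M: "op_one Y \<in> ops M"
    using A.one_closed by (simp add: M flip: tr_one)
  have "norm2 M (op_one Y) = 1"
    using tracial by (simp add: norm2_def op_adj_one op_one_mult bounded_ops_one tracial_vna_def M)
  \<comment> \<open>For m = 0 the sum is empty and there are no conditions on the unitaries, so the
    inequality at n = 1 bounds the norm of the unit by 0.\<close>
  moreover have "norm2 M (op_one Y) \<le> 0"
    using assms(2) tracial_group_vna[OF T] one_M unfolding nonamenability_constants_def m M_def G_def
    by (auto simp: Let_def dest!: spec[of _ "group_vna T"] spec[of _ 1] spec[of _ "op_one Y"])
  ultimately show False
    by simp
qed


theorem corollary4p6:
  fixes \<Gamma> :: "'g monoid" and n :: nat
    and \<alpha> \<beta> \<beta>' :: "bool word"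
    and \<phi>le :: fm and rel pnf :: "fm \<Rightarrow> fm"
    and m :: "nat monoid \<Rightarrow> nat" and C :: "nat monoid \<Rightarrow> real"
    and r :: "nat monoid \<Rightarrow> nat \<Rightarrow> real"
  assumes "group \<Gamma>" and "countable (carrier \<Gamma>)"
    and "phi_le_spec TYPE('h::infinite) \<phi>le"
    and "relativization_spec TYPE('h) rel"
    and "prenex_form_spec TYPE('h) pnf"
    and "\<And>\<Delta>. group \<Delta> \<Longrightarrow> \<not> amenable \<Delta> \<Longrightarrow> nonamenability_constants TYPE('h) \<Delta> (m \<Delta>) (C \<Delta>)"
    and "lower_bounds_spec \<phi>le rel pnf m r"
    and "\<And>i. i < n - 1 \<Longrightarrow> \<alpha> i = \<beta> i"
    and "\<alpha> n = True" and "\<beta> n = False"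
    and "\<beta> = prefix (n + 1) \<beta> \<frown> \<beta>'"
  shows "value_in (group_vna (K_lim \<alpha> \<Gamma>)) (theta \<phi>le rel pnf (m (K_lim \<beta>' \<Gamma>)) (n + 1)) = 0
       \<and> value_in (group_vna (K_lim \<beta> \<Gamma>)) (theta \<phi>le rel pnf (m (K_lim \<beta>' \<Gamma>)) (n + 1))
           \<ge> r (K_lim \<beta>' \<Gamma>) (n + 1)"
proof -
  define \<Delta> where "\<Delta> \<xi> = K_lim (suffix (n + 1) \<xi>) \<Gamma>" for \<xi>
  have \<Delta>: "group (\<Delta> \<xi>)" "\<not> amenable (\<Delta> \<xi>)" for \<xi>
    using assms(1,2) by (simp_all only: \<Delta>_def group_K_lim not_amenable_K_lim not_False_eq_True)
  have "\<beta>' = suffix (n + 1) \<beta>"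
    by (subst assms(11)) (simp add: conc_def fun_eq_iff)
  then have \<beta>': "K_lim \<beta>' \<Gamma> = \<Delta> \<beta>"
    by (simp only: \<Delta>_def)
  have m: "1 \<le> m (\<Delta> \<beta>)"
    using nonamenability_constants_pos[OF \<Delta>(1) assms(6)[OF \<Delta>]] .
  \<comment> \<open>The specification looks at position (n + 1) - 1 of a list of length n + 1, which
    is the letter at n because sequences start at 0.\<close>
  have last: "prefix (n + 1) \<xi> ! n = \<xi> n" for \<xi> :: "bool word"
    by (simp add: nth_append)
  have value_eq: "value_in (tensor_power (group_vna (K_fin (prefix (n + 1) \<xi>) (\<Delta> \<xi>))) 1) \<theta> =
      value_in (group_vna (K_lim \<xi> \<Gamma>)) \<theta>" for \<xi> \<theta>
  proof -
    have K: "group (K_fin (prefix (n + 1) \<xi>) (\<Delta> \<xi>))"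
      by (intro group_K_fin \<Delta>) auto
    have "K_lim \<xi> \<Gamma> \<cong> K_fin (prefix (n + 1) \<xi>) (\<Delta> \<xi>)"
      unfolding \<Delta>_def by (rule K_lim_iso_K_fin[OF assms(1,2)])
    with group_K_lim[OF assms(1,2)] K show ?thesis
      unfolding value_in_tensor_power_1[OF K] by (rule value_in_group_vna_iso[symmetric])
  qed
  have bounds: "(\<xi> n \<longrightarrow> (\<forall>k\<ge>1. value_in (group_vna (K_lim \<xi> \<Gamma>)) (theta \<phi>le rel pnf k (n + 1)) = 0)) \<and>
      (\<not> \<xi> n \<longrightarrow> r (\<Delta> \<xi>) (n + 1) \<le> value_in (group_vna (K_lim \<xi> \<Gamma>)) (theta \<phi>le rel pnf (m (\<Delta> \<xi>)) (n + 1)))"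
    for \<xi>
  proof -
    have "length (prefix (n + 1) \<xi>) = n + 1"
      by simp
    with assms(7) \<Delta> show ?thesis
      unfolding lower_bounds_spec_def Let_def
      by (metis value_eq last add_diff_cancel_right' le_add2 order_refl)
  qed
  show ?thesis
    \<comment> \<open>For \<alpha> the bounds concern its own remainder
      \<open>\<Delta> \<alpha>\<close>, but the vanishing holds for all k \<ge> 1 and is applied to
      k = \<open>m (\<Delta> \<beta>)\<close>.\<close>
    using bounds[of \<alpha>] bounds[of \<beta>] assms(9,10) m by (simp add: \<beta>')
qed

end
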